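(* There is an absolute constant $c>0$ so that the following holds. Let $n\ge 1$, let $0\le\Delta\le(\log n)^{1/4}$ be an integer, and let $(\log n)^{-1/16}\le p\le 1-(\log n)^{-1/16}$. Sample $G\sim\mathbb{G}(2n+\Delta,p)$ on vertex set $V$ with $|V|=2n+\Delta$, fix a partition $V=R_0\sqcup B_0$ with $|R_0|=n+\Delta$ and $|B_0|=n$, and run majority dynamics on $G$ starting from $B_0\sqcup R_0$. Then with probability at least $1-O(n^{-c})$, one of $|R_1|,|B_1|$ is strictly larger than the other and the corresponding color wins by step $3$ (i.e. $R_3=V$ if $|R_1|>|B_1|$, and $B_3=V$ if $|B_1|>|R_1|$). Furthermore, \[\mathbb{P}[|R_3|=2n+\Delta]=\Phi\bigg(\frac{p\Delta\sqrt{2}}{\sqrt{\pi p(1-p)}}\bigg)+O(n^{-c}),\] where $\Phi$ is the cumulative distribution function of $\mathcal{N}(0,1)$. The implied constants in $O(\cdot)$ are absolute.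
   Context: Majority dynamics: given a graph $G$ with a bipartition $B_0\sqcup R_0$ of its vertex set, for each $i\ge0$ the partition $B_{i+1}\sqcup R_{i+1}$ is obtained from $B_i\sqcup R_i$ by moving to the other side precisely those vertices which have strictly more neighbors on the other side of the partition $B_i\sqcup R_i$ than on their own side (vertices with equally many neighbors on both sides stay). Blue (resp. red) wins by step $k$ if $B_k=B_0\cup R_0$ (resp. $R_k=B_0\cup R_0$). $\mathbb{G}(N,p)$ is the Erdős–Rényi random graph on $N$ vertices with each edge present independently with probability $p$. *)

theory Defs
  imports "HOL-Probability.Probability"
begin

text \<open>A simple graph on a vertex set \<open>V\<close> is given by its edge set, a subset of \<open>all_edges V\<close>.\<close>

definition all_edges :: "'a set \<Rightarrow> 'a set set" where
  "all_edges V = {e. e \<subseteq> V \<and> card e = 2}"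

definition neighbors :: "'a set set \<Rightarrow> 'a \<Rightarrow> 'a set" where
  "neighbors E v = {u. {v, u} \<in> E}"

definition erdos_renyi :: "'a set \<Rightarrow> real \<Rightarrow> 'a set set pmf" where
  "erdos_renyi V p =
     map_pmf (\<lambda>f. {e \<in> all_edges V. f e})
       (Pi_pmf (all_edges V) False (\<lambda>_. bernoulli_pmf p))"

definition moves :: "'a set set \<Rightarrow> 'a set \<Rightarrow> 'a set \<Rightarrow> 'a \<Rightarrow> bool" where
  "moves E own other v \<longleftrightarrow>
     card (neighbors E v \<inter> other) > card (neighbors E v \<inter> own)"

text \<open>States are pairs (blue set, red set).\<close>

definition majority_step :: "'a set set \<Rightarrow> 'a set \<times> 'a set \<Rightarrow> 'a set \<times> 'a set" where
  "majority_step E = (\<lambda>(B, R).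
     ({v \<in> B. \<not> moves E B R v} \<union> {v \<in> R. moves E R B v},
      {v \<in> R. \<not> moves E R B v} \<union> {v \<in> B. moves E B R v}))"

definition blue :: "'a set set \<Rightarrow> 'a set \<Rightarrow> 'a set \<Rightarrow> nat \<Rightarrow> 'a set" where
  "blue E B0 R0 k = fst ((majority_step E ^^ k) (B0, R0))"

definition red :: "'a set set \<Rightarrow> 'a set \<Rightarrow> 'a set \<Rightarrow> nat \<Rightarrow> 'a set" where
  "red E B0 R0 k = snd ((majority_step E ^^ k) (B0, R0))"

definition blue_wins_by :: "'a set set \<Rightarrow> 'a set \<Rightarrow> 'a set \<Rightarrow> nat \<Rightarrow> bool" where
  "blue_wins_by E B0 R0 k \<longleftrightarrow> blue E B0 R0 k = B0 \<union> R0"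

definition red_wins_by :: "'a set set \<Rightarrow> 'a set \<Rightarrow> 'a set \<Rightarrow> nat \<Rightarrow> bool" where
  "red_wins_by E B0 R0 k \<longleftrightarrow> red E B0 R0 k = B0 \<union> R0"

end

theory Submission
  imports Defs "HOL-Real_Asymp.Real_Asymp"
begin

text \<open>
  Let \<open>S\<^sub>1\<close> be the number of red minus the number of blue vertices after one step. The edges at a single vertex \<open>v\<close> are
  independent of the remaining graph and influence the colors of the other vertices only through the roughly \<open>\<surd>n\<close> vertices
  whose neighborhoods are tied up to the edge to \<open>v\<close>. Resampling the edges at \<open>v\<close> therefore changes \<open>S\<^sub>1\<close> by a
  centered sum of order \<open>n\<^bsup>1/4\<^esup>\<close> that is almost uncorrelated with the color of \<open>v\<close>, and Stein's method gives a normal limit for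
  \<open>S\<^sub>1\<close> with polynomial rate, variance \<open>2n + \<Delta>\<close> and the mean read off from a local limit law for binomials. In particular
  \<open>|S\<^sub>1| \<ge> n\<^bsup>1/2 - \<epsilon>\<^esup>\<close> with probability \<open>1 - O(n\<^bsup>-c\<^esup>)\<close>. Resampling at a vertex also computes the conditional mean of its
  color after two steps and shows that the colors of two vertices are almost uncorrelated given \<open>S\<^sub>1\<close>, so the majority of
  \<open>S\<^sub>1\<close> becomes a majority of at least \<open>n\<^bsup>1 - 2\<epsilon>\<^esup>\<close> after step 2. Finally, up to few exceptions the colors after
  step 2 are determined by the graph without \<open>v\<close>, so by Hoeffding's inequality every \<open>v\<close> sees this majority among its neighbors.
\<close>

section \<open>The standard normal distribution and Stein's method\<close>

text \<open>Moment methods give only polynomially small failure probabilities, which do not survive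
  a union bound over vertices. Hence two kinds of statements: totals over V (\<open>S1\<close>,
  \<open>S2\<close>, \<open>ZZ\<close>, \<open>QQ\<close>) are controlled once, with polynomial
  error; only sums over the edges at one vertex, with coefficients fixed by the rest of the graph,
  are controlled at every vertex simultaneously, with error of order n^(-5). In the central limit
  theorem absolute moment bounds on the effect of one row just fail: the first-order error would
  exceed the main term by n^(1/4), the second-order error would have its size. Both need
  cancellation, hence point probabilities to relative precision: error n^(-2/3) against size about
  n^(-1/2). The mean color of w at time 2 depends on more than \<open>S1\<close>: the vertices
  pivotal for w shift the vote it sees towards its initial color by order sqrt n, as large as
  \<open>S1\<close> itself. The shifts are opposite for red and blue and harmless in the sum because
  the normal law is symmetric. As p stays a power of log n away from 0 and 1, its influence
  disappears in powers n^(1/1000).\<close>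

abbreviation (input) Phi :: "real \<Rightarrow> real" where "Phi \<equiv> cdf std_normal_distribution"

lemma Phi_diff: assumes "a \<le> b" shows "Phi b - Phi a = integral {a..b} std_normal_density"
proof (cases "a = b")
  case False
  then have ab: "a < b" using assms by simp
  interpret real_distribution std_normal_distribution by (rule real_dist_normal_dist)
  have "Phi b - Phi a = measure std_normal_distribution {a<..b}"
    using cdf_diff_eq[OF ab] by simp
  also have "\<dots> = integral\<^sup>L std_normal_distribution (indicat_real {a<..b})"
    by simp
  also have "\<dots> = (\<integral>x\<in>{a<..b}. std_normal_density x \<partial>lborel)"
    by (subst integral_density) (auto simp: set_lebesgue_integral_def mult.commute)
  also have "\<dots> = integral {a<..b} std_normal_density"
    by (rule set_borel_integral_eq_integral(2))
      (unfold set_integrable_def, rule integrable_mult_indicator, auto)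
  also have "\<dots> = integral {a..b} std_normal_density"
    by (rule integral_spike_set; rule negligible_subset[of "{a}"]) auto
  finally show ?thesis .
qed simp

lemma Phi_deriv: "(Phi has_real_derivative std_normal_density x) (at x)"
proof -
  have cont: "continuous_on {x-1..x+1} std_normal_density"
    by (auto simp: std_normal_density_def intro!: continuous_intros)
  have "((\<lambda>y. integral {x-1..y} std_normal_density) has_real_derivative std_normal_density x) (at x within {x-1..x+1})"
    by (rule integral_has_real_derivative[OF cont]) auto
  then have "((\<lambda>y. integral {x-1..y} std_normal_density + Phi (x-1)) has_real_derivative std_normal_density x) (at x within {x-1..x+1})"
    by (auto intro!: derivative_eq_intros)
  then have "(Phi has_real_derivative std_normal_density x) (at x within {x-1..x+1})"
    by (rule has_field_derivative_transform_within[where d=1])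
       (auto, smt (verit) Phi_diff)
  moreover have "at x within {x-1..x+1} = at x"
    by (rule at_within_interior) auto
  ultimately show ?thesis by simp
qed

lemma Phi_mono: "x \<le> y \<Longrightarrow> Phi x \<le> Phi y"
proof -
  interpret real_distribution std_normal_distribution by (rule real_dist_normal_dist)
  show "x \<le> y \<Longrightarrow> Phi x \<le> Phi y" by (rule cdf_nondecreasing)
qed

lemma Phi_range: "0 \<le> Phi x" "Phi x \<le> 1"
proof -
  interpret real_distribution std_normal_distribution by (rule real_dist_normal_dist)
  show "0 \<le> Phi x" "Phi x \<le> 1" by (rule cdf_nonneg, rule cdf_bounded_prob)
qed

text \<open>Chebyshev's inequality with the unit second moment. Quadratic decay is enough, since all
  later errors are only tracked up to powers.\<close>

lemma Phi_tail: assumes "y > 0" shows "Phi (-y) \<le> 1 / y\<^sup>2" "1 - Phi y \<le> 1 / y\<^sup>2"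
proof -
  interpret real_distribution std_normal_distribution by (rule real_dist_normal_dist)
  have int2: "integrable lborel (\<lambda>x. std_normal_density x * x\<^sup>2)"
    by (rule integrable_std_normal_moment)
  have "(\<integral>x. x\<^sup>2 \<partial>std_normal_distribution) = (\<integral>x. std_normal_density x * x\<^sup>2 \<partial>lborel)"
    by (subst integral_density) auto
  also have "\<dots> = 1"
    using integral_std_normal_moment_even[of 1] by simp
  finally have e: "(\<integral>x. x\<^sup>2 \<partial>std_normal_distribution) = 1" .
  have i: "integrable std_normal_distribution (\<lambda>x. x\<^sup>2)"
    by (subst integrable_density) (use int2 in auto)
  have m: "measure std_normal_distribution {x. y\<^sup>2 \<le> x\<^sup>2} \<le> 1 / y\<^sup>2"
    using integral_Markov_inequality_measure[OF i, of "{}" "y\<^sup>2"] e assms by auto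
  have "Phi (-y) \<le> measure std_normal_distribution {x. y\<^sup>2 \<le> x\<^sup>2}"
    unfolding cdf_def by (rule finite_measure_mono) (use assms in \<open>auto simp: abs_le_square_iff[symmetric]\<close>)
  then show "Phi (-y) \<le> 1 / y\<^sup>2" using m by simp
  have "1 - Phi y = measure std_normal_distribution (UNIV - {..y})"
    unfolding cdf_def using prob_compl[of "{..y}"] by simp
  also have "\<dots> \<le> measure std_normal_distribution {x. y\<^sup>2 \<le> x\<^sup>2}"
    by (rule finite_measure_mono) (use assms in \<open>auto simp: abs_le_square_iff[symmetric]\<close>)
  finally show "1 - Phi y \<le> 1 / y\<^sup>2" using m by simp
qed

section \<open>Rational bounds for the normal density and its derivatives\<close>

lemma std_normal_density_le: "std_normal_density z \<le> 1 / (1 + z\<^sup>2/2 + z^4/8)"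
proof -
  have "1 + z\<^sup>2/2 + (z\<^sup>2/2)\<^sup>2/2 \<le> exp (z\<^sup>2/2)"
    using exp_lower_Taylor_quadratic[of "z\<^sup>2/2"] by simp
  moreover have "(z\<^sup>2/2)\<^sup>2/2 = z^4/8" by (simp add: power2_eq_square power4_eq_xxxx)
  ultimately have "exp (- z\<^sup>2/2) \<le> 1 / (1 + z\<^sup>2/2 + z^4/8)"
    by (simp add: exp_minus field_simps add_pos_nonneg)
  moreover have "1 / sqrt (2*pi) \<le> 1" using pi_gt3 by (simp add: real_le_rsqrt)
  ultimately show ?thesis unfolding std_normal_density_def
    by (smt (verit) exp_gt_zero mult_left_le_one_le mult_nonneg_nonneg zero_le_divide_1_iff real_sqrt_ge_zero pi_gt_zero)
qed

lemma std_normal_density_le_1: "std_normal_density z \<le> 1"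
  using order_trans[OF std_normal_density_le, of z 1] by (auto simp: field_simps add_pos_nonneg)

text \<open>Turns a bound on a polynomial times the density into a polynomial inequality; the
  quartic dominates the cubic that occurs in the third derivative.\<close>

lemma poly_std_normal_density_le:
  assumes "\<bar>c\<bar> \<le> 4 * (1 + z\<^sup>2/2 + z^4/8)" shows "\<bar>c * std_normal_density z\<bar> \<le> 4"
proof -
  have p: "1 + z\<^sup>2/2 + z^4/8 > 0" by (simp add: add_pos_nonneg)
  have "\<bar>c * std_normal_density z\<bar> = \<bar>c\<bar> * std_normal_density z" by (simp add: abs_mult)
  also have "\<dots> \<le> (4 * (1 + z\<^sup>2/2 + z^4/8)) * (1 / (1 + z\<^sup>2/2 + z^4/8))"
    using assms p std_normal_density_le by (intro mult_mono) auto
  also have "\<dots> = 4" using p by (simp add: field_simps)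
  finally show ?thesis .
qed

lemma std_normal_density_derivs:
  "(std_normal_density has_real_derivative - z * std_normal_density z) (at z)"
  "((\<lambda>z. - z * std_normal_density z) has_real_derivative (z\<^sup>2 - 1) * std_normal_density z) (at z)"
  "((\<lambda>z. (z\<^sup>2 - 1) * std_normal_density z) has_real_derivative (3 * z - z^3) * std_normal_density z) (at z)"
proof -
  show d: "(std_normal_density has_real_derivative - z * std_normal_density z) (at z)" for z
  proof -
    have "((\<lambda>z. exp (- z\<^sup>2 / 2)) has_real_derivative - z * exp (- z\<^sup>2 / 2)) (at z)"
      by (auto intro!: derivative_eq_intros)
    from DERIV_cmult[OF this, of "1 / sqrt (2 * pi)"] show ?thesis
      unfolding std_normal_density_def by (simp only: mult.left_commute)
  qed
  show "((\<lambda>z. - z * std_normal_density z) has_real_derivative (z\<^sup>2 - 1) * std_normal_density z) (at z)"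
    by (rule derivative_eq_intros d refl)+ (simp add: algebra_simps power2_eq_square)
  show "((\<lambda>z. (z\<^sup>2 - 1) * std_normal_density z) has_real_derivative (3 * z - z^3) * std_normal_density z) (at z)"
    by (rule derivative_eq_intros d refl)+ (simp add: algebra_simps power2_eq_square power3_eq_cube)
qed

text \<open>One common constant for the orders 0 to 3, the orders on which
  \<open>stein_bound\<close> tests.\<close>

lemma std_normal_density_deriv_bounds:
  "\<bar>std_normal_density z\<bar> \<le> 4" "\<bar>- z * std_normal_density z\<bar> \<le> 4"
  "\<bar>(z\<^sup>2 - 1) * std_normal_density z\<bar> \<le> 4" "\<bar>(3 * z - z^3) * std_normal_density z\<bar> \<le> 4"
proof -
  have z1: "2 * \<bar>z\<bar> \<le> 1 + z\<^sup>2"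
    using zero_le_power2[of "\<bar>z\<bar> - 1"] by (simp add: power2_eq_square algebra_simps)
  have "0 \<le> \<bar>z\<bar>\<^sup>2 * (\<bar>z\<bar> - 1)\<^sup>2" by simp
  then have z3: "2 * \<bar>z\<bar>^3 \<le> z\<^sup>2 + z^4"
    by (simp add: power2_eq_square power3_eq_cube power4_eq_xxxx algebra_simps)
  show "\<bar>std_normal_density z\<bar> \<le> 4" using std_normal_density_le_1[of z] by simp
  show "\<bar>- z * std_normal_density z\<bar> \<le> 4" 
  proof (rule poly_std_normal_density_le)
    have "0 \<le> z^4" by simp
    then show "\<bar>- z\<bar> \<le> 4 * (1 + z\<^sup>2/2 + z^4/8)" using z1 zero_le_power2[of z] unfolding abs_minus_cancel by argo
  qed
  show "\<bar>(z\<^sup>2 - 1) * std_normal_density z\<bar> \<le> 4"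
    by (rule poly_std_normal_density_le) (auto simp: abs_le_iff add_nonneg_nonneg)
  have "\<bar>3 * z - z^3\<bar> \<le> 3 * \<bar>z\<bar> + \<bar>z\<bar>^3" by (simp add: abs_le_iff power_abs[symmetric]) (auto simp: abs_if)
  then show "\<bar>(3 * z - z^3) * std_normal_density z\<bar> \<le> 4"
    using z1 z3 by (intro poly_std_normal_density_le) auto
qed

lemma Phi_lipschitz: "\<bar>Phi x - Phi y\<bar> \<le> \<bar>x - y\<bar>"
proof -
  have "norm (Phi x - Phi y) \<le> 1 * norm (x - y)"
    by (rule field_differentiable_bound[where S=UNIV and f'=std_normal_density])
       (use std_normal_density_le_1 Phi_deriv in \<open>auto\<close>)
  then show ?thesis by simp
qed

lemma Phi_diff_ge:
  assumes "a \<le> b" "\<And>z. a \<le> z \<Longrightarrow> z \<le> b \<Longrightarrow> m \<le> std_normal_density z"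
  shows "m * (b - a) \<le> Phi b - Phi a"
proof (cases "a = b")
  case False
  then have "a < b" using assms by simp
  then obtain z where "a < z" "z < b" "Phi b - Phi a = (b - a) * std_normal_density z"
    using MVT2[of a b Phi std_normal_density] Phi_deriv by blast
  then show ?thesis using assms(2)[of z] \<open>a < b\<close> by (simp add: mult.commute mult_left_mono)
qed simp

text \<open>The density is even, so Phi x + Phi (-x) has derivative 0; the tail bounds far out
  identify the constant as 1.\<close>

lemma Phi_minus: "Phi (- x) = 1 - Phi x"
proof -
  have d: "((\<lambda>x. Phi x + Phi (-x)) has_real_derivative 0) (at x)" for x
  proof -
    have "((\<lambda>x. Phi (-x)) has_real_derivative std_normal_density (-x) * (-1)) (at x)"
      by (rule DERIV_chain2[OF Phi_deriv]) (auto intro!: derivative_eq_intros)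
    moreover have "std_normal_density (-x) = std_normal_density x"
      by (simp add: std_normal_density_def)
    ultimately show ?thesis using DERIV_add[OF Phi_deriv[of x]] by force
  qed
  then have c: "Phi x + Phi (-x) = Phi y + Phi (-y)" for x y
    by (rule DERIV_isconst_all[rule_format, of "\<lambda>x. Phi x + Phi (-x)"]) 
  have b: "\<bar>Phi x + Phi (-x) - 1\<bar> \<le> 2 / y\<^sup>2" if "y > 0" for y
    using c[of x y] Phi_tail[OF that] Phi_range[of y] Phi_range[of "-y"] 
    by (simp only: abs_le_iff) linarith
  have e: "\<bar>Phi x + Phi (-x) - 1\<bar> \<le> 0 + e" if "e > 0" for e
  proof -
    have "(sqrt (2 / e))\<^sup>2 = 2 / e" "0 < sqrt (2/e)" using that by auto
    then show ?thesis using b[of "sqrt (2 / e)"] that by simp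
  qed
  have "\<bar>Phi x + Phi (-x) - 1\<bar> \<le> 0" by (rule field_le_epsilon[OF e])
  then show ?thesis by linarith
qed

text \<open>The two arguments differ by about eps^2 * |y|, which is unbounded in y. The decay of the
  density, taken at the endpoint nearer 0, pays for the factor |y| and makes the bound
  uniform.\<close>

lemma Phi_rescale: "\<bar>Phi (y / sqrt (1 + \<epsilon>\<^sup>2)) - Phi y\<bar> \<le> \<epsilon>\<^sup>2"
proof -
  let ?s = "sqrt (1 + \<epsilon>\<^sup>2)"
  define y' where "y' = y / ?s"
  have s1: "1 \<le> ?s" by simp
  have s2: "?s - 1 \<le> \<epsilon>\<^sup>2 / 2"
  proof -
    have "?s \<le> sqrt ((1 + \<epsilon>\<^sup>2/2)\<^sup>2)" by (rule real_sqrt_le_mono) (simp add: power2_sum)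
    then show ?thesis by simp
  qed
  have y: "y = y' * ?s" unfolding y'_def using less_le_trans[OF zero_less_one s1, THEN less_imp_neq] nonzero_eq_divide_eq[of ?s "y / ?s" y] by simp
  have ay: "\<bar>y' - y\<bar> = \<bar>y'\<bar> * (?s - 1)"
  proof -
    have "y' - y = - (y' * (?s - 1))" unfolding y by (simp add: algebra_simps)
    then show ?thesis using s1 by (simp add: abs_mult)
  qed
  define B where "B = 1 / (1 + y'\<^sup>2/2)"
  have "norm (Phi y' - Phi y) \<le> B * norm (y' - y)"
  proof (rule field_differentiable_bound[where S="closed_segment y' y" and f'=std_normal_density])
    fix z assume z: "z \<in> closed_segment y' y"
    have "\<bar>y'\<bar> \<le> \<bar>z\<bar>"
    proof -
      have "0 \<le> y' \<Longrightarrow> y' \<le> y" unfolding y using s1 by (metis mult.right_neutral mult_left_mono)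
      moreover have "y' \<le> 0 \<Longrightarrow> y \<le> y'" unfolding y using s1 by (metis mult.right_neutral mult_left_mono_neg)
      ultimately show ?thesis using z unfolding closed_segment_eq_real_ivl
        by (cases "y' \<le> y"; cases "0 \<le> y'") auto
    qed
    then have "y'\<^sup>2 \<le> z\<^sup>2" by (simp add: abs_le_square_iff)
    then have "1 / (1 + z\<^sup>2/2 + z^4/8) \<le> B" unfolding B_def
      by (intro divide_left_mono) (auto simp: add_pos_nonneg intro!: add_pos_nonneg mult_pos_pos add_increasing2)
    then show "norm (std_normal_density z) \<le> B" using std_normal_density_le[of z] by simp
  qed (auto intro: DERIV_subset[OF Phi_deriv])
  also have "\<dots> \<le> B * (\<bar>y'\<bar> * (\<epsilon>\<^sup>2 / 2))" unfolding real_norm_def ay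
    by (intro mult_left_mono s2) (auto simp: B_def intro!: add_nonneg_nonneg)
  also have "B * \<bar>y'\<bar> \<le> 1"
  proof -
    have "\<bar>y'\<bar> \<le> 1 + y'\<^sup>2/2" using zero_le_power2[of "\<bar>y'\<bar> - 1"] by (simp add: power2_eq_square algebra_simps)
    then show ?thesis unfolding B_def by (simp add: field_simps add_pos_nonneg)
  qed
  then have "B * (\<bar>y'\<bar> * (\<epsilon>\<^sup>2 / 2)) \<le> 1 * (\<epsilon>\<^sup>2/2)"
    unfolding mult.assoc[symmetric] by (intro mult_right_mono) auto
  finally show ?thesis unfolding y'_def real_norm_def using zero_le_power2[of \<epsilon>] by linarith
qed

text \<open>The identity E[W g(W)] = E[g'(W)] characterises the standard normal law; d measures its
  defect. Testing only on functions with derivatives bounded up to order three allows W to be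
  Taylor-expanded around its value with one vertex taken out.\<close>

definition stein_bound :: "'a pmf \<Rightarrow> ('a \<Rightarrow> real) \<Rightarrow> real \<Rightarrow> bool" where
  "stein_bound M W d \<longleftrightarrow> (\<forall>g g1 g2 g3 L.
     (\<forall>y. (g has_real_derivative g1 y) (at y)) \<longrightarrow>
     (\<forall>y. (g1 has_real_derivative g2 y) (at y)) \<longrightarrow>
     (\<forall>y. (g2 has_real_derivative g3 y) (at y)) \<longrightarrow>
     (\<forall>y. \<bar>g y\<bar> \<le> L \<and> \<bar>g1 y\<bar> \<le> L \<and> \<bar>g2 y\<bar> \<le> L \<and> \<bar>g3 y\<bar> \<le> L) \<longrightarrow>
     \<bar>measure_pmf.expectation M (\<lambda>\<omega>. W \<omega> * g (W \<omega>)) - measure_pmf.expectation M (\<lambda>\<omega>. g1 (W \<omega>))\<bar> \<le> L * d)"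

text \<open>
  For \<open>g(w) = \<phi>((x - r w) / s) / s\<close> with \<open>s\<^sup>2 = \<epsilon>\<^sup>2 + 1 - r\<^sup>2\<close> the derivative of \<open>r \<mapsto> Phi ((x - r w) / s)\<close> is
  \<open>- (w g(w) - g'(w))\<close>; integrating over \<open>r \<in> [0, 1]\<close> replaces the solution of the Stein equation.
\<close>

lemma stein_smooth:
  assumes fin: "finite (set_pmf M)" and st: "stein_bound M W d" and e: "0 < \<epsilon>" "\<epsilon> \<le> 1" and d: "d \<ge> 0"
  shows "\<bar>measure_pmf.expectation M (\<lambda>\<omega>. Phi ((x - W \<omega>) / \<epsilon>)) - Phi (x / sqrt (1 + \<epsilon>\<^sup>2))\<bar> \<le> 4 / \<epsilon>^4 * d"
proof -
  let ?E = "measure_pmf.expectation M"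
  define s where "s r = sqrt (\<epsilon>\<^sup>2 + 1 - r\<^sup>2)" for r :: real
  define z where "z r w = (x - r * w) / s r" for r w :: real
  let ?g = "\<lambda>r w. std_normal_density (z r w) / s r"
  let ?g1 = "\<lambda>r w. (- z r w * std_normal_density (z r w)) * (- r / s r) / s r"
  let ?g2 = "\<lambda>r w. (((z r w)\<^sup>2 - 1) * std_normal_density (z r w)) * (- r / s r)^2 / s r"
  let ?g3 = "\<lambda>r w. ((3 * z r w - (z r w)^3) * std_normal_density (z r w)) * (- r / s r)^3 / s r"
  have sp: "s r \<ge> \<epsilon>" if "0 \<le> r" "r \<le> 1" for r
  proof -
    have "r\<^sup>2 \<le> 1" using that by (simp add: power_le_one)
    then have "sqrt (\<epsilon>\<^sup>2) \<le> s r" unfolding s_def by (intro real_sqrt_le_mono) simp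
    then show ?thesis using e by simp
  qed
  have dz: "(z r has_real_derivative (- r / s r)) (at w)" if "0 \<le> r" "r \<le> 1" for r w
    unfolding z_def using sp[OF that] e by (auto intro!: derivative_eq_intros)
  have dr: "((\<lambda>r. Phi (z r w)) has_real_derivative - (w * ?g r w - ?g1 r w)) (at r)"
    if r: "0 \<le> r" "r \<le> 1" for r w
  proof -
    have pos: "\<epsilon>\<^sup>2 + 1 - r\<^sup>2 > 0" using sp[OF r] e unfolding s_def
      by (metis less_le_trans real_sqrt_gt_0_iff)
    have s2: "s r * s r = \<epsilon>\<^sup>2 + 1 - r\<^sup>2" unfolding s_def using pos by simp
    have ds: "(s has_real_derivative (- r / s r)) (at r)"
      unfolding s_def using pos by (auto intro!: derivative_eq_intros simp: field_simps)
    have s0: "s r \<noteq> 0" using sp[OF r] e by simp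
    have "((\<lambda>r. z r w) has_real_derivative ((- w) * s r - (x - r * w) * (- r / s r)) / (s r * s r)) (at r)"
      unfolding z_def by (rule derivative_eq_intros ds refl s0)+ auto
    from DERIV_chain2[OF Phi_deriv this] show ?thesis
      by (rule back_subst[where P="\<lambda>D. (_ has_real_derivative D) _"])
         (use s0 in \<open>simp add: z_def field_simps\<close>)
  qed
  \<comment> \<open>As \<open>s r\<close> is at least eps, the prefactor and each derivative in w
    cost one factor 1/eps, hence at most four factors.\<close>
  have bnd: "\<bar>c * (- r / s r)^k / s r\<bar> \<le> 4 / \<epsilon>^4" if r: "0 \<le> r" "r \<le> 1" and c: "\<bar>c\<bar> \<le> 4" and k: "k \<le> 3" for c r k
  proof -
    have sr: "s r \<ge> \<epsilon>" "s r > 0" using sp[OF r] e by auto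
    have "\<bar>- r / s r\<bar>^k \<le> (1/\<epsilon>)^k"
      using r sr e by (intro power_mono) (auto simp: abs_mult intro!: frac_le)
    also have "\<dots> \<le> (1/\<epsilon>)^3" using e k by (intro power_increasing) auto
    finally have a: "\<bar>- r / s r\<bar>^k \<le> (1/\<epsilon>)^3" .
    have "\<bar>c * (- r / s r)^k / s r\<bar> = \<bar>c\<bar> * \<bar>- r / s r\<bar>^k * (1 / s r)"
      using sr by (simp add: abs_mult power_abs)
    also have "\<dots> \<le> 4 * (1/\<epsilon>)^3 * (1/\<epsilon>)"
      using a c sr e by (intro mult_mono frac_le) auto
    also have "\<dots> = 4 / \<epsilon>^4" using e by (simp add: field_simps power3_eq_cube power4_eq_xxxx)
    finally show ?thesis .
  qed
  have key: "\<bar>?E (\<lambda>\<omega>. - (W \<omega> * ?g r (W \<omega>) - ?g1 r (W \<omega>)))\<bar> \<le> 4/\<epsilon>^4 * d" if r: "0 \<le> r" "r \<le> 1" for r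
  proof -
    have s0: "s r \<noteq> 0" using sp[OF r] e by simp
    have 1: "(?g r has_real_derivative ?g1 r y) (at y)" for y
      using DERIV_cdivide[OF DERIV_chain2[OF std_normal_density_derivs(1) dz[OF r]], of "s r"] by simp
    have 2: "(?g1 r has_real_derivative ?g2 r y) (at y)" for y
      using DERIV_cmult_right[OF DERIV_chain2[OF std_normal_density_derivs(2) dz[OF r]], of "(- r / s r) / s r"]
      by (simp add: power2_eq_square mult.assoc)
    have 3: "(?g2 r has_real_derivative ?g3 r y) (at y)" for y
      using DERIV_cmult_right[OF DERIV_chain2[OF std_normal_density_derivs(3) dz[OF r]], of "(- r / s r)^2 / s r"]
      by (simp add: power2_eq_square power3_eq_cube mult.assoc)
    have b: "\<bar>?g r y\<bar> \<le> 4/\<epsilon>^4 \<and> \<bar>?g1 r y\<bar> \<le> 4/\<epsilon>^4 \<and> \<bar>?g2 r y\<bar> \<le> 4/\<epsilon>^4 \<and> \<bar>?g3 r y\<bar> \<le> 4/\<epsilon>^4" for y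
      using bnd[OF r std_normal_density_deriv_bounds(1)[of "z r y"], of 0]
        bnd[OF r std_normal_density_deriv_bounds(2)[of "z r y"], of 1]
        bnd[OF r std_normal_density_deriv_bounds(3)[of "z r y"], of 2]
        bnd[OF r std_normal_density_deriv_bounds(4)[of "z r y"], of 3] by simp
    have "\<bar>?E (\<lambda>\<omega>. W \<omega> * ?g r (W \<omega>)) - ?E (\<lambda>\<omega>. ?g1 r (W \<omega>))\<bar> \<le> 4/\<epsilon>^4 * d"
      by (rule st[unfolded stein_bound_def, rule_format, OF 1 2 3 b])
    moreover have "?E (\<lambda>\<omega>. - (W \<omega> * ?g r (W \<omega>) - ?g1 r (W \<omega>))) = - (?E (\<lambda>\<omega>. W \<omega> * ?g r (W \<omega>)) - ?E (\<lambda>\<omega>. ?g1 r (W \<omega>)))"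
      using fin by (simp add: integrable_measure_pmf_finite Bochner_Integration.integral_diff)
    ultimately show ?thesis by linarith
  qed
  \<comment> \<open>At r = 1 the function is a smoothed indicator of W, at r = 0 it no longer
    depends on W. A single intermediate r from the mean value theorem suffices, because
    \<open>key\<close> is uniform in r.\<close>
  have "\<exists>r. 0 < r \<and> r < 1 \<and> ?E (\<lambda>\<omega>. Phi (z 1 (W \<omega>))) - ?E (\<lambda>\<omega>. Phi (z 0 (W \<omega>))) = (1 - 0) * ?E (\<lambda>\<omega>. - (W \<omega> * ?g r (W \<omega>) - ?g1 r (W \<omega>)))"
  proof (rule MVT2)
    fix r :: real assume r: "0 \<le> r" "r \<le> 1"
    show "((\<lambda>r. ?E (\<lambda>\<omega>. Phi (z r (W \<omega>)))) has_real_derivative ?E (\<lambda>\<omega>. - (W \<omega> * ?g r (W \<omega>) - ?g1 r (W \<omega>)))) (at r)"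
      \<comment> \<open>Finite support makes the expectation a finite sum, so it can be
        differentiated termwise.\<close>
      unfolding integral_measure_pmf[OF fin, of M, simplified] real_scaleR_def
      by (intro DERIV_sum DERIV_cmult[OF dr[OF r]])
  qed simp
  then obtain r where r: "0 < r" "r < 1" "?E (\<lambda>\<omega>. Phi (z 1 (W \<omega>))) - ?E (\<lambda>\<omega>. Phi (z 0 (W \<omega>))) = ?E (\<lambda>\<omega>. - (W \<omega> * ?g r (W \<omega>) - ?g1 r (W \<omega>)))"
    by auto
  have "?E (\<lambda>\<omega>. Phi (z 1 (W \<omega>))) = ?E (\<lambda>\<omega>. Phi ((x - W \<omega>) / \<epsilon>))"
    using e by (simp add: z_def s_def)
  moreover have "?E (\<lambda>\<omega>. Phi (z 0 (W \<omega>))) = Phi (x / sqrt (1 + \<epsilon>\<^sup>2))"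
    by (simp add: z_def s_def add.commute)
  moreover have "\<bar>?E (\<lambda>\<omega>. Phi (z 1 (W \<omega>))) - ?E (\<lambda>\<omega>. Phi (z 0 (W \<omega>)))\<bar> \<le> 4/\<epsilon>^4 * d"
    unfolding r(3) by (rule key) (use r(1,2) in auto)
  ultimately show ?thesis by (simp only:)
qed

text \<open>The indicator of W <= x is sandwiched between smoothed indicators shifted by s.
  Smoothing at scale eps = s^2 leaves a tail of at most s^2 at distance s, and d = s^16 makes the
  smoothing error 4 d / eps^4 = 4 s^8. The total 7 s consists of 5 s for smoothing and rescaling, s
  for the shift and s for the tail.\<close>

lemma stein_kolmogorov:
  assumes fin: "finite (set_pmf M)" and st: "stein_bound M W d" and d: "0 < d" "d \<le> 1"
  shows "\<bar>measure_pmf.prob M {\<omega>. W \<omega> \<le> x} - Phi x\<bar> \<le> 7 * d powr (1/16)"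
proof -
  let ?E = "measure_pmf.expectation M"
  define s where "s = d powr (1/16)"
  define \<epsilon> where "\<epsilon> = s\<^sup>2"
  have s: "0 < s" "s \<le> 1" using d by (auto simp: s_def powr_le1)
  have e: "0 < \<epsilon>" "\<epsilon> \<le> 1" using s by (auto simp: \<epsilon>_def power_le_one)
  have s16: "s^16 = d" using d unfolding s_def by (simp add: powr_realpow[symmetric] powr_powr)
  have err: "4 / \<epsilon>^4 * d \<le> 4 * s"
  proof -
    have "4 / \<epsilon>^4 * d = 4 * s^8" using s unfolding s16[symmetric] \<epsilon>_def 
      by (simp add: power_mult[symmetric] field_simps power_add[symmetric])
    also have "\<dots> \<le> 4 * s" using s power_decreasing[of 1 8 s] by simp
    finally show ?thesis .
  qed
  have s2: "s\<^sup>2 \<le> s" using s power_decreasing[of 1 2 s] by simp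
  have e2: "\<epsilon>\<^sup>2 \<le> s" using s power_decreasing[of 1 4 s] by (simp add: \<epsilon>_def power_mult[symmetric])
  have se: "s / \<epsilon> = 1 / s" using s by (simp add: \<epsilon>_def power2_eq_square)
  have int: "integrable M (f :: _ \<Rightarrow> real)" for f using fin by (rule integrable_measure_pmf_finite)
  have P: "measure_pmf.prob M {\<omega>. W \<omega> \<le> x} = ?E (indicator {\<omega>. W \<omega> \<le> x})" by simp
  have up: "measure_pmf.prob M {\<omega>. W \<omega> \<le> x} \<le> ?E (\<lambda>\<omega>. Phi ((x + s - W \<omega>) / \<epsilon>) + s\<^sup>2)"
    unfolding P
  proof (rule integral_mono[OF int int])
    fix \<omega>
    show "indicator {\<omega>. W \<omega> \<le> x} \<omega> \<le> Phi ((x + s - W \<omega>) / \<epsilon>) + s\<^sup>2"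
    proof (cases "W \<omega> \<le> x")
      case True
      have "1 - s\<^sup>2 \<le> Phi (1/s)" using Phi_tail(2)[of "1/s"] s by (simp add: power_divide)
      also have "\<dots> \<le> Phi ((x + s - W \<omega>) / \<epsilon>)" unfolding se[symmetric]
        using True e by (intro Phi_mono divide_right_mono) auto
      finally show ?thesis using True by simp
    qed (use Phi_range in auto)
  qed
  also have "\<dots> = ?E (\<lambda>\<omega>. Phi ((x + s - W \<omega>) / \<epsilon>)) + s\<^sup>2"
    by (subst Bochner_Integration.integral_add[OF int int]) simp
  finally have up: "measure_pmf.prob M {\<omega>. W \<omega> \<le> x} \<le> \<dots>" .
  have "?E (\<lambda>\<omega>. Phi ((x - s - W \<omega>) / \<epsilon>) - s\<^sup>2) \<le> measure_pmf.prob M {\<omega>. W \<omega> \<le> x}"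
    unfolding P
  proof (rule integral_mono[OF int int])
    fix \<omega>
    show "Phi ((x - s - W \<omega>) / \<epsilon>) - s\<^sup>2 \<le> indicator {\<omega>. W \<omega> \<le> x} \<omega>"
    proof (cases "W \<omega> \<le> x")
      case False
      have "Phi ((x - s - W \<omega>) / \<epsilon>) \<le> Phi (- (1/s))" unfolding se[symmetric]
        using False e unfolding minus_divide_left by (intro Phi_mono divide_right_mono) auto
      also have "\<dots> \<le> s\<^sup>2" using Phi_tail(1)[of "1/s"] s by (simp add: power_divide)
      finally show ?thesis using False by simp
    qed (use Phi_range[of "(x - s - W \<omega>) / \<epsilon>"] zero_le_power2[of s] in \<open>simp add: diff_le_eq add_increasing2\<close>)
  qed
  moreover have "?E (\<lambda>\<omega>. Phi ((x - s - W \<omega>) / \<epsilon>) - s\<^sup>2) = ?E (\<lambda>\<omega>. Phi ((x - s - W \<omega>) / \<epsilon>)) - s\<^sup>2"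
    by (subst Bochner_Integration.integral_diff[OF int int]) simp
  ultimately have lo: "?E (\<lambda>\<omega>. Phi ((x - s - W \<omega>) / \<epsilon>)) - s\<^sup>2 \<le> measure_pmf.prob M {\<omega>. W \<omega> \<le> x}" by simp
  have sm: "\<bar>?E (\<lambda>\<omega>. Phi ((y - W \<omega>) / \<epsilon>)) - Phi y\<bar> \<le> 5 * s" for y
    using stein_smooth[OF fin st e, of y] Phi_rescale[of y \<epsilon>] e2 err d by linarith
  show ?thesis unfolding s_def[symmetric]
    using up lo sm[of "x + s"] sm[of "x - s"] Phi_lipschitz[of "x+s" x] Phi_lipschitz[of "x-s" x] s s2 by linarith
qed

section \<open>Products of Bernoulli variables\<close>

abbreviation EE :: "'a pmf \<Rightarrow> ('a \<Rightarrow> real) \<Rightarrow> real" where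
  "EE M f \<equiv> measure_pmf.expectation M f"

lemma EE_add: "finite (set_pmf M) \<Longrightarrow> EE M (\<lambda>x. f x + g x) = EE M f + EE M g"
  by (rule Bochner_Integration.integral_add) (auto intro: integrable_measure_pmf_finite)

lemma EE_diff: "finite (set_pmf M) \<Longrightarrow> EE M (\<lambda>x. f x - g x) = EE M f - EE M g"
  by (rule Bochner_Integration.integral_diff) (auto intro: integrable_measure_pmf_finite)

lemma EE_sum: "finite (set_pmf M) \<Longrightarrow> EE M (\<lambda>x. \<Sum>i\<in>I. f i x) = (\<Sum>i\<in>I. EE M (f i))"
  by (rule Bochner_Integration.integral_sum) (auto intro: integrable_measure_pmf_finite)

lemma EE_mono: "finite (set_pmf M) \<Longrightarrow> (\<And>x. x \<in> set_pmf M \<Longrightarrow> f x \<le> g x) \<Longrightarrow> EE M f \<le> EE M g"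
  by (rule integral_mono_AE) (auto intro: integrable_measure_pmf_finite AE_pmfI)

lemma EE_cong: "(\<And>x. x \<in> set_pmf M \<Longrightarrow> f x = g x) \<Longrightarrow> EE M f = EE M g"
  by (rule integral_cong_AE) (auto intro: AE_pmfI)

lemma EE_abs: "finite (set_pmf M) \<Longrightarrow> \<bar>EE M f\<bar> \<le> EE M (\<lambda>x. \<bar>f x\<bar>)"
  using integral_norm_bound[of M f] by simp

lemma EE_abs_le:
  "finite (set_pmf M) \<Longrightarrow> (\<And>x. x \<in> set_pmf M \<Longrightarrow> \<bar>f x\<bar> \<le> g x) \<Longrightarrow> \<bar>EE M f\<bar> \<le> EE M g"
  by (rule order_trans[OF EE_abs EE_mono])

lemma EE_bound:
  "finite (set_pmf M) \<Longrightarrow> (\<And>x. x \<in> set_pmf M \<Longrightarrow> \<bar>f x\<bar> \<le> B) \<Longrightarrow> \<bar>EE M f\<bar> \<le> B"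
  using EE_abs_le[of M f "\<lambda>_. B"] by simp

lemma EE_le_const:
  "finite (set_pmf M) \<Longrightarrow> (\<And>x. x \<in> set_pmf M \<Longrightarrow> f x \<le> B) \<Longrightarrow> EE M f \<le> B"
  using EE_mono[of M f "\<lambda>_. B"] by simp

lemma EE_prob: "measure_pmf.prob M A = EE M (\<lambda>x. of_bool (x \<in> A))"
proof -
  have "measure_pmf.prob M A = EE M (indicat_real A)" by simp
  also have "\<dots> = EE M (\<lambda>x. of_bool (x \<in> A))" by (rule EE_cong) (simp add: indicator_def)
  finally show ?thesis .
qed

lemma EE_markov:
  assumes "finite (set_pmf M)" "t > 0" "\<And>x. x \<in> set_pmf M \<Longrightarrow> 0 \<le> f x"
  shows "measure_pmf.prob M {x. f x \<ge> t} \<le> EE M f / t"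
  unfolding EE_prob integral_divide_zero[symmetric]
  by (rule EE_mono) (use assms in auto)

lemma EE_bind:
  assumes "finite (set_pmf M)" "\<And>x. x \<in> set_pmf M \<Longrightarrow> finite (set_pmf (N x))"
  shows "EE (bind_pmf M N) F = EE M (\<lambda>x. EE (N x) F)"
  by (subst pmf_expectation_bind[of "set_pmf M"]) (use assms in \<open>auto simp: integral_measure_pmf[of "set_pmf M"]\<close>)

text \<open>The mean value theorem without an order on the endpoints; the intermediate point is
  close to both of them, so it can be compared with either.\<close>

lemma mvt_between:
  fixes g :: "real \<Rightarrow> real"
  assumes "\<And>y. (g has_real_derivative g1 y) (at y)"
  shows "\<exists>z. g b - g a = (b - a) * g1 z \<and> \<bar>z - a\<bar> \<le> \<bar>b - a\<bar> \<and> \<bar>z - b\<bar> \<le> \<bar>b - a\<bar>"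
proof -
  consider "a < b" | "b < a" | "a = b" by linarith
  then show ?thesis
  proof cases
    case 1
    then obtain z where "a < z" "z < b" "g b - g a = (b - a) * g1 z"
      using MVT2[of a b g g1] assms by blast
    then show ?thesis by (intro exI[of _ z]) auto
  next
    case 2
    then obtain z where "b < z" "z < a" "g a - g b = (a - b) * g1 z"
      using MVT2[of b a g g1] assms by blast
    then show ?thesis by (intro exI[of _ z]) (auto simp: algebra_simps)
  qed auto
qed

definition bern :: "real \<Rightarrow> 'a set \<Rightarrow> ('a \<Rightarrow> bool) pmf" where
  "bern p A = Pi_pmf A False (\<lambda>_. bernoulli_pmf p)"

lemma finite_set_bern: "finite A \<Longrightarrow> finite (set_pmf (bern p A))"
  unfolding bern_def by (rule finite_subset[OF set_Pi_pmf_subset']) auto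

locale bernoulli = fixes p :: real assumes p: "0 < p" "p < 1"
begin

definition q :: real where "q = 1 - p"

lemma q: "0 < q" "q < 1" "p + q = 1" using p by (auto simp: q_def)

lemma pq: "0 < p * q" "p * q \<le> 1/4"
proof -
  have "0 \<le> (p - q)\<^sup>2" by simp
  moreover have "(p + q)\<^sup>2 = 1" using q by simp
  ultimately show "p * q \<le> 1/4" by (simp add: power2_eq_square algebra_simps)
qed (use p q in simp)

lemma abs_pq: "\<bar>p * q * y\<bar> = p * q * \<bar>y\<bar>"
  using p q by (simp add: abs_mult)

lemma convex_abs_le: "\<bar>a\<bar> \<le> B \<Longrightarrow> \<bar>b\<bar> \<le> B \<Longrightarrow> \<bar>p * a + q * b\<bar> \<le> B"
proof -
  assume ab: "\<bar>a\<bar> \<le> B" "\<bar>b\<bar> \<le> B"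
  have "\<bar>p * a + q * b\<bar> \<le> p * \<bar>a\<bar> + q * \<bar>b\<bar>"
    using p q by (intro order_trans[OF abs_triangle_ineq]) (simp add: abs_mult)
  also have "\<dots> \<le> p * B + q * B" using ab p q by (intro add_mono mult_left_mono) auto
  also have "\<dots> = B" by (simp add: q_def algebra_simps)
  finally show ?thesis .
qed

lemma EE_bern_empty: "EE (bern p {}) F = F (\<lambda>_. False)"
  by (simp add: bern_def)

lemma EE_bern_insert:
  assumes "finite A" "x \<notin> A"
  shows "EE (bern p (insert x A)) F = p * EE (bern p A) (\<lambda>f. F (f(x := True))) + q * EE (bern p A) (\<lambda>f. F (f(x := False)))"
proof -
  have "bern p (insert x A) = bind_pmf (bernoulli_pmf p) (\<lambda>b. map_pmf (\<lambda>f. f(x := b)) (bern p A))"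
    unfolding bern_def using assms by (subst Pi_pmf_insert') (auto simp: map_pmf_def)
  then have "EE (bern p (insert x A)) F = EE (bernoulli_pmf p) (\<lambda>b. EE (bern p A) (\<lambda>f. F (f(x := b))))"
    using finite_set_bern[OF assms(1)] by (simp add: EE_bind)
  then show ?thesis using p by (simp add: q_def)
qed

lemma EE_bern_resample:
  assumes "finite A" "x \<in> A"
  shows "EE (bern p A) F = EE (bern p A) (\<lambda>f. p * F (f(x := True)) + q * F (f(x := False)))"
proof -
  let ?B = "A - {x}"
  have A: "A = insert x ?B" using assms by auto
  have fB: "finite (set_pmf (bern p ?B))" using assms by (intro finite_set_bern) auto
  have "EE (bern p (insert x ?B)) (\<lambda>f. p * F (f(x := True)) + q * F (f(x := False)))
     = (p + q) * EE (bern p ?B) (\<lambda>f. p * F (f(x := True)) + q * F (f(x := False)))"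
    using assms by (subst EE_bern_insert) (auto simp: algebra_simps)
  also have "\<dots> = EE (bern p (insert x ?B)) F"
    using assms q by (subst EE_bern_insert) (auto simp: EE_add[OF fB])
  finally show ?thesis using A by simp
qed

text \<open>Discrete integration by parts: a centered bit acts as a difference operator in its own
  coordinate, with the variance p q as weight.\<close>

lemma EE_bern_cov:
  assumes "finite A" "x \<in> A"
  shows "EE (bern p A) (\<lambda>f. (of_bool (f x) - p) * F f) = p * q * EE (bern p A) (\<lambda>f. F (f(x := True)) - F (f(x := False)))"
proof -
  have "EE (bern p A) (\<lambda>f. (of_bool (f x) - p) * F f)
    = EE (bern p A) (\<lambda>f. p * ((1 - p) * F (f(x := True))) + q * ((0 - p) * F (f(x := False))))"
    by (subst EE_bern_resample[OF assms]) simp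
  also have "\<dots> = EE (bern p A) (\<lambda>f. p * q * (F (f(x := True)) - F (f(x := False))))"
    by (simp add: q_def algebra_simps)
  finally show ?thesis by simp
qed

lemma EE_bern_remove:
  assumes "finite A" "x \<in> A" "\<And>f b. F (f(x := b)) = F f"
  shows "EE (bern p A) F = EE (bern p (A - {x})) F"
proof -
  have "EE (bern p (insert x (A - {x}))) F = (p + q) * EE (bern p (A - {x})) F"
    using assms by (subst EE_bern_insert) (auto simp: algebra_simps)
  then show ?thesis using assms(2) q by (simp add: insert_absorb)
qed

section \<open>Moments, exponential moments and tails of centered weighted sums\<close>

definition csum :: "('a \<Rightarrow> real) \<Rightarrow> 'a set \<Rightarrow> ('a \<Rightarrow> bool) \<Rightarrow> real" where
  "csum c A f = (\<Sum>u\<in>A. c u * (of_bool (f u) - p))"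

lemma csum_insert:
  assumes "finite A" "x \<notin> A"
  shows "csum c (insert x A) (f(x := b)) = csum c A f + c x * (of_bool b - p)"
proof -
  have "(\<Sum>u\<in>A. c u * (of_bool ((f(x := b)) u) - p)) = csum c A f"
    unfolding csum_def by (rule sum.cong) (use assms in auto)
  then show ?thesis using assms by (simp add: csum_def)
qed

text \<open>A joint induction, because the step for the fourth moment uses the two lower ones. It
  closes since 3 s^2 + 6 c^2 s + 3 c^4 = 3 (s + c^2)^2, the shape of the Gaussian fourth
  moment.\<close>

lemma csum_moments:
  assumes "finite A"
  shows "EE (bern p A) (csum c A) = 0"
    and "EE (bern p A) (\<lambda>f. (csum c A f)\<^sup>2) = p * q * (\<Sum>u\<in>A. (c u)\<^sup>2)"
    and "EE (bern p A) (\<lambda>f. (csum c A f)^4) \<le> 3 * (\<Sum>u\<in>A. (c u)\<^sup>2)\<^sup>2"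
proof -
  have "EE (bern p A) (csum c A) = 0 \<and> EE (bern p A) (\<lambda>f. (csum c A f)\<^sup>2) = p * q * (\<Sum>u\<in>A. (c u)\<^sup>2)
    \<and> EE (bern p A) (\<lambda>f. (csum c A f)^4) \<le> 3 * (\<Sum>u\<in>A. (c u)\<^sup>2)\<^sup>2"
    using assms
  proof (induction A)
    case empty
    then show ?case by (simp add: EE_bern_empty csum_def)
  next
    case (insert x A)
    let ?s = "\<Sum>u\<in>A. (c u)\<^sup>2"
    have fA: "finite (set_pmf (bern p A))" using insert by (simp add: finite_set_bern)
    note ins = EE_bern_insert[OF insert.hyps(1,2)] csum_insert[OF insert.hyps(1,2)]
    have s0: "?s \<ge> 0" by (simp add: sum_nonneg)
    have X: "EE (bern p A) (\<lambda>f. csum c A f) = 0" using insert.IH by simp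
    have sh2: "EE (bern p A) (\<lambda>f. (csum c A f + a)\<^sup>2) = p * q * ?s + a\<^sup>2" for a
      using insert.IH X by (simp add: power2_sum EE_add[OF fA] mult.assoc)
    have sh4: "EE (bern p A) (\<lambda>f. (csum c A f + a)^4) = EE (bern p A) (\<lambda>f. (csum c A f)^4)
       + 4 * a * EE (bern p A) (\<lambda>f. (csum c A f)^3) + 6 * a\<^sup>2 * (p * q * ?s) + a^4" for a
    proof -
      have "(csum c A f + a)^4 = (csum c A f)^4 + (4 * a) * (csum c A f)^3 + (6 * a\<^sup>2) * (csum c A f)\<^sup>2 + (4 * a^3) * csum c A f + a^4" for f
        by (simp add: power2_eq_square power3_eq_cube power4_eq_xxxx algebra_simps)
      then show ?thesis using insert.IH X by (simp add: EE_add[OF fA])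
    qed
    have 1: "EE (bern p (insert x A)) (csum c (insert x A)) = 0"
      using X unfolding ins EE_add[OF fA] by (simp add: q_def algebra_simps)
    have "p * (c x * (1 - p))\<^sup>2 + q * (c x * (0 - p))\<^sup>2 = p * q * (c x)\<^sup>2 * (p + q)"
      by (simp add: q_def power2_eq_square algebra_simps)
    then have v: "p * (c x * (1 - p))\<^sup>2 + q * (c x * (0 - p))\<^sup>2 = p * q * (c x)\<^sup>2" using q by simp
    have "EE (bern p (insert x A)) (\<lambda>f. (csum c (insert x A) f)\<^sup>2)
      = (p + q) * (p * q * ?s) + (p * (c x * (1 - p))\<^sup>2 + q * (c x * (0 - p))\<^sup>2)"
      unfolding ins sh2 by (simp add: algebra_simps)
    then have 2: "EE (bern p (insert x A)) (\<lambda>f. (csum c (insert x A) f)\<^sup>2) = p * q * ((c x)\<^sup>2 + ?s)"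
      unfolding v using q by (simp add: algebra_simps)
    \<comment> \<open>The third moment of the old sum needs no bound: its coefficient is the mean of
      the new summand up to a factor.\<close>
    have v3: "p * (4 * (c x * (1 - p))) + q * (4 * (c x * (0 - p))) = 0" by (simp add: q_def algebra_simps)
    have "EE (bern p (insert x A)) (\<lambda>f. (csum c (insert x A) f)^4)
      = (p + q) * EE (bern p A) (\<lambda>f. (csum c A f)^4)
        + (p * (4 * (c x * (1 - p))) + q * (4 * (c x * (0 - p)))) * EE (bern p A) (\<lambda>f. (csum c A f)^3)
        + 6 * (p * (c x * (1 - p))\<^sup>2 + q * (c x * (0 - p))\<^sup>2) * (p * q * ?s)
        + (p * (c x * (1 - p))^4 + q * (c x * (0 - p))^4)"
      unfolding ins sh4 by (simp add: algebra_simps)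
    also have "\<dots> = EE (bern p A) (\<lambda>f. (csum c A f)^4) + 6 * (p * q * (c x)\<^sup>2) * (p * q * ?s)
        + (p * q^4 + q * p^4) * (c x)^4"
    proof -
      have "(c x * (1 - p))^4 = q^4 * (c x)^4" "(c x * (0 - p))^4 = p^4 * (c x)^4"
        unfolding q_def power_mult_distrib by simp_all
      then show ?thesis unfolding v v3 using q by (simp add: distrib_right)
    qed
    also have "\<dots> \<le> 3 * ?s\<^sup>2 + 6 * (1 * (c x)\<^sup>2) * (1 * ?s) + 3 * (c x)^4"
    proof -
      have p1: "p * q \<le> 1" "0 \<le> p * q" using pq by auto
      have "p * q^4 \<le> 1" "q * p^4 \<le> 1" using p q by (auto intro!: mult_le_one power_le_one)
      then have a: "(p * q^4 + q * p^4) * (c x)^4 \<le> 3 * (c x)^4" by (intro mult_right_mono) auto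
      have b1: "p * q * (c x)\<^sup>2 \<le> 1 * (c x)\<^sup>2" using p1 by (intro mult_right_mono) auto
      have b2: "p * q * ?s \<le> 1 * ?s" using p1 s0 by (intro mult_right_mono) auto
      have "p * q * (c x)\<^sup>2 * (p * q * ?s) \<le> 1 * (c x)\<^sup>2 * (1 * ?s)"
        using b1 b2 p1 s0 by (intro mult_mono) auto
      then show ?thesis using a insert.IH by linarith
    qed
    also have "\<dots> = 3 * ((c x)\<^sup>2 + ?s)\<^sup>2" by (simp add: power2_eq_square power4_eq_xxxx algebra_simps)
    finally show ?case using 1 2 insert.hyps by simp
  qed
  then show "EE (bern p A) (csum c A) = 0"
    and "EE (bern p A) (\<lambda>f. (csum c A f)\<^sup>2) = p * q * (\<Sum>u\<in>A. (c u)\<^sup>2)"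
    and "EE (bern p A) (\<lambda>f. (csum c A f)^4) \<le> 3 * (\<Sum>u\<in>A. (c u)\<^sup>2)\<^sup>2" by auto
qed

text \<open>For h >= 0 this is Hoeffding's lemma; for h < 0 exchange success and failure.\<close>

lemma bernoulli_mgf: "p * exp (h * (1 - p)) + q * exp (h * (0 - p)) \<le> exp (h\<^sup>2 / 8)"
proof -
  have pos: "a * exp (h * (1 - a)) + (1 - a) * exp (h * (0 - a)) \<le> exp (h\<^sup>2 / 8)" if "h \<ge> 0" "0 \<le> a" "a < 1" for h a :: real
  proof -
    have "0 < 1 + a * (exp h - 1)" using that by (simp add: add_pos_nonneg)
    moreover have "ln (1 + a * (exp h - 1)) \<le> h * a + h\<^sup>2 / 8"
      using Hoeffdings_lemma_aux[OF that(1,2)] by simp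
    ultimately have "1 + a * (exp h - 1) \<le> exp (h * a + h\<^sup>2 / 8)"
      by (metis exp_le_cancel_iff exp_ln)
    then have "exp (- (h * a)) * (1 + a * (exp h - 1)) \<le> exp (- (h * a)) * exp (h * a + h\<^sup>2 / 8)"
      by (rule mult_left_mono) simp
    then show ?thesis by (simp add: exp_add[symmetric] algebra_simps flip: exp_add)
  qed
  show ?thesis
  proof (cases "h \<ge> 0")
    case True then show ?thesis using pos[of h p] p by (simp add: q_def)
  next
    case False then show ?thesis using pos[of "-h" q] p q by (simp add: q_def add.commute algebra_simps)
  qed
qed

lemma csum_mgf:
  assumes "finite A"
  shows "EE (bern p A) (\<lambda>f. exp (csum c A f)) \<le> exp ((\<Sum>u\<in>A. (c u)\<^sup>2) / 8)"
  using assms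
proof (induction A)
  case empty
  then show ?case by (simp add: EE_bern_empty csum_def)
next
  case (insert x A)
  note ins = EE_bern_insert[OF insert.hyps(1,2)] csum_insert[OF insert.hyps(1,2)]
  have "EE (bern p (insert x A)) (\<lambda>f. exp (csum c (insert x A) f))
    = EE (bern p A) (\<lambda>f. exp (csum c A f)) * (p * exp (c x * (1 - p)) + q * exp (c x * (0 - p)))"
    unfolding ins exp_add by (simp add: distrib_left mult_ac)
  also have "\<dots> \<le> exp ((\<Sum>u\<in>A. (c u)\<^sup>2) / 8) * exp ((c x)\<^sup>2 / 8)"
    using p q by (intro mult_mono insert.IH bernoulli_mgf) (auto intro!: add_nonneg_nonneg)
  also have "\<dots> = exp ((\<Sum>u\<in>insert x A. (c u)\<^sup>2) / 8)"
    using insert.hyps by (simp add: exp_add[symmetric] add_divide_distrib add.commute)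
  finally show ?case .
qed

lemma csum_tail:
  assumes "finite A" "(\<Sum>u\<in>A. (c u)\<^sup>2) \<le> s" "s > 0" "t > 0"
  shows "measure_pmf.prob (bern p A) {f. \<bar>csum c A f\<bar> \<ge> t} \<le> 2 * exp (- t\<^sup>2 / (2 * s))"
proof -
  have fA: "finite (set_pmf (bern p A))" using assms by (simp add: finite_set_bern)
  \<comment> \<open>The Chernoff parameter. Any constant multiple of t/s of this kind works; this
    one gives the exponent 7/8 * t^2 / s, more than the stated half.\<close>
  define l where "l = t / s"
  have one: "EE (bern p A) (\<lambda>f. exp (z * csum c A f)) \<le> exp (l\<^sup>2 * s / 8)" if "z\<^sup>2 = l\<^sup>2" for z
  proof -
    have "z * csum c A f = csum (\<lambda>u. z * c u) A f" for f
      by (simp add: csum_def sum_distrib_left mult.assoc)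
    then have "EE (bern p A) (\<lambda>f. exp (z * csum c A f)) \<le> exp ((\<Sum>u\<in>A. (z * c u)\<^sup>2) / 8)"
      using csum_mgf[OF assms(1), of "\<lambda>u. z * c u"] by simp
    also have "(\<Sum>u\<in>A. (z * c u)\<^sup>2) = l\<^sup>2 * (\<Sum>u\<in>A. (c u)\<^sup>2)"
      using that by (simp add: power_mult_distrib sum_distrib_left)
    also have "exp (\<dots> / 8) \<le> exp (l\<^sup>2 * s / 8)"
      using assms(2) by (simp add: mult_left_mono)
    finally show ?thesis .
  qed
  have "measure_pmf.prob (bern p A) {f. \<bar>csum c A f\<bar> \<ge> t}
     \<le> EE (bern p A) (\<lambda>f. exp (- (l * t)) * exp (l * csum c A f) + exp (- (l * t)) * exp ((-l) * csum c A f))"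
    unfolding EE_prob
  proof (rule EE_mono[OF fA])
    fix f
    have l: "l > 0" using assms by (simp add: l_def)
    show "of_bool (f \<in> {f. t \<le> \<bar>csum c A f\<bar>}) \<le> exp (- (l * t)) * exp (l * csum c A f) + exp (- (l * t)) * exp ((-l) * csum c A f)"
    proof (cases "t \<le> \<bar>csum c A f\<bar>")
      case True
      then have "t \<le> csum c A f \<or> t \<le> - csum c A f" by linarith
      then have "0 \<le> l * (csum c A f - t) \<or> 0 \<le> l * (- csum c A f - t)"
        using l by (elim disj_forward) auto
      then have "1 \<le> exp (l * (csum c A f - t)) \<or> 1 \<le> exp (l * (- csum c A f - t))" by simp
      moreover have "exp (- (l * t)) * exp (l * csum c A f) = exp (l * (csum c A f - t))"
        "exp (- (l * t)) * exp ((-l) * csum c A f) = exp (l * (- csum c A f - t))"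
        by (simp_all add: exp_add[symmetric] algebra_simps)
      ultimately show ?thesis using True by (auto simp: add_increasing add_increasing2)
    qed (simp add: add_nonneg_nonneg)
  qed
  also have "\<dots> \<le> exp (- (l * t)) * exp (l\<^sup>2 * s / 8) + exp (- (l * t)) * exp (l\<^sup>2 * s / 8)"
    unfolding EE_add[OF fA] integral_mult_right_zero
    by (intro add_mono mult_left_mono one) auto
  also have "\<dots> = 2 * exp (- (l * t) + l\<^sup>2 * s / 8)" unfolding exp_add by simp
  also have "- (l * t) + l\<^sup>2 * s / 8 = - (7/8) * (t\<^sup>2 / s)"
    using assms by (simp add: l_def power2_eq_square field_simps)
  also have "2 * exp (- (7/8) * (t\<^sup>2 / s)) \<le> 2 * exp (- t\<^sup>2 / (2 * s))"
  proof -
    have "0 \<le> t\<^sup>2 / s" using assms by simp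
    moreover have "- t\<^sup>2 / (2 * s) = - (1/2) * (t\<^sup>2 / s)" by simp
    ultimately show ?thesis by simp
  qed
  finally show ?thesis .
qed

lemma csum_upd: assumes "finite A" "u \<in> A"
  shows "csum c A (f(u := b)) = csum c A f + c u * (of_bool b - of_bool (f u))"
proof -
  have "(\<Sum>v\<in>A - {u}. c v * (of_bool ((f(u := b)) v) - p)) = (\<Sum>v\<in>A - {u}. c v * (of_bool (f v) - p))"
    by (rule sum.cong) auto
  then show ?thesis unfolding csum_def sum.remove[OF assms] by (simp add: right_diff_distrib)
qed

text \<open>By \<open>EE_bern_cov\<close> each summand yields p q times a difference of g over a
  step of length 1/\<sigma>. As the weights square to 1, this is g'/\<sigma>^2 to first order,
  whatever the sign. The sum over A has the total weight p q card A / \<sigma>^2 = 1, and the errors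
  L/\<sigma>^3 add up to L/\<sigma>.\<close>

lemma csum_stein:
  assumes A: "finite A" "A \<noteq> {}" and c: "\<And>u. u \<in> A \<Longrightarrow> c u = 1 \<or> c u = -1"
  defines "\<sigma> \<equiv> sqrt (card A * (p * q))"
  shows "stein_bound (bern p A) (\<lambda>f. csum c A f / \<sigma>) (1 / \<sigma>)"
  unfolding stein_bound_def
proof (intro allI impI)
  fix g g1 g2 g3 :: "real \<Rightarrow> real" and L
  assume d: "\<forall>y. (g has_real_derivative g1 y) (at y)" "\<forall>y. (g1 has_real_derivative g2 y) (at y)"
    and L: "\<forall>y. \<bar>g y\<bar> \<le> L \<and> \<bar>g1 y\<bar> \<le> L \<and> \<bar>g2 y\<bar> \<le> L \<and> \<bar>g3 y\<bar> \<le> L"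
  let ?W = "\<lambda>f. csum c A f / \<sigma>"
  have fA: "finite (set_pmf (bern p A))" using A by (simp add: finite_set_bern)
  have cA: "card A > 0" using A by (simp add: card_gt_0_iff)
  have s0: "\<sigma> > 0" using cA pq by (simp add: \<sigma>_def)
  have s2: "\<sigma>\<^sup>2 = card A * (p * q)" using cA pq by (simp add: \<sigma>_def)
  have lip: "\<bar>g1 a - g1 b\<bar> \<le> L * \<bar>a - b\<bar>" for a b
    using field_differentiable_bound[of UNIV g1 g2 L a b] d(2) L by auto
  have one: "\<bar>EE (bern p A) (\<lambda>f. (of_bool (f u) - p) * (c u / \<sigma> * g (?W f))) - p * q / \<sigma>\<^sup>2 * EE (bern p A) (\<lambda>f. g1 (?W f))\<bar>
       \<le> p * q * (L / \<sigma>^3)" if u: "u \<in> A" for u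
  proof -
    let ?d = "\<lambda>f. c u / \<sigma> * g (?W (f(u:=True))) - c u / \<sigma> * g (?W (f(u:=False)))"
    have cc: "c u * c u = 1" using c[OF u] by auto
    have pt: "\<bar>?d f - g1 (?W f) / \<sigma>\<^sup>2\<bar> \<le> L / \<sigma>^3" for f
    proof -
      let ?a = "?W (f(u:=False))" and ?b = "?W (f(u:=True))"
      have ba: "?b - ?a = c u / \<sigma>"
        using A u by (simp add: csum_upd diff_divide_distrib[symmetric] algebra_simps)
      obtain z where z: "g ?b - g ?a = (?b - ?a) * g1 z" "\<bar>z - ?a\<bar> \<le> \<bar>?b - ?a\<bar>" "\<bar>z - ?b\<bar> \<le> \<bar>?b - ?a\<bar>"
        using mvt_between[of g g1 ?b ?a] d(1) by blast
      have W: "?W f = ?a \<or> ?W f = ?b"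
        using fun_upd_triv[of f u] by (cases "f u") (simp_all del: fun_upd_triv)
      have "\<bar>?b - ?a\<bar> = 1 / \<sigma>" unfolding ba using c[OF u] s0 by auto
      then have zW: "\<bar>z - ?W f\<bar> \<le> 1 / \<sigma>" using W z(2,3) by (elim disjE) (simp_all only:)
      have "?d f = c u / \<sigma> * (g ?b - g ?a)" by (simp add: algebra_simps)
      also have "\<dots> = (c u * c u) * g1 z / \<sigma>\<^sup>2" unfolding z(1) ba by (simp add: power2_eq_square)
      finally have "?d f - g1 (?W f) / \<sigma>\<^sup>2 = (g1 z - g1 (?W f)) / \<sigma>\<^sup>2" using cc by (simp add: diff_divide_distrib)
      then have "\<bar>?d f - g1 (?W f) / \<sigma>\<^sup>2\<bar> = \<bar>g1 z - g1 (?W f)\<bar> / \<sigma>\<^sup>2" by simp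
      also have "\<dots> \<le> (L * (1/\<sigma>)) / \<sigma>\<^sup>2"
        using lip[of z "?W f"] zW L[rule_format, of 0] s0
        by (intro divide_right_mono order_trans[OF lip] mult_left_mono) auto
      finally show ?thesis using s0 by (simp add: power2_eq_square power3_eq_cube)
    qed
    have "EE (bern p A) (\<lambda>f. (of_bool (f u) - p) * (c u / \<sigma> * g (?W f))) - p * q / \<sigma>\<^sup>2 * EE (bern p A) (\<lambda>f. g1 (?W f))
      = p * q * EE (bern p A) (\<lambda>f. ?d f - g1 (?W f) / \<sigma>\<^sup>2)"
      by (subst EE_bern_cov[OF A(1) u], unfold EE_diff[OF fA]) (simp add: algebra_simps)
    moreover have "\<bar>EE (bern p A) (\<lambda>f. ?d f - g1 (?W f) / \<sigma>\<^sup>2)\<bar> \<le> L / \<sigma>^3"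
      by (rule EE_bound[OF fA pt])
    ultimately show ?thesis using pq(1) by (simp only: abs_pq mult_left_mono less_imp_le)
  qed
  have "?W f * g (?W f) = (\<Sum>u\<in>A. (of_bool (f u) - p) * (c u / \<sigma> * g (?W f)))" for f
  proof -
    have "(\<Sum>u\<in>A. (of_bool (f u) - p) * (c u / \<sigma> * g (?W f))) = (\<Sum>u\<in>A. (c u * (of_bool (f u) - p)) * (g (?W f) / \<sigma>))"
      by (rule sum.cong) simp_all
    also have "\<dots> = csum c A f * (g (?W f) / \<sigma>)" unfolding csum_def by (rule sum_distrib_right[symmetric])
    finally show ?thesis by simp
  qed
  then have eq: "EE (bern p A) (\<lambda>f. ?W f * g (?W f)) - EE (bern p A) (\<lambda>f. g1 (?W f))
    = (\<Sum>u\<in>A. EE (bern p A) (\<lambda>f. (of_bool (f u) - p) * (c u / \<sigma> * g (?W f))) - p * q / \<sigma>\<^sup>2 * EE (bern p A) (\<lambda>f. g1 (?W f)))"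
    using s0 s2 cA p q by (simp add: EE_sum[OF fA] sum_subtractf)
  have "\<bar>EE (bern p A) (\<lambda>f. ?W f * g (?W f)) - EE (bern p A) (\<lambda>f. g1 (?W f))\<bar> \<le> (\<Sum>u\<in>A. p * q * (L / \<sigma>^3))"
    unfolding eq by (rule order_trans[OF sum_abs sum_mono]) (rule one)
  moreover have "(\<Sum>u\<in>A. p * q * (L / \<sigma>^3)) = \<sigma>\<^sup>2 * (L / \<sigma>^3)" unfolding s2 by simp
  moreover have "\<sigma>\<^sup>2 * (L / \<sigma>^3) = L * (1 / \<sigma>)" using s0 by (simp add: power2_eq_square power3_eq_cube)
  ultimately show "\<bar>EE (bern p A) (\<lambda>f. ?W f * g (?W f)) - EE (bern p A) (\<lambda>f. g1 (?W f))\<bar> \<le> L * (1 / \<sigma>)"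
    by (simp only:)
qed

text \<open>A normal approximation uniform in z and in the signs; the exponent -1/32 is the exponent
  -1/2 of 1/\<sigma> in the variance times the 1/16 of \<open>stein_kolmogorov\<close>.\<close>

lemma signed_sum_cdf:
  assumes A: "finite A" and c: "\<And>u. u \<in> A \<Longrightarrow> c u = 1 \<or> c u = -1" and m: "1 \<le> real (card A) * (p * q)"
  shows "\<bar>measure_pmf.prob (bern p A) {f. (\<Sum>u\<in>A. c u * of_bool (f u)) \<le> z}
     - Phi ((z - p * (\<Sum>u\<in>A. c u)) / sqrt (card A * (p * q)))\<bar> \<le> 7 * (real (card A) * (p * q)) powr (-1/32)"
proof -
  let ?s = "sqrt (card A * (p * q))"
  have s1: "1 \<le> ?s" using m by simp
  have ne: "A \<noteq> {}" using m by auto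
  have "(\<Sum>u\<in>A. c u * of_bool (f u)) = csum c A f + p * (\<Sum>u\<in>A. c u)" for f
    by (simp add: csum_def sum_distrib_left sum.distrib[symmetric] algebra_simps sum_subtractf)
  then have "(\<Sum>u\<in>A. c u * of_bool (f u)) \<le> z \<longleftrightarrow> csum c A f / ?s \<le> (z - p * (\<Sum>u\<in>A. c u)) / ?s" for f
    using s1 by (subst divide_le_cancel) (auto simp: not_less)
  moreover have "\<bar>measure_pmf.prob (bern p A) {f. csum c A f / ?s \<le> (z - p * (\<Sum>u\<in>A. c u)) / ?s}
      - Phi ((z - p * (\<Sum>u\<in>A. c u)) / ?s)\<bar> \<le> 7 * (1/?s) powr (1/16)"
    by (rule stein_kolmogorov[OF finite_set_bern[OF A] csum_stein[OF A ne c]]) (use s1 m in auto)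
  moreover have "(1/?s) powr (1/16) = (real (card A) * (p * q)) powr (-1/32)"
  proof -
    have "1 / ?s = (real (card A) * (p * q)) powr (-1/2)"
      using m powr_half_sqrt[of "real (card A) * (p * q)"] powr_minus_divide[of "real (card A) * (p * q)" "1/2"] by simp
    then show ?thesis by (simp only: powr_powr) simp
  qed
  ultimately show ?thesis by simp
qed

end

section \<open>Local limit law of a signed Bernoulli sum\<close>

text \<open>Unlike the usual sign it is never 0, so every value is a color, also for the real-valued
  predictor \<open>Yt\<close>.\<close>

definition sg :: "real \<Rightarrow> real" where "sg z = (if z > 0 then 1 else -1)"

lemma sg_simps: "\<bar>sg z\<bar> = 1" "sg z * sg z = 1" "(sg z)\<^sup>2 = 1"
  by (auto simp: sg_def)

lemma sg_odd_minus: "odd (c::int) \<Longrightarrow> sg (real_of_int (- c)) = - sg (real_of_int c)"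
  by (auto simp: sg_def)

text \<open>Odd numbers move in steps of two, so the sign can change only between -1 and 1.\<close>

lemma sg_odd_step: "odd (c::int) \<Longrightarrow> sg (real_of_int (c + 2)) - sg (real_of_int c) = 2 * of_bool (c + 1 = 0)"
  by (auto simp: sg_def elim!: oddE)

context bernoulli begin

text \<open>\<open>law r b \<phi>\<close> is the expectation of \<open>\<phi>(X - X')\<close> for independent binomials \<open>X \<sim> Bin(r,p)\<close>, \<open>X' \<sim> Bin(b,p)\<close>.\<close>

fun law :: "nat \<Rightarrow> nat \<Rightarrow> (int \<Rightarrow> real) \<Rightarrow> real" where
  "law 0 0 \<phi> = \<phi> 0"
| "law (Suc r) b \<phi> = p * law r b (\<lambda>k. \<phi> (k + 1)) + q * law r b \<phi>"
| "law 0 (Suc b) \<phi> = p * law 0 b (\<lambda>k. \<phi> (k - 1)) + q * law 0 b \<phi>"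

text \<open>The recursion exhausts the first binomial before it touches the second; independence
  lets the second be peeled at any moment.\<close>

lemma law_Suc2: "law r (Suc b) \<phi> = p * law r b (\<lambda>k. \<phi> (k - 1)) + q * law r b \<phi>"
  by (induction r arbitrary: \<phi>) (simp_all add: algebra_simps)

lemma law_diff: "law r b (\<lambda>k. \<phi> k - \<psi> k) = law r b \<phi> - law r b \<psi>"
proof (induction r arbitrary: \<phi> \<psi>)
  case 0
  show ?case by (induction b arbitrary: \<phi> \<psi>) (simp_all add: right_diff_distrib)
qed (simp add: right_diff_distrib)

lemma law_cmult: "law r b (\<lambda>k. a * \<phi> k) = a * law r b \<phi>"
proof (induction r arbitrary: \<phi>)
  case 0
  show ?case by (induction b arbitrary: \<phi>) (simp_all add: algebra_simps)
qed (simp add: algebra_simps)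

lemma law_swap: "law r b (\<lambda>k. \<phi> (- k)) = law b r \<phi>"
proof (induction r arbitrary: \<phi>)
  case 0
  show ?case
  proof (induction b arbitrary: \<phi>)
    case (Suc b)
    show ?case using Suc[of "\<lambda>k. \<phi> (k + 1)"] Suc[of \<phi>] by simp
  qed simp
next
  case (Suc r)
  have "law r b (\<lambda>k. \<phi> (- (k + 1))) = law b r (\<lambda>k. \<phi> (k - 1))"
    using Suc[of "\<lambda>k. \<phi> (k - 1)"] by (simp add: algebra_simps)
  then show ?case using Suc[of \<phi>] by (simp add: law_Suc2)
qed

lemma EE_law:
  fixes x :: "'a \<Rightarrow> int"
  assumes "finite A" "\<And>u. u \<in> A \<Longrightarrow> x u = 1 \<or> x u = -1"
  shows "EE (bern p A) (\<lambda>f. \<phi> (\<Sum>u\<in>A. x u * of_bool (f u)))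
    = law (card {u\<in>A. x u = 1}) (card {u\<in>A. x u = -1}) \<phi>"
  using assms
proof (induction A arbitrary: \<phi>)
  case empty
  then show ?case by (simp add: EE_bern_empty)
next
  case (insert a A)
  have s: "(\<Sum>u\<in>insert a A. x u * of_bool ((f(a := b)) u)) = (\<Sum>u\<in>A. x u * of_bool (f u)) + x a * of_bool b" for f b
  proof -
    have "(\<Sum>u\<in>A. x u * of_bool ((f(a := b)) u)) = (\<Sum>u\<in>A. x u * of_bool (f u))"
      by (rule sum.cong) (use insert.hyps in auto)
    then show ?thesis unfolding sum.insert[OF insert.hyps] by (simp only: fun_upd_same add.commute)
  qed
  note IH = insert.IH[OF insert.prems]
  have e: "EE (bern p (insert a A)) (\<lambda>f. \<phi> (\<Sum>u\<in>insert a A. x u * of_bool (f u)))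
     = p * law (card {u\<in>A. x u = 1}) (card {u\<in>A. x u = -1}) (\<lambda>k. \<phi> (k + x a))
       + q * law (card {u\<in>A. x u = 1}) (card {u\<in>A. x u = -1}) \<phi>"
    using IH[of "\<lambda>k. \<phi> (k + x a)"] IH[of \<phi>]
    by (subst EE_bern_insert[OF insert.hyps(1,2)]) (simp only: s, simp)
  consider "x a = 1" | "x a = -1" using insert.prems by blast
  then show ?case
  proof cases
    case 1
    then have "{u \<in> insert a A. x u = 1} = insert a {u\<in>A. x u = 1}" "{u \<in> insert a A. x u = -1} = {u\<in>A. x u = -1}" by auto
    then show ?thesis unfolding e using insert.hyps 1 by simp
  next
    case 2
    then have "{u \<in> insert a A. x u = -1} = insert a {u\<in>A. x u = -1}" "{u \<in> insert a A. x u = 1} = {u\<in>A. x u = 1}" by auto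
    then show ?thesis unfolding e using insert.hyps 2 by (simp add: law_Suc2)
  qed
qed

section \<open>Local limit theorem by Fourier analysis\<close>

definition \<psi> :: "real \<Rightarrow> real" where "\<psi> t = 1 - 2 * (p * q) * (1 - cos t)"

text \<open>Fourier inversion; \<open>\<psi>\<close> is the characteristic function of the difference of two independent Bernoulli variables.\<close>

definition fint :: "nat \<Rightarrow> int \<Rightarrow> real" where
  "fint m k = 1 / (2 * pi) * integral {-pi..pi} (\<lambda>t. cos (k * t) * \<psi> t ^ m)"

lemma fint_0: "fint 0 k = of_bool (0 = k)"
proof (cases "k = 0")
  case False
  have "((\<lambda>t. cos (k * t)) has_integral sin (k * pi) / k - sin (k * (-pi)) / k) {-pi..pi}"
    by (rule fundamental_theorem_of_calculus)
       (use False in \<open>auto intro!: derivative_eq_intros simp flip: has_real_derivative_iff_has_vector_derivative\<close>)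
  moreover have "sin (k * pi) = 0" using sin_int_times_real[of k] by (metis sin_zero_iff_int2)
  ultimately show ?thesis using False by (simp add: fint_def integral_unique)
qed (simp add: fint_def)

lemma \<psi>_cont [continuous_intros]: "continuous_on S \<psi>"
  unfolding \<psi>_def by (intro continuous_intros)

lemma fint_Suc: "fint (Suc m) k = (1 - 2 * (p * q)) * fint m k + p * q * (fint m (k - 1) + fint m (k + 1))"
proof -
  have i: "(\<lambda>t. cos (real_of_int j * t) * \<psi> t ^ m) integrable_on {-pi..pi}" for j
    by (intro integrable_continuous_interval continuous_intros)
  have c: "cos (real_of_int (k - 1) * t) + cos (real_of_int (k + 1) * t) = 2 * cos (k * t) * cos t" for t :: real
    by (simp add: algebra_simps cos_add cos_diff)
  have *: "cos (k * t) * \<psi> t ^ Suc m = (1 - 2 * (p * q)) * (cos (k * t) * \<psi> t ^ m)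
     + p * q * (cos (real_of_int (k - 1) * t) * \<psi> t ^ m + cos (real_of_int (k + 1) * t) * \<psi> t ^ m)" for t :: real
  proof -
    have "cos (k * t) * \<psi> t ^ Suc m = (1 - 2 * (p * q)) * (cos (k * t) * \<psi> t ^ m) + p * q * ((2 * cos (k * t) * cos t) * \<psi> t ^ m)"
      unfolding power_Suc by (subst \<psi>_def) (simp add: algebra_simps)
    then show ?thesis unfolding c[symmetric] by (simp add: algebra_simps)
  qed
  have "integral {-pi..pi} (\<lambda>t. cos (k * t) * \<psi> t ^ Suc m) = (1 - 2 * (p * q)) * integral {-pi..pi} (\<lambda>t. cos (k * t) * \<psi> t ^ m)
    + p * q * (integral {-pi..pi} (\<lambda>t. cos (real_of_int (k-1) * t) * \<psi> t ^ m) + integral {-pi..pi} (\<lambda>t. cos (real_of_int (k+1) * t) * \<psi> t ^ m))"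
  proof -
    have "((\<lambda>t. (1 - 2 * (p * q)) * (cos (real_of_int k * t) * \<psi> t ^ m)
     + p * q * (cos (real_of_int (k - 1) * t) * \<psi> t ^ m + cos (real_of_int (k + 1) * t) * \<psi> t ^ m)) has_integral
      (1 - 2 * (p * q)) * integral {-pi..pi} (\<lambda>t. cos (real_of_int k * t) * \<psi> t ^ m)
    + p * q * (integral {-pi..pi} (\<lambda>t. cos (real_of_int (k-1) * t) * \<psi> t ^ m) + integral {-pi..pi} (\<lambda>t. cos (real_of_int (k+1) * t) * \<psi> t ^ m))) {-pi..pi}"
      by (intro has_integral_add has_integral_mult_right integrable_integral i)
    then show ?thesis unfolding * by (rule integral_unique)
  qed
  then show ?thesis unfolding fint_def by (simp only:) (simp add: algebra_simps add_divide_distrib diff_divide_distrib)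
qed

text \<open>Both sides obey the same recurrence in m: a difference of two independent Bernoulli
  variables is 0 with probability p^2 + q^2 = 1 - 2 p q and each of 1, -1 with probability p q. So
  the inversion formula is verified by induction.\<close>

lemma law_fint: "law m m (\<lambda>j. of_bool (j = k)) = fint m k"
proof (induction m arbitrary: k)
  case 0
  then show ?case by (simp add: fint_0)
next
  case (Suc m)
  have a: "(\<lambda>j. of_bool (j + 1 = k)) = (\<lambda>j. of_bool (j = k - 1) :: real)"
     "(\<lambda>j. of_bool (j - 1 = k)) = (\<lambda>j. of_bool (j = k + 1) :: real)" for k :: int
    by (auto simp: fun_eq_iff)
  have "law (Suc m) (Suc m) (\<lambda>j. of_bool (j = k)) = (p * p + q * q) * fint m k + p * q * (fint m (k - 1) + fint m (k + 1))"
    unfolding law.simps law_Suc2 a Suc.IH by (simp add: algebra_simps)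
  moreover have "p * p + q * q = 1 - 2 * (p * q)" by (simp add: q_def algebra_simps)
  ultimately show ?case by (simp add: fint_Suc)
qed

lemma \<psi>_bounds: "0 \<le> \<psi> t" "\<psi> t \<le> 1"
proof -
  have "2 * (p * q) * (1 - cos t) \<le> (2 * (1/4)) * 2"
    using pq by (intro mult_mono) auto
  then show "0 \<le> \<psi> t" by (simp add: \<psi>_def)
  show "\<psi> t \<le> 1" using pq by (simp add: \<psi>_def)
qed

lemma cos_taylor: "\<bar>1 - cos t - t\<^sup>2/2\<bar> \<le> (t::real)^4 / 24"
proof -
  obtain s where s: "cos t = (\<Sum>k<4. cos_coeff k * t^k) + (cos (s + 1/2 * real 4 * pi) / fact 4) * t^4"
    using Maclaurin_cos_expansion[of t 4] by blast
  have c: "(\<Sum>k<4. cos_coeff k * t^k) = 1 - t\<^sup>2/2"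
  proof -
    have "{..<4::nat} = {0,1,2,3}" by auto
    then show ?thesis by (simp add: cos_coeff_def)
  qed
  have "\<bar>1 - cos t - t\<^sup>2/2\<bar> = \<bar>cos (s + 1/2 * real 4 * pi)\<bar> * (t^4 / 24)"
    unfolding s c by (simp add: abs_mult fact_numeral)
  also have "\<dots> \<le> 1 * (t^4 / 24)" by (intro mult_right_mono) auto
  finally show ?thesis by simp
qed

lemma power_diff_le: "\<bar>a ^ m - b ^ m\<bar> \<le> m * \<bar>a - b\<bar>" if "0 \<le> a" "a \<le> 1" "0 \<le> b" "b \<le> 1" for a b :: real
  using norm_power_diff[of a b m] that by simp

text \<open>The antiderivative is a rescaled Phi, and truncation at t0 costs one normal tail at t0 *
  sqrt (2 a) on each side.\<close>

lemma gauss_integral: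
  assumes a: "a > 0" and t0: "t0 > 0"
  shows "\<bar>integral {-t0..t0} (\<lambda>t. exp (- a * t\<^sup>2)) - sqrt (pi / a)\<bar> \<le> sqrt (pi / a) / (a * t0\<^sup>2)"
proof -
  define y where "y = t0 * sqrt (2 * a)"
  have y: "y > 0" "y\<^sup>2 = 2 * a * t0\<^sup>2" using a t0 by (auto simp: y_def power_mult_distrib)
  have "((\<lambda>t. exp (- a * t\<^sup>2)) has_integral sqrt (pi / a) * Phi (t0 * sqrt (2 * a)) - sqrt (pi / a) * Phi ((-t0) * sqrt (2 * a))) {-t0..t0}"
  proof (rule fundamental_theorem_of_calculus)
    fix t assume "t \<in> {-t0..t0}"
    have "((\<lambda>t. Phi (t * sqrt (2*a))) has_real_derivative std_normal_density (t * sqrt (2*a)) * sqrt (2*a)) (at t)"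
      by (rule DERIV_chain2[OF Phi_deriv]) (auto intro!: derivative_eq_intros)
    from DERIV_cmult[OF this, of "sqrt (pi/a)"]
    have "((\<lambda>t. sqrt (pi / a) * Phi (t * sqrt (2*a))) has_real_derivative exp (- a * t\<^sup>2)) (at t)"
    proof (rule back_subst[where P="\<lambda>D. (_ has_real_derivative D) _"])
      have "sqrt (pi / a) * sqrt (2 * a) = sqrt (2 * pi)" using a by (simp add: real_sqrt_mult[symmetric])
      moreover have "std_normal_density (t * sqrt (2*a)) = exp (- a * t\<^sup>2) / sqrt (2 * pi)"
        using a by (simp add: std_normal_density_def power_mult_distrib mult.commute)
      moreover have "sqrt (2 * pi) \<noteq> 0" by simp
      ultimately show "sqrt (pi / a) * (std_normal_density (t * sqrt (2*a)) * sqrt (2*a)) = exp (- a * t\<^sup>2)"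
        by (metis mult.assoc mult.commute nonzero_divide_eq_eq)
    qed
    then show "((\<lambda>t. sqrt (pi / a) * Phi (t * sqrt (2*a))) has_vector_derivative exp (- a * t\<^sup>2)) (at t within {-t0..t0})"
      by (simp add: has_real_derivative_iff_has_vector_derivative has_vector_derivative_at_within)
  qed (use t0 in simp)
  then have "integral {-t0..t0} (\<lambda>t. exp (- a * t\<^sup>2)) = sqrt (pi / a) * (Phi y - Phi (-y))"
    by (simp add: integral_unique y_def right_diff_distrib)
  moreover have "Phi y - Phi (-y) \<le> 1" "1 - 1 / (a * t0\<^sup>2) \<le> Phi y - Phi (-y)"
  proof -
    show "Phi y - Phi (-y) \<le> 1" using Phi_range[of y] Phi_range[of "-y"] by linarith
    have "1 / y\<^sup>2 + 1 / y\<^sup>2 = 1 / (a * t0\<^sup>2)" using a t0 by (simp add: y(2) field_simps)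
    then show "1 - 1 / (a * t0\<^sup>2) \<le> Phi y - Phi (-y)" using Phi_tail[OF y(1)] by linarith
  qed
  moreover have "0 \<le> sqrt (pi / a)" using a by simp
  ultimately have "sqrt (pi/a) * (1 - 1 / (a * t0\<^sup>2)) \<le> integral {-t0..t0} (\<lambda>t. exp (- a * t\<^sup>2))"
     "integral {-t0..t0} (\<lambda>t. exp (- a * t\<^sup>2)) \<le> sqrt (pi/a) * 1"
    by (simp_all only: mult_left_mono)
  then show ?thesis by (simp add: abs_le_iff algebra_simps)
qed

text \<open>Laplace's method. On [-t0, t0] replacing the cosine by 1 costs k^2 t^2 and replacing the
  power of \<open>\<psi>\<close> by a Gaussian costs m t^4, which integrates to the first error
  term. Outside, \<open>\<psi>\<close> is at most exp (- p q t0^2 / 2), the second term. Completing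
  the Gaussian integral gives the third.\<close>

lemma fint_local:
  fixes m :: nat and k :: int and t0 :: real
  assumes t0: "0 < t0" "t0 \<le> 1" and m: "m \<ge> 1"
  defines "a \<equiv> real m * (p * q)"
  shows "\<bar>fint m k - 1 / sqrt (4 * pi * a)\<bar> \<le> t0^3 * ((real_of_int k)\<^sup>2 + m * t0\<^sup>2) + exp (- a * t0\<^sup>2 / 2) + 1 / (sqrt a * (a * t0\<^sup>2))"
proof -
  have a: "a > 0" using m pq by (simp add: a_def)
  let ?F = "\<lambda>t::real. cos (k * t) * \<psi> t ^ m"
  let ?g = "\<lambda>t. exp (- a * t\<^sup>2)"
  have t0pi: "t0 \<le> pi" using t0 pi_gt3 by linarith
  have int: "f integrable_on {x..y}" if "continuous_on UNIV f" for f :: "real \<Rightarrow> real" and x y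
    using that continuous_on_subset by (intro integrable_continuous_interval) blast
  have cF: "continuous_on UNIV ?F" by (intro continuous_intros)
  have cg: "continuous_on UNIV ?g" by (intro continuous_intros)
  have split: "integral {-pi..pi} ?F = integral {-pi..-t0} ?F + integral {-t0..t0} ?F + integral {t0..pi} ?F"
    using Henstock_Kurzweil_Integration.integral_combine[where a="-pi" and c="-t0" and b=pi and f="?F"] Henstock_Kurzweil_Integration.integral_combine[where a="-t0" and c=t0 and b=pi and f="?F"] int[OF cF] t0 t0pi by simp
  have \<psi>a: "\<bar>?F t\<bar> \<le> \<psi> t ^ m" for t
    using \<psi>_bounds[of t] by (simp add: abs_mult mult_left_le_one_le)
  have out: "\<bar>?F t\<bar> \<le> exp (- a * t0\<^sup>2 / 2)" if t: "t0 \<le> \<bar>t\<bar>" "\<bar>t\<bar> \<le> pi" for t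
  proof -
    have "cos t = cos \<bar>t\<bar>" by simp
    also have "\<dots> \<le> cos t0" using t t0 by (intro cos_monotone_0_pi_le) auto
    finally have c: "cos t \<le> cos t0" .
    have "t0^4 \<le> t0^2" using t0 by (intro power_decreasing) auto
    then have "t0\<^sup>2/4 \<le> 1 - cos t0" using cos_taylor[of t0] zero_le_power2[of t0] unfolding abs_le_iff by linarith
    then have "t0\<^sup>2/4 \<le> 1 - cos t" using c by simp
    then have "2 * (p * q) * (t0\<^sup>2/4) \<le> 2 * (p * q) * (1 - cos t)" using pq by (intro mult_left_mono) auto
    then have "\<psi> t \<le> 1 - p * q * t0\<^sup>2 / 2" by (simp add: \<psi>_def)
    also have "\<dots> \<le> exp (- (p * q * t0\<^sup>2 / 2))" using exp_ge_add_one_self[of "- (p * q * t0\<^sup>2 / 2)"] by simp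
    finally have "\<psi> t ^ m \<le> exp (- (p * q * t0\<^sup>2 / 2)) ^ m" using \<psi>_bounds by (intro power_mono)
    also have "\<dots> = exp (- a * t0\<^sup>2 / 2)" by (simp add: exp_of_nat_mult[symmetric] a_def)
    finally show ?thesis using \<psi>a[of t] by simp
  qed
  have o1: "\<bar>integral {-pi..-t0} ?F\<bar> \<le> exp (- a * t0\<^sup>2 / 2) * (- t0 - (- pi))"
    using integral_bound[of "-pi" "-t0" ?F "exp (- a * t0\<^sup>2 / 2)"] t0pi out t0 continuous_on_subset[OF cF] by auto
  have o2: "\<bar>integral {t0..pi} ?F\<bar> \<le> exp (- a * t0\<^sup>2 / 2) * (pi - t0)"
    using integral_bound[of t0 pi ?F "exp (- a * t0\<^sup>2 / 2)"] t0pi out t0 continuous_on_subset[OF cF] by auto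
  let ?B = "(real_of_int k)\<^sup>2 * t0\<^sup>2 + m * t0^4"
  have inn: "\<bar>?F t - ?g t\<bar> \<le> ?B" if t: "\<bar>t\<bar> \<le> t0" for t
  proof -
    have t2: "t\<^sup>2 \<le> t0\<^sup>2" using t by (metis abs_le_square_iff abs_of_pos t0(1))
    have "t^4 = (t\<^sup>2)\<^sup>2" "t0^4 = (t0\<^sup>2)\<^sup>2" by simp_all
    then have t4: "t^4 \<le> t0^4" using t2 power_mono[OF t2, of 2] by simp
    have "\<bar>?F t - \<psi> t ^ m\<bar> = \<bar>cos (k * t) - 1\<bar> * \<psi> t ^ m"
    proof -
      have "?F t - \<psi> t ^ m = (cos (k * t) - 1) * \<psi> t ^ m" by (simp add: left_diff_distrib)
      then show ?thesis using \<psi>_bounds(1)[of t] by (simp add: abs_mult)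
    qed
    also have "\<dots> \<le> \<bar>cos (k * t) - 1\<bar> * 1"
      using \<psi>_bounds[of t] by (intro mult_left_mono) (auto simp: power_le_one)
    also have "\<dots> \<le> (k * t)\<^sup>2" 
    proof -
      have "1 - cos (k * t) = 2 * (sin (k * t / 2))\<^sup>2" using cos_double_sin[of "k * t / 2"] by simp
      moreover have "(sin (k * t / 2))\<^sup>2 \<le> (k * t / 2)\<^sup>2"
        using abs_sin_x_le_abs_x[of "k * t / 2"] unfolding abs_le_square_iff .
      moreover have "(k * t / 2)\<^sup>2 = (k * t)\<^sup>2 / 4" by (simp add: power_divide)
      moreover have "1 - c = 2 * x \<Longrightarrow> x \<le> y \<Longrightarrow> y = z / 4 \<Longrightarrow> 0 \<le> x \<Longrightarrow> \<bar>c - 1\<bar> * 1 \<le> z" for c x y z :: real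
        unfolding mult_1_right abs_le_iff by linarith
      ultimately show ?thesis using zero_le_power2[of "sin (k * t / 2)"] by blast
    qed
    also have "\<dots> \<le> (real_of_int k)\<^sup>2 * t0\<^sup>2" using t2 by (simp add: power_mult_distrib mult_left_mono)
    finally have 1: "\<bar>?F t - \<psi> t ^ m\<bar> \<le> (real_of_int k)\<^sup>2 * t0\<^sup>2" .
    define e where "e = exp (- (p * q * t\<^sup>2))"
    have em: "?g t = e ^ m" by (simp add: e_def exp_of_nat_mult[symmetric] a_def algebra_simps)
    let ?x = "p * q * t\<^sup>2"
    have x0: "0 \<le> ?x" using pq by simp
    have el: "1 - ?x \<le> e" unfolding e_def using exp_ge_add_one_self[of "- ?x"] by simp
    have eu: "e \<le> 1 - ?x + ?x\<^sup>2/2"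
    proof -
      have pos: "0 < 1 + ?x + ?x\<^sup>2/2" using x0 by (simp add: add_pos_nonneg)
      have "e = 1 / exp ?x" by (simp add: e_def exp_minus field_simps)
      also have "\<dots> \<le> 1 / (1 + ?x + ?x\<^sup>2/2)"
        using exp_lower_Taylor_quadratic[OF x0] pos by (intro divide_left_mono) auto
      also have "\<dots> \<le> 1 - ?x + ?x\<^sup>2/2"
      proof -
        have "(1 + ?x + ?x\<^sup>2/2) * (1 - ?x + ?x\<^sup>2/2) = 1 + (?x\<^sup>2)\<^sup>2 / 4" by (simp add: power2_eq_square algebra_simps)
        then have "1 \<le> (1 - ?x + ?x\<^sup>2/2) * (1 + ?x + ?x\<^sup>2/2)" by (simp add: mult.commute)
        then show ?thesis using pos by (simp only: divide_le_eq if_True)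
      qed
      finally show ?thesis .
    qed
    have x2: "?x\<^sup>2/2 \<le> t^4/2"
    proof -
      have "?x \<le> 1 * t\<^sup>2" using pq by (intro mult_right_mono) auto
      then have "?x\<^sup>2 \<le> (t\<^sup>2)\<^sup>2" using x0 by (intro power_mono) auto
      then show ?thesis by simp
    qed
    have "\<bar>\<psi> t - (1 - ?x)\<bar> = 2 * (p * q) * \<bar>1 - cos t - t\<^sup>2/2\<bar>"
    proof -
      have "\<psi> t - (1 - ?x) = - (2 * (p * q) * (1 - cos t - t\<^sup>2/2))" by (simp add: \<psi>_def algebra_simps)
      then show ?thesis using p q by (simp add: abs_mult)
    qed
    also have "\<dots> \<le> 1 * (t^4/24)" using pq cos_taylor[of t] by (intro mult_mono) auto
    finally have "\<bar>\<psi> t - (1 - ?x)\<bar> \<le> t^4/24" by simp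
    moreover have "0 \<le> t^4" by simp
    ultimately have "\<bar>\<psi> t - e\<bar> \<le> t^4" using el eu x2 unfolding abs_le_iff by linarith
    then have "\<bar>\<psi> t ^ m - e ^ m\<bar> \<le> m * t^4"
      using power_diff_le[OF \<psi>_bounds[of t], of e m] x0
      by (intro order_trans[OF power_diff_le[OF \<psi>_bounds]] mult_left_mono) (auto simp: e_def)
    also have "\<dots> \<le> m * t0^4" using t4 by (intro mult_left_mono) auto
    finally show ?thesis using 1 em by linarith
  qed
  have i1: "\<bar>integral {-t0..t0} ?F - integral {-t0..t0} ?g\<bar> \<le> ?B * (t0 - (-t0))"
  proof -
    have "integral {-t0..t0} ?F - integral {-t0..t0} ?g = integral {-t0..t0} (\<lambda>t. ?F t - ?g t)"
      by (rule integral_diff[symmetric]) (rule int[OF cF], rule int[OF cg])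
    moreover have "norm (integral {-t0..t0} (\<lambda>t. ?F t - ?g t)) \<le> ?B * (t0 - (-t0))"
    proof (rule integral_bound)
      show "continuous_on {-t0..t0} (\<lambda>t. ?F t - ?g t)"
        using continuous_on_subset[OF cF] continuous_on_subset[OF cg] by (intro continuous_on_diff) auto
    qed (use inn t0 in auto)
    ultimately show ?thesis by simp
  qed
  let ?E = "exp (- a * t0\<^sup>2 / 2)"
  have E0: "0 \<le> ?E * t0" using t0 by simp
  have tot: "\<bar>integral {-pi..pi} ?F - sqrt (pi/a)\<bar> \<le> ?E * (2 * pi) + 2 * t0 * ?B + sqrt (pi/a) / (a * t0\<^sup>2)"
  proof -
    have "?E * (- t0 - (- pi)) + ?E * (pi - t0) = ?E * (2 * pi) - 2 * (?E * t0)" by (simp add: algebra_simps)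
    moreover have "?B * (t0 - (-t0)) = 2 * t0 * ?B" by (simp add: algebra_simps)
    ultimately show ?thesis using o1 o2 i1 gauss_integral[OF a t0(1)] E0 unfolding split by linarith
  qed
  have sq: "sqrt (pi/a) / (2 * pi) = 1 / sqrt (4 * pi * a)"
  proof -
    have "(2 * pi) = sqrt ((2*pi)\<^sup>2)" by (simp only: real_sqrt_abs) simp
    then have "sqrt (pi/a) / (2 * pi) = sqrt ((pi/a) / (2*pi)\<^sup>2)" by (metis real_sqrt_divide)
    also have "(pi/a) / (2*pi)\<^sup>2 = 1 / (4 * pi * a)" by (simp add: power2_eq_square field_simps)
    finally show ?thesis by (simp add: real_sqrt_divide)
  qed
  have "\<bar>fint m k - 1 / sqrt (4 * pi * a)\<bar> = \<bar>integral {-pi..pi} ?F - sqrt (pi/a)\<bar> / (2 * pi)"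
    unfolding fint_def sq[symmetric] by (simp add: diff_divide_distrib[symmetric])
  also have "\<dots> \<le> (?E * (2 * pi) + 2 * t0 * ?B + sqrt (pi/a) / (a * t0\<^sup>2)) / (2 * pi)"
    using tot by (intro divide_right_mono) auto
  also have "\<dots> = ?E + t0 * ?B / pi + 1 / sqrt (4 * pi * a) / (a * t0\<^sup>2)"
    unfolding sq[symmetric] by (simp add: add_divide_distrib)
  also have "t0 * ?B / pi \<le> t0 * ?B"
  proof -
    have "0 \<le> t0 * ?B" using t0 by simp
    moreover have "1 \<le> pi" using pi_gt3 by linarith
    ultimately show ?thesis using mult_left_mono[of 1 pi "t0 * ?B"] by (simp add: divide_le_eq)
  qed
  also have "1 / sqrt (4 * pi * a) / (a * t0\<^sup>2) \<le> 1 / (sqrt a * (a * t0\<^sup>2))"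
  proof -
    have "1 * a \<le> 4 * pi * a" using a pi_gt3 by (intro mult_right_mono) auto
    then have "sqrt a \<le> sqrt (4 * pi * a)" by simp
    then have "1 / sqrt (4 * pi * a) \<le> 1 / sqrt a" using a by (intro divide_left_mono) auto
    then have "1 / sqrt (4 * pi * a) / (a * t0\<^sup>2) \<le> 1 / sqrt a / (a * t0\<^sup>2)" using a t0 by (intro divide_right_mono) auto
    then show ?thesis by simp
  qed
  also have "t0 * ?B = t0^3 * ((real_of_int k)\<^sup>2 + m * t0\<^sup>2)"
    by (simp add: power2_eq_square power3_eq_cube power4_eq_xxxx algebra_simps)
  finally show ?thesis by simp
qed

text \<open>An additional variable averages the probabilities of two adjacent points. An
  approximation by one constant P, uniform over a range of k, therefore survives with the same error
  while the range shrinks by one per variable.\<close>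

lemma law_point_extend:
  assumes "\<And>k. \<bar>k\<bar> \<le> J \<Longrightarrow> \<bar>law m m (\<lambda>j. of_bool (j = k)) - P\<bar> \<le> e"
  shows "\<bar>k\<bar> + int i + int l \<le> J \<Longrightarrow> \<bar>law (m + i) (m + l) (\<lambda>j. of_bool (j = k)) - P\<bar> \<le> e"
proof -
  have conv: "\<bar>p * a + q * b - P\<bar> \<le> e" if "\<bar>a - P\<bar> \<le> e" "\<bar>b - P\<bar> \<le> e" for a b
  proof -
    have "p * a + q * b - P = p * (a - P) + q * (b - P)" by (simp add: q_def algebra_simps)
    also have "\<bar>\<dots>\<bar> \<le> p * \<bar>a - P\<bar> + q * \<bar>b - P\<bar>"
      using p q by (intro order_trans[OF abs_triangle_ineq]) (simp add: abs_mult)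
    also have "\<dots> \<le> p * e + q * e" using that p q by (intro add_mono mult_left_mono) auto
    also have "\<dots> = e" by (simp add: q_def algebra_simps)
    finally show ?thesis .
  qed
  have a: "(\<lambda>j. of_bool (j + 1 = k)) = (\<lambda>j. of_bool (j = k - 1) :: real)"
     "(\<lambda>j. of_bool (j - 1 = k)) = (\<lambda>j. of_bool (j = k + 1) :: real)" for k :: int
    by (auto simp: fun_eq_iff)
  show "\<bar>k\<bar> + int i + int l \<le> J \<Longrightarrow> \<bar>law (m + i) (m + l) (\<lambda>j. of_bool (j = k)) - P\<bar> \<le> e"
  proof (induction i arbitrary: k)
    case 0
    then show ?case
    proof (induction l arbitrary: k)
      case 0
      then show ?case using assms by simp
    next
      case (Suc l)
      then show ?case using Suc.IH[of "k+1"] Suc.IH[of k] by (auto simp: law_Suc2 a intro!: conv)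
    qed
  next
    case (Suc i)
    then show ?case using Suc.IH[of "k-1"] Suc.IH[of k] by (auto simp: a intro!: conv)
  qed
qed

text \<open>For equal groups the law is symmetric, so the expected sign is odd in c; it grows by
  twice a point probability when c grows by 2, hence is about P c. Each additional variable shifts c
  by 2 or -2 with probability p, which explains the mean shift 2 p (i - l).\<close>

lemma law_sign_extend:
  fixes P e :: real and c :: int
  assumes pt: "\<And>k. \<bar>k\<bar> \<le> J \<Longrightarrow> \<bar>law m m (\<lambda>j. of_bool (j = k)) - P\<bar> \<le> e"
  shows "odd c \<Longrightarrow> \<bar>c\<bar> + 2 * int i + 2 * int l \<le> 2 * J \<Longrightarrow>
    \<bar>law (m + i) (m + l) (\<lambda>k. sg (real_of_int (2 * k + c))) - P * (c + 2 * p * (real i - real l))\<bar>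
     \<le> real_of_int (\<bar>c\<bar> + 2 * int i + 2 * int l) * e"
proof -
  let ?H = "\<lambda>c. law m m (\<lambda>k. sg (real_of_int (2 * k + c)))"
  have e0: "0 \<le> e" if "0 \<le> J" using pt[of 0] that by linarith
  have Hm: "?H (- c) = - ?H c" if "odd c" for c :: int
  proof -
    have "?H (-c) = law m m (\<lambda>k. sg (real_of_int (2 * (- k) + (- c))))"
      using law_swap[of m m "\<lambda>k. sg (real_of_int (2 * k + (- c)))"] by simp
    also have "\<dots> = law m m (\<lambda>k. (-1) * sg (real_of_int (2 * k + c)))"
      using sg_odd_minus[of "2 * k + c" for k] that by simp
    finally show ?thesis unfolding law_cmult by simp
  qed
  have Hs: "?H (c + 2) - ?H c = 2 * law m m (\<lambda>k. of_bool (k = - ((c + 1) div 2)))" if "odd c" for c :: int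
  proof -
    have "?H (c + 2) - ?H c = law m m (\<lambda>k. sg (real_of_int ((2 * k + c) + 2)) - sg (real_of_int (2 * k + c)))"
      unfolding law_diff by (simp add: add.assoc)
    also have "\<dots> = law m m (\<lambda>k. 2 * of_bool ((2 * k + c) + 1 = 0))"
      using that sg_odd_step[of "2 * k + c" for k] by simp
    also have "(\<lambda>k. 2 * of_bool ((2 * k + c) + 1 = 0) :: real) = (\<lambda>k. 2 * of_bool (k = - ((c + 1) div 2)))"
      using that by (auto simp: fun_eq_iff elim!: oddE)
    finally show ?thesis unfolding law_cmult .
  qed
  have pos: "\<bar>?H (2 * int n + 1) - P * (2 * int n + 1)\<bar> \<le> real_of_int (2 * int n + 1) * e" if "int n \<le> J" for n
    using that
  proof (induction n)
    case 0
    \<comment> \<open>Oddness turns the increment across 0 into the value at 1, which anchors the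
      telescoping.\<close>
    have "?H (-1 + 2) - ?H (-1) = 2 * law m m (\<lambda>k. of_bool (k = 0))" using Hs[of "-1"] by simp
    then have "?H 1 = law m m (\<lambda>k. of_bool (k = 0))" using Hm[of 1] by simp
    then show ?case using pt[of 0] 0 by simp
  next
    case (Suc n)
    have "?H (2 * int (Suc n) + 1) = ?H (2 * int n + 1) + 2 * law m m (\<lambda>k. of_bool (k = - (int n + 1)))"
      using Hs[of "2 * int n + 1"] by (simp add: algebra_simps)
    moreover have "\<bar>law m m (\<lambda>k. of_bool (k = - (int n + 1))) - P\<bar> \<le> e" using Suc.prems by (intro pt) auto
    moreover have "\<bar>?H (2 * int n + 1) - P * (2 * int n + 1)\<bar> \<le> real_of_int (2 * int n + 1) * e" using Suc by auto
    ultimately show ?case unfolding abs_le_iff by (simp add: algebra_simps) 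
  qed
  have base: "\<bar>?H c - P * c\<bar> \<le> real_of_int \<bar>c\<bar> * e" if "odd c" "\<bar>c\<bar> \<le> 2 * J" for c
  proof (cases "c > 0")
    case True
    then have "c = 2 * int (nat (c div 2)) + 1" using \<open>odd c\<close> by (auto elim!: oddE)
    then obtain n where n: "c = 2 * int n + 1" ..
    show ?thesis using pos[of n] that True unfolding n by auto
  next
    case False
    then have "c = - (2 * int (nat ((- c) div 2)) + 1)" using \<open>odd c\<close> by (auto elim!: oddE)
    then obtain n where n: "c = - (2 * int n + 1)" ..
    show ?thesis using pos[of n] that Hm[of "2 * int n + 1"] unfolding n by (auto simp: algebra_simps)
  qed
  show "odd c \<Longrightarrow> \<bar>c\<bar> + 2 * int i + 2 * int l \<le> 2 * J \<Longrightarrow>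
    \<bar>law (m + i) (m + l) (\<lambda>k. sg (real_of_int (2 * k + c))) - P * (c + 2 * p * (real i - real l))\<bar>
     \<le> real_of_int (\<bar>c\<bar> + 2 * int i + 2 * int l) * e"
  proof (induction i arbitrary: c)
    case 0
    then show ?case
    proof (induction l arbitrary: c)
      case 0
      then show ?case using base by simp
    next
      case (Suc l)
      have f: "(\<lambda>k. sg (real_of_int (2 * (k - 1) + c))) = (\<lambda>k. sg (real_of_int (2 * k + (c - 2))))"
        by (simp add: algebra_simps)
      let ?b = "real_of_int (\<bar>c\<bar> + 2 * int 0 + 2 * int (Suc l)) * e"
      have e: "0 \<le> e" using e0 Suc.prems by simp
      let ?x = "law (m + 0) (m + l) (\<lambda>k. sg (real_of_int (2 * k + (c - 2))))" and ?y = "law (m + 0) (m + l) (\<lambda>k. sg (real_of_int (2 * k + c)))"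
      have 1: "\<bar>?x - P * (real_of_int (c - 2) + 2 * p * (real 0 - real l))\<bar> \<le> ?b"
        by (rule order_trans[OF Suc.IH[of "c - 2"]]) (use Suc.prems e in \<open>auto intro!: mult_right_mono\<close>)
      have 2: "\<bar>?y - P * (c + 2 * p * (real 0 - real l))\<bar> \<le> ?b"
        by (rule order_trans[OF Suc.IH[of c]]) (use Suc.prems e in \<open>auto intro!: mult_right_mono\<close>)
      have "law (m + 0) (m + Suc l) (\<lambda>k. sg (real_of_int (2 * k + c))) - P * (c + 2 * p * (real 0 - real (Suc l)))
        = p * (?x - P * (real_of_int (c - 2) + 2 * p * (real 0 - real l))) + q * (?y - P * (c + 2 * p * (real 0 - real l)))"
        unfolding add_Suc_right law_Suc2 f by (simp add: q_def algebra_simps)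
      then show ?case using convex_abs_le[OF 1 2] by (simp only:)
    qed
  next
    case (Suc i)
    have f: "(\<lambda>k. sg (real_of_int (2 * (k + 1) + c))) = (\<lambda>k. sg (real_of_int (2 * k + (c + 2))))"
      by (simp add: algebra_simps)
    let ?b = "real_of_int (\<bar>c\<bar> + 2 * int (Suc i) + 2 * int l) * e"
    have e: "0 \<le> e" using e0 Suc.prems by simp
    let ?x = "law (m + i) (m + l) (\<lambda>k. sg (real_of_int (2 * k + (c + 2))))" and ?y = "law (m + i) (m + l) (\<lambda>k. sg (real_of_int (2 * k + c)))"
    have 1: "\<bar>?x - P * (real_of_int (c + 2) + 2 * p * (real i - real l))\<bar> \<le> ?b"
      by (rule order_trans[OF Suc.IH[of "c + 2"]]) (use Suc.prems e in \<open>auto intro!: mult_right_mono\<close>)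
    have 2: "\<bar>?y - P * (c + 2 * p * (real i - real l))\<bar> \<le> ?b"
      by (rule order_trans[OF Suc.IH[of c]]) (use Suc.prems e in \<open>auto intro!: mult_right_mono\<close>)
    have "law (m + Suc i) (m + l) (\<lambda>k. sg (real_of_int (2 * k + c))) - P * (c + 2 * p * (real (Suc i) - real l))
      = p * (?x - P * (real_of_int (c + 2) + 2 * p * (real i - real l))) + q * (?y - P * (c + 2 * p * (real i - real l)))"
      unfolding add_Suc_right add_Suc law.simps f by (simp add: q_def algebra_simps)
    then show ?case using convex_abs_le[OF 1 2] by (simp only:)
  qed
qed

end

context bernoulli begin

text \<open>The renaming h lets the new coordinates be indexed by another type: edges at v by their
  other endpoint, so that a row is a function on vertices.\<close>

lemma EE_bern_block_resample:
  assumes "finite A" "finite S" "S \<subseteq> A" "inj_on h S"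
  shows "EE (bern p A) F = EE (bern p A) (\<lambda>f. EE (bern p (h ` S)) (\<lambda>r. F (\<lambda>e. if e \<in> S then r (h e) else f e)))"
  using assms(2-4)
proof (induction S arbitrary: F)
  case empty
  then show ?case by (simp add: EE_bern_empty)
next
  case (insert s S)
  have hs: "h s \<notin> h ` S" using insert by auto
  have upd: "(\<lambda>e. if e \<in> insert s S then (r(h s := b)) (h e) else f e) = (\<lambda>e. if e \<in> S then r (h e) else f e)(s := b)" for r f b
  proof (rule ext)
    fix e
    have "e \<in> S \<Longrightarrow> h e \<noteq> h s" using hs by (metis imageI)
    then show "(if e \<in> insert s S then (r(h s := b)) (h e) else f e) = ((\<lambda>e. if e \<in> S then r (h e) else f e)(s := b)) e"
      using insert.hyps hs by (cases "e = s"; cases "e \<in> S") auto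
  qed
  have fh: "finite (set_pmf (bern p (h ` S)))" using insert by (simp add: finite_set_bern)
  have "EE (bern p A) F = EE (bern p A) (\<lambda>g. p * F (g(s := True)) + q * F (g(s := False)))"
    using insert assms(1) by (intro EE_bern_resample) auto
  also have "\<dots> = EE (bern p A) (\<lambda>f. EE (bern p (h ` S)) (\<lambda>r. 
      p * F ((\<lambda>e. if e \<in> S then r (h e) else f e)(s := True)) + q * F ((\<lambda>e. if e \<in> S then r (h e) else f e)(s := False))))"
    using insert by (subst insert.IH) auto
  also have "\<dots> = EE (bern p A) (\<lambda>f. EE (bern p (insert (h s) (h ` S))) (\<lambda>r. F (\<lambda>e. if e \<in> insert s S then r (h e) else f e)))"
    unfolding EE_bern_insert[OF finite_imageI[OF insert.hyps(1)] hs] upd EE_add[OF fh] by simp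
  finally show ?case by simp
qed

lemma EE_bern_restrict:
  assumes A: "finite A" "B \<subseteq> A" and F: "\<And>f g. (\<And>u. u \<in> B \<Longrightarrow> f u = g u) \<Longrightarrow> F f = F g"
  shows "EE (bern p A) F = EE (bern p B) F"
proof -
  have st: "EE (bern p (B \<union> C)) F = EE (bern p B) F" if "finite C" "C \<inter> B = {}" for C
    using that
  proof (induction C)
    case (insert c C)
    have fB: "finite B" using A finite_subset by blast
    have "EE (bern p (B \<union> insert c C)) F = EE (bern p (B \<union> insert c C - {c})) F"
      using insert fB by (intro EE_bern_remove) (auto intro!: F split: if_splits)
    also have "B \<union> insert c C - {c} = B \<union> C" using insert by auto
    finally show ?case using insert by simp
  qed simp
  have "B \<union> (A - B) = A" "finite (A - B)" "(A - B) \<inter> B = {}" using A by auto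
  then show ?thesis using st[of "A - B"] by simp
qed

end

section \<open>Majority dynamics and resampling the edges at a vertex\<close>

locale majority = bernoulli p for p :: real +
  fixes V R0 B0 :: "'a set" and n \<Delta> :: nat
  assumes finV: "finite V" and V: "V = R0 \<union> B0" and disj: "R0 \<inter> B0 = {}"
    and cR: "card R0 = n + \<Delta>" and cB: "card B0 = n"
begin

definition x :: "'a \<Rightarrow> int" where "x u = (if u \<in> R0 then 1 else -1)"

lemma x_cases: "x u = 1 \<or> x u = -1" by (auto simp: x_def)

lemma x_sq: "x u * x u = 1" "real_of_int (x u) * real_of_int (x u) = 1" "\<bar>x u\<bar> = 1" "\<bar>real_of_int (x u)\<bar> = 1" "odd (x u)"
  using x_cases[of u] by auto

lemma cV: "card V = 2 * n + \<Delta>"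
  using finV disj cR cB unfolding V by (subst card_Un_disjoint) auto

lemma sum_x: "(\<Sum>u\<in>V. real_of_int (x u)) = real \<Delta>"
proof -
  have "(\<Sum>u\<in>V. real_of_int (x u)) = (\<Sum>u\<in>R0. real_of_int (x u)) + (\<Sum>u\<in>B0. real_of_int (x u))"
    unfolding V by (rule sum.union_disjoint) (use finV V disj in auto)
  also have "(\<Sum>u\<in>R0. real_of_int (x u)) = real (card R0)" by (simp add: x_def)
  also have "(\<Sum>u\<in>B0. real_of_int (x u)) = (\<Sum>u\<in>B0. -1)" using disj by (intro sum.cong) (auto simp: x_def)
  finally show ?thesis using cR cB by simp
qed

definition PP where "PP = bern p (all_edges V)"

lemma fin_edges: "finite (all_edges V)"
  by (rule finite_subset[of _ "Pow V"]) (auto simp: all_edges_def finV)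

lemma finite_set_PP: "finite (set_pmf PP)"
  unfolding PP_def by (rule finite_set_bern[OF fin_edges])

lemma finite_set_row: "finite (set_pmf (bern p (V - X)))"
  by (rule finite_set_bern) (use finV in auto)

text \<open>\<open>the_elem (e - {v})\<close> is the endpoint of e other than v.\<close>

definition upd :: "'a \<Rightarrow> ('a set \<Rightarrow> bool) \<Rightarrow> ('a \<Rightarrow> bool) \<Rightarrow> 'a set \<Rightarrow> bool" where
  "upd v f r = (\<lambda>e. if e \<in> {e \<in> all_edges V. v \<in> e} then r (the_elem (e - {v})) else f e)"

lemma edge_iff: "u \<in> V \<Longrightarrow> t \<in> V \<Longrightarrow> {u,t} \<in> all_edges V \<longleftrightarrow> u \<noteq> t"
  by (auto simp: all_edges_def card_2_iff doubleton_eq_iff)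

lemma edge_other: assumes "e \<in> all_edges V" "v \<in> e" shows "\<exists>u. u \<in> V - {v} \<and> e = {v,u}"
proof -
  obtain a b where e: "e = {a,b}" "a \<noteq> b" using assms by (auto simp: all_edges_def card_2_iff)
  have "a \<in> V" "b \<in> V" using assms e by (auto simp: all_edges_def)
  then show ?thesis using e assms(2) by (cases "v = a") (auto simp: insert_commute)
qed

text \<open>Conditioning on the graph without v, but on the same sample space: the outer average
  still draws edges at v, and \<open>upd\<close> overwrites them.\<close>

lemma resample:
  assumes v: "v \<in> V"
  shows "EE PP F = EE PP (\<lambda>f. EE (bern p (V - {v})) (\<lambda>r. F (upd v f r)))"
proof -
  let ?S = "{e \<in> all_edges V. v \<in> e}" and ?h = "\<lambda>e. the_elem (e - {v})"
  have h: "?h {v,u} = u" if "u \<in> V - {v}" for u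
  proof -
    have "{v,u} - {v} = {u}" using that by auto
    then show ?thesis by simp
  qed
  have S: "\<exists>u. u \<in> V - {v} \<and> e = {v,u} \<and> ?h e = u" if "e \<in> ?S" for e
    using edge_other[of e v] that h by auto
  have inj: "inj_on ?h ?S"
  proof (rule inj_onI)
    fix e e' assume a: "e \<in> ?S" "e' \<in> ?S" "?h e = ?h e'"
    obtain u u' where "e = {v,u}" "?h e = u" "e' = {v,u'}" "?h e' = u'" using S[OF a(1)] S[OF a(2)] by blast
    then show "e = e'" using a(3) by simp
  qed
  have im: "?h ` ?S = V - {v}"
  proof (intro equalityI subsetI)
    fix u assume u: "u \<in> V - {v}"
    then have "{v,u} \<in> ?S" using v edge_iff[of v u] by auto
    then show "u \<in> ?h ` ?S" using h[OF u] by (metis (no_types, lifting) image_eqI)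
  next
    fix u assume "u \<in> ?h ` ?S"
    then obtain e where "e \<in> ?S" "u = ?h e" by blast
    then show "u \<in> V - {v}" using S[of e] by auto
  qed
  have fS: "finite ?S" using fin_edges by simp
  show ?thesis
    using EE_bern_block_resample[OF fin_edges fS _ inj, of F] unfolding im PP_def upd_def by blast
qed

lemma upd_at: "v \<in> V \<Longrightarrow> u \<in> V - {v} \<Longrightarrow> upd v f r {v,u} = r u" "v \<in> V \<Longrightarrow> u \<in> V - {v} \<Longrightarrow> upd v f r {u,v} = r u"
  using edge_iff[of v u] by (auto simp: upd_def insert_Diff_if insert_commute)

lemma upd_off: "v \<noteq> u \<Longrightarrow> v \<noteq> t \<Longrightarrow> upd v f r {u,t} = f {u,t}"
  by (auto simp: upd_def)

text \<open>Red minus blue neighbors of u at time 0 in the graph from which the vertices X are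
  deleted.\<close>

definition DX :: "'a set \<Rightarrow> ('a set \<Rightarrow> bool) \<Rightarrow> 'a \<Rightarrow> int" where
  "DX X f u = (\<Sum>t\<in>V - insert u X. x t * of_bool (f {u,t}))"

lemma DX_upd_self: "v \<in> V \<Longrightarrow> DX X (upd v f r) v = (\<Sum>t\<in>V - insert v X. x t * of_bool (r t))"
  unfolding DX_def by (rule sum.cong) (auto simp: upd_at)

lemma DX_upd_in: "v \<in> X \<Longrightarrow> u \<noteq> v \<Longrightarrow> DX X (upd v f r) u = DX X f u"
  unfolding DX_def by (rule sum.cong[OF refl]) (subst upd_off, auto)

lemma DX_upd_out:
  assumes "v \<in> V" "u \<in> V" "u \<noteq> v" "v \<notin> X"
  shows "DX X (upd v f r) u = DX (insert v X) f u + x v * of_bool (r u)"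
proof -
  have "V - insert u X = insert v (V - insert u (insert v X))" using assms by auto
  then have "DX X (upd v f r) u = x v * of_bool (upd v f r {u,v}) + DX (insert v X) (upd v f r) u"
    unfolding DX_def using finV by simp
  then show ?thesis using assms upd_at(2)[of v u f r] DX_upd_in[of v "insert v X" u f r] by simp
qed

text \<open>
  Colors are signs, red being \<open>1\<close>; \<open>x\<close> and \<open>Y\<close> are the colors at times 0 and 1. Since \<open>2 * DX {} f u + x u\<close> is odd, the tie rule
  needs no case distinction. \<open>Y0 v f u\<close> is the color of \<open>u\<close> at time 1 if the edge \<open>uv\<close> is absent, and \<open>kk v f u\<close>
  indicates that the presence of this edge would change it (then always to the color of \<open>v\<close>).
  Given the graph without \<open>v\<close>, \<open>S1 = M v + Y v + 2 x\<^sub>v TT v\<close>, where \<open>TT v\<close> is a centered sum over the edges at \<open>v\<close>.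
\<close>

definition Y :: "('a set \<Rightarrow> bool) \<Rightarrow> 'a \<Rightarrow> real" where "Y f u = sg (real_of_int (2 * DX {} f u + x u))"
definition Y0 where "Y0 v f u = sg (real_of_int (2 * DX {v} f u + x u))"
definition kk :: "'a \<Rightarrow> ('a set \<Rightarrow> bool) \<Rightarrow> 'a \<Rightarrow> real" where "kk v f u = of_bool (2 * DX {v} f u + x u + x v = 0)"
definition Yr where "Yr v r = sg (real_of_int (2 * (\<Sum>t\<in>V - {v}. x t * of_bool (r t)) + x v))"
definition KN where "KN v f = (\<Sum>u\<in>V - {v}. kk v f u)"
definition S1 where "S1 f = (\<Sum>u\<in>V. Y f u)"
definition M where "M v f = (\<Sum>u\<in>V - {v}. Y0 v f u) + 2 * real_of_int (x v) * p * KN v f"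
definition TT where "TT v f r = csum (kk v f) (V - {v}) r"

lemma kk01: "0 \<le> kk v f u" "kk v f u \<le> 1" "(kk v f u)\<^sup>2 = kk v f u" by (auto simp: kk_def)

lemma sum_kk_sq: "(\<Sum>u\<in>V - {v}. (kk v f u)\<^sup>2) = KN v f" by (simp add: KN_def kk01)

lemma KN_nonneg: "0 \<le> KN v f" unfolding KN_def by (intro sum_nonneg kk01)

lemma Y_upd_self: "v \<in> V \<Longrightarrow> Y (upd v f r) v = Yr v r"
  by (simp add: Y_def Yr_def DX_upd_self)

lemma sg_flip:
  assumes "odd c" "y = 1 \<or> y = (-1::int)"
  shows "sg (real_of_int (c + 2 * y)) - sg (real_of_int c) = 2 * y * of_bool (c + y = 0)"
  using assms(2) sg_odd_step[of c] sg_odd_step[of "c - 2"] assms(1) by (auto split: if_splits)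

lemma Y_upd:
  assumes "v \<in> V" "u \<in> V - {v}"
  shows "Y (upd v f r) u = Y0 v f u + 2 * real_of_int (x v) * kk v f u * of_bool (r u)"
proof (cases "r u")
  case True
  have "2 * (DX {v} f u + x v) + x u = (2 * DX {v} f u + x u) + 2 * x v" by simp
  moreover have "sg (real_of_int ((2 * DX {v} f u + x u) + 2 * x v)) = sg (real_of_int (2 * DX {v} f u + x u)) + 2 * real_of_int (x v) * kk v f u"
    using sg_flip[of "2 * DX {v} f u + x u" "x v"] x_sq(5)[of u] x_cases[of v] unfolding kk_def by simp
  moreover have "DX {} (upd v f r) u = DX {v} f u + x v" using assms True by (simp add: DX_upd_out)
  ultimately show ?thesis using True unfolding Y_def Y0_def by (simp only: of_bool_eq mult_1_right)
qed (use assms in \<open>simp add: Y_def Y0_def DX_upd_out\<close>)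

lemma S1_upd:
  assumes "v \<in> V"
  shows "S1 (upd v f r) = M v f + Yr v r + 2 * real_of_int (x v) * TT v f r"
proof -
  have "S1 (upd v f r) = Yr v r + (\<Sum>u\<in>V - {v}. Y0 v f u + 2 * real_of_int (x v) * kk v f u * of_bool (r u))"
    unfolding S1_def using assms by (simp add: sum.remove[OF finV] Y_upd_self Y_upd)
  also have "(\<Sum>u\<in>V - {v}. Y0 v f u + 2 * real_of_int (x v) * kk v f u * of_bool (r u)) =
     (\<Sum>u\<in>V - {v}. Y0 v f u) + 2 * real_of_int (x v) * (\<Sum>u\<in>V - {v}. kk v f u * of_bool (r u))"
    unfolding sum.distrib sum_distrib_left by (simp only: mult.assoc)
  also have "(\<Sum>u\<in>V - {v}. kk v f u * of_bool (r u)) = TT v f r + p * KN v f"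
  proof -
    have "TT v f r = (\<Sum>u\<in>V - {v}. kk v f u * of_bool (r u) - p * kk v f u)"
      unfolding TT_def csum_def by (rule sum.cong) (simp_all add: algebra_simps)
    then show ?thesis unfolding sum_subtractf KN_def sum_distrib_left by linarith
  qed
  finally show ?thesis unfolding M_def by (simp add: algebra_simps)
qed

lemma Yr_pm: "\<bar>Yr v r\<bar> = 1" "Yr v r * Yr v r = 1" "(Yr v r)\<^sup>2 = 1" by (auto simp: Yr_def sg_simps)
lemma Y_pm: "\<bar>Y f v\<bar> = 1" "Y f v = 1 \<or> Y f v = -1" by (auto simp: Y_def sg_simps sg_def)

end

text \<open>\<open>nn a\<close> is \<open>n\<^sup>a\<close>; the factor \<open>nn (1/1000)\<close> absorbs constants, \<open>1/(pq)\<close> and \<open>\<Delta>\<close>.\<close>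

locale regime = majority p V R0 B0 n \<Delta> for p :: real and V R0 B0 :: "'a set" and n \<Delta> :: nat +
  fixes nn :: "real \<Rightarrow> real"
  defines nn: "nn \<equiv> \<lambda>a. real n powr a"
  assumes n_ge_10: "n \<ge> 10" and nb: "1000000 \<le> nn (1/1000)" and pqb: "nn (-1/1000) \<le> p * q" and \<Delta>b: "real \<Delta> \<le> nn (1/1000)"
    and expb: "exp (- nn (1/1000)) \<le> nn (-5)"
begin

section \<open>Arithmetic of powers of n\<close>

lemma nn_pos [simp]: "0 < nn a" using n_ge_10 by (simp add: nn)
lemma nn_nonneg [simp]: "0 \<le> nn a" by (simp add: less_imp_le)
lemma nn_nonzero [simp]: "nn a \<noteq> 0" using nn_pos[of a] by linarith
lemma nn_mult: "nn a * nn b = nn (a + b)" by (simp add: nn powr_add)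
lemma nn_mono: "a \<le> b \<Longrightarrow> nn a \<le> nn b" using n_ge_10 by (simp add: nn powr_mono)
lemma nn_1: "nn 1 = real n" "nn 0 = 1" using n_ge_10 by (simp_all add: nn)
lemma nn_divide: "nn a / nn b = nn (a - b)" by (simp add: nn powr_diff)
lemma nn_power: "nn a ^ k = nn (k * a)" using n_ge_10 by (simp add: nn powr_power mult.commute)
text \<open>How numerical constants vanish: giving away 1/1000 in the exponent pays for any factor
  up to 10^6. This is the reason for the slightly increasing exponents throughout.\<close>

lemma nn_absorb: assumes "c \<le> 1000000" "a + 1/1000 \<le> b" shows "c * nn a \<le> nn b"
proof -
  have "c * nn a \<le> nn (1/1000) * nn a" using assms nb nn_pos[of a] by (intro mult_right_mono) auto
  also have "\<dots> \<le> nn b" unfolding nn_mult using assms by (intro nn_mono) simp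
  finally show ?thesis .
qed
lemma nn_sqrt: "sqrt (nn a) = nn (a/2)" using n_ge_10 by (simp add: nn powr_half_sqrt_powr)

lemma p_lower: "nn (-1/1000) \<le> p" "nn (-1/1000) \<le> q"
proof -
  have "p * q \<le> p * 1" "p * q \<le> 1 * q" using p q by (intro mult_mono; simp)+
  then show "nn (-1/1000) \<le> p" "nn (-1/1000) \<le> q" using pqb by simp_all
qed

text \<open>A factor p q costs at most 1/1000 in the exponent.\<close>

lemma pq_mono: assumes "c * nn a \<le> b" "c \<ge> 0" shows "c * nn (a - 1/1000) \<le> b * (p * q)"
proof -
  have "c * nn (a - 1/1000) = (c * nn a) * nn (-1/1000)" by (simp add: nn_mult mult.assoc)
  also have "\<dots> \<le> (c * nn a) * (p * q)" using assms nn_pos[of a] pqb by (intro mult_left_mono mult_nonneg_nonneg) auto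
  also have "\<dots> \<le> b * (p * q)" using assms(1) pq by (intro mult_right_mono) auto
  finally show ?thesis .
qed

text \<open>\<open>P0\<close> approximates every point probability near 0 of the sums \<open>DX X f u\<close> with at most three vertices removed.\<close>

definition m3 :: real where "m3 = real (n - 3)"
definition P0 :: real where "P0 = 1 / sqrt (4 * pi * (m3 * (p * q)))"
definition e0 :: real where "e0 = nn (-2/3)"

lemma m3: "(1/2) * nn 1 \<le> m3" "m3 \<le> nn 1" "0 < m3" using n_ge_10 by (auto simp: nn_1 m3_def)

lemma m3pq: "(1/2) * nn (999/1000) \<le> m3 * (p * q)" "0 < m3 * (p * q)"
  using pq_mono[OF m3(1)] m3(3) pq by auto

lemma fint_P0:
  assumes k: "\<bar>k\<bar> \<le> int \<Delta> + 20"
  shows "\<bar>law (n - 3) (n - 3) (\<lambda>j. of_bool (j = k)) - P0\<bar> \<le> e0"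
proof -
  \<comment> \<open>The window must be wider than n^(-1/2) to contain the Gaussian and narrow enough
    for the Taylor error t0^3 * n * t0^2, here n^(-1). Truncation then dominates with roughly
    n^(-3/2) / t0^2 = n^(-7/10), which is why \<open>e0\<close> is n^(-2/3).\<close>
  define t0 where "t0 = nn (-2/5)"
  define a where "a = m3 * (p * q)"
  have t0: "0 < t0" "t0 \<le> 1" unfolding t0_def using nn_mono[of "-2/5" 0] nn_pos[of "-2/5"] nn_1(2) by auto
  have t02: "t0\<^sup>2 = nn (-4/5)" "t0^3 = nn (-6/5)" by (simp_all add: t0_def nn_power)
  have a: "(1/2) * nn (999/1000) \<le> a" "0 < a" unfolding a_def by (rule m3pq)+
  have k2: "(real_of_int k)\<^sup>2 \<le> nn (1/100)"
  proof -
    have "\<bar>real_of_int k\<bar> \<le> real \<Delta> + 20" using k by linarith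
    also have "\<dots> \<le> 2 * nn (1/1000)" using \<Delta>b nb by linarith
    also have "\<dots> \<le> nn (1/200)" by (rule nn_absorb) simp_all
    finally have "\<bar>real_of_int k\<bar>\<^sup>2 \<le> (nn (1/200))\<^sup>2" by (intro power_mono) auto
    then show ?thesis by (simp add: nn_power)
  qed
  have t1: "t0^3 * ((real_of_int k)\<^sup>2 + m3 * t0\<^sup>2) \<le> (1/4) * e0"
  proof -
    have "m3 * t0\<^sup>2 \<le> nn 1 * nn (-4/5)" unfolding t02 using m3(2) nn_pos[of "-4/5"] by (intro mult_right_mono) auto
    then have "(real_of_int k)\<^sup>2 + m3 * t0\<^sup>2 \<le> 2 * nn (1/5)" using k2 nn_mono[of "1/100" "1/5"] by (simp add: nn_mult)
    then have "t0^3 * ((real_of_int k)\<^sup>2 + m3 * t0\<^sup>2) \<le> nn (-6/5) * (2 * nn (1/5))"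
      unfolding t02 using nn_pos[of "-6/5"] by (intro mult_left_mono) auto
    also have "\<dots> = 2 * nn (-1)" using nn_mult[of "-6/5" "1/5"] by simp
    also have "\<dots> \<le> (1/4) * e0" using nn_absorb[of 8 "-1" "-2/3"] unfolding e0_def by simp
    finally show ?thesis .
  qed
  have at: "(1/2) * nn (199/1000) \<le> a * t0\<^sup>2"
  proof -
    have "(1/2) * nn (199/1000) = (1/2) * nn (999/1000) * nn (-4/5)" using nn_mult[of "999/1000" "-4/5"] by simp
    also have "\<dots> \<le> a * nn (-4/5)" using a(1) nn_pos[of "-4/5"] by (intro mult_right_mono) auto
    finally show ?thesis unfolding t02 .
  qed
  have t2: "exp (- a * t0\<^sup>2 / 2) \<le> (1/4) * e0"
  proof -
    have "nn (1/1000) \<le> a * t0\<^sup>2 / 2" using nn_absorb[of 4 "1/1000" "199/1000"] at by simp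
    then have "exp (- a * t0\<^sup>2 / 2) \<le> exp (- nn (1/1000))" by simp
    also have "\<dots> \<le> nn (-5)" by (rule expb)
    also have "\<dots> \<le> (1/4) * e0" using nn_absorb[of 4 "-5" "-2/3"] unfolding e0_def by simp
    finally show ?thesis .
  qed
  have t3: "1 / (sqrt a * (a * t0\<^sup>2)) \<le> (1/4) * e0"
  proof -
    have "(1/4) * nn (999/1000) \<le> a" using a(1) nn_pos[of "999/1000"] by linarith
    then have "sqrt ((1/4) * nn (999/1000)) \<le> sqrt a" by (rule real_sqrt_le_mono)
    moreover have "sqrt ((1/4) * nn (999/1000)) = (1/2) * nn (999/2000)"
      unfolding real_sqrt_mult nn_sqrt by (simp add: real_sqrt_divide)
    ultimately have s: "(1/2) * nn (999/2000) \<le> sqrt a" by (simp only:)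
    have "((1/2) * nn (999/2000)) * ((1/2) * nn (199/1000)) \<le> sqrt a * (a * t0\<^sup>2)"
      by (rule mult_mono[OF s at]) (use a nn_pos[of "199/1000"] in simp_all)
    then have b: "(1/4) * nn (1397/2000) \<le> sqrt a * (a * t0\<^sup>2)" using nn_mult[of "999/2000" "199/1000"] by simp
    have pos: "0 < (1/4) * nn (1397/2000)" using nn_pos[of "1397/2000"] by simp
    have "1 / (sqrt a * (a * t0\<^sup>2)) \<le> 1 / ((1/4) * nn (1397/2000))"
      using b pos a(2) t0(1) by (intro divide_left_mono mult_pos_pos) auto
    also have "\<dots> = 4 * nn (- (1397/2000))" using nn_divide[of 0 "1397/2000"] nn_1(2) by simp
    also have "\<dots> \<le> (1/4) * e0" using nn_absorb[of 16 "-(1397/2000)" "-2/3"] unfolding e0_def by simp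
    finally show ?thesis .
  qed
  have "\<bar>fint (n - 3) k - P0\<bar> \<le> t0^3 * ((real_of_int k)\<^sup>2 + m3 * t0\<^sup>2) + exp (- a * t0\<^sup>2 / 2) + 1 / (sqrt a * (a * t0\<^sup>2))"
    unfolding P0_def a_def m3_def by (rule fint_local[OF t0]) (use n_ge_10 in simp)
  then show ?thesis unfolding law_fint using t1 t2 t3 nn_pos[of "-2/3"] unfolding e0_def by linarith
qed

text \<open>With at most three vertices removed both groups keep n - 3 members. This common base
  makes one constant \<open>P0\<close> serve every removed set X, so that point probabilities can be
  compared across different X.\<close>

lemma card_split:
  assumes "X \<subseteq> V" "card X \<le> 3"
  obtains i l where "card {u \<in> V - X. x u = 1} = n - 3 + i" "card {u \<in> V - X. x u = -1} = n - 3 + l"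
    "i \<le> \<Delta> + 3" "l \<le> 3" "real i - real l = real \<Delta> - (\<Sum>u\<in>X. real_of_int (x u))"
proof -
  have fX: "finite X" using assms finV finite_subset by blast
  have fR: "finite R0" "finite B0" using finV V by auto
  have R: "{u \<in> V - X. x u = 1} = R0 - (R0 \<inter> X)" using V disj by (auto simp: x_def)
  have B: "{u \<in> V - X. x u = -1} = B0 - (B0 \<inter> X)" using V disj by (auto simp: x_def)
  have cRX: "card (R0 \<inter> X) \<le> 3" "card (B0 \<inter> X) \<le> 3"
    using assms(2) card_mono[OF fX, of "R0 \<inter> X"] card_mono[OF fX, of "B0 \<inter> X"] by auto
  have 1: "card {u \<in> V - X. x u = 1} = n + \<Delta> - card (R0 \<inter> X)" unfolding R using fR cR by (subst card_Diff_subset) auto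
  have 2: "card {u \<in> V - X. x u = -1} = n - card (B0 \<inter> X)" unfolding B using fR cB by (subst card_Diff_subset) auto
  have "X = (R0 \<inter> X) \<union> (B0 \<inter> X)" using assms(1) V by auto
  then have "(\<Sum>u\<in>X. real_of_int (x u)) = (\<Sum>u\<in>(R0 \<inter> X) \<union> (B0 \<inter> X). real_of_int (x u))" by (rule arg_cong)
  also have "\<dots> = (\<Sum>u\<in>R0 \<inter> X. real_of_int (x u)) + (\<Sum>u\<in>B0 \<inter> X. real_of_int (x u))"
    by (rule sum.union_disjoint) (use fX disj in auto)
  also have "(\<Sum>u\<in>R0 \<inter> X. real_of_int (x u)) = card (R0 \<inter> X)" by (simp add: x_def)
  also have "(\<Sum>u\<in>B0 \<inter> X. real_of_int (x u)) = (\<Sum>u\<in>B0 \<inter> X. -1)" using disj by (intro sum.cong) (auto simp: x_def)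
  finally have s: "(\<Sum>u\<in>X. real_of_int (x u)) = real (card (R0 \<inter> X)) - real (card (B0 \<inter> X))" by simp
  show ?thesis
    by (rule that[of "\<Delta> + 3 - card (R0 \<inter> X)" "3 - card (B0 \<inter> X)"]) (use 1 2 s cRX n_ge_10 in auto)
qed

lemma point_prob:
  assumes "X \<subseteq> V" "card X \<le> 3" "\<bar>k\<bar> \<le> 10"
  shows "\<bar>EE (bern p (V - X)) (\<lambda>r. of_bool ((\<Sum>t\<in>V - X. x t * of_bool (r t)) = k)) - P0\<bar> \<le> e0"
proof -
  obtain i l where il: "card {u \<in> V - X. x u = 1} = n - 3 + i" "card {u \<in> V - X. x u = -1} = n - 3 + l"
    "i \<le> \<Delta> + 3" "l \<le> 3" "real i - real l = real \<Delta> - (\<Sum>u\<in>X. real_of_int (x u))" by (rule card_split[OF assms(1,2)])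
  have "\<bar>law (n - 3 + i) (n - 3 + l) (\<lambda>j. of_bool (j = k)) - P0\<bar> \<le> e0"
    by (rule law_point_extend[OF fint_P0]) (use il assms in auto)
  then show ?thesis
    using EE_law[of "V - X" x "\<lambda>j. of_bool (j = k)"] finV x_cases il by simp
qed

definition mv :: "'a \<Rightarrow> real" where "mv v = EE (bern p (V - {v})) (Yr v)"

text \<open>In \<open>law_sign_extend\<close> the offset c is the initial color of v, which breaks
  ties, and i - l is the red surplus among the other vertices, \<open>\<Delta>\<close> minus the
  initial color of v.\<close>

lemma mv_approx:
  assumes "v \<in> V"
  shows "\<bar>mv v - P0 * (x v + 2 * p * (real \<Delta> - x v))\<bar> \<le> nn (-3/5)"
proof -
  obtain i l where il: "card {u \<in> V - {v}. x u = 1} = n - 3 + i" "card {u \<in> V - {v}. x u = -1} = n - 3 + l"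
    "i \<le> \<Delta> + 3" "l \<le> 3" "real i - real l = real \<Delta> - (\<Sum>u\<in>{v}. real_of_int (x u))"
    by (rule card_split[of "{v}"]) (use assms in simp_all)
  have "\<bar>law (n - 3 + i) (n - 3 + l) (\<lambda>k. sg (real_of_int (2 * k + x v))) - P0 * (x v + 2 * p * (real i - real l))\<bar>
     \<le> real_of_int (\<bar>x v\<bar> + 2 * int i + 2 * int l) * e0"
    by (rule law_sign_extend[OF fint_P0]) (use il x_sq[of v] in auto)
  moreover have "mv v = law (n - 3 + i) (n - 3 + l) (\<lambda>k. sg (real_of_int (2 * k + x v)))"
    unfolding mv_def Yr_def using EE_law[of "V - {v}" x "\<lambda>k. sg (real_of_int (2 * k + x v))"] finV x_cases il by simp
  moreover have "real_of_int (\<bar>x v\<bar> + 2 * int i + 2 * int l) * e0 \<le> nn (-3/5)"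
  proof -
    have "real_of_int (\<bar>x v\<bar> + 2 * int i + 2 * int l) \<le> 2 * real \<Delta> + 13" using il(3,4) x_sq(3)[of v] by linarith
    also have "\<dots> \<le> 3 * nn (1/1000)" using \<Delta>b nb by linarith
    finally have "real_of_int (\<bar>x v\<bar> + 2 * int i + 2 * int l) * e0 \<le> (3 * nn (1/1000)) * e0"
      using nn_pos by (intro mult_right_mono) (auto simp: e0_def less_imp_le)
    also have "\<dots> = 3 * nn (1/1000 - 2/3)" by (simp add: e0_def nn_mult mult.assoc)
    also have "\<dots> \<le> nn (-3/5)" by (rule nn_absorb) auto
    finally show ?thesis .
  qed
  ultimately show ?thesis using il(5) by simp
qed

lemma P0_bounds: "0 < P0" "P0 \<le> nn (-499/1000)"
proof -
  have pos: "0 < 4 * pi * (m3 * (p * q))" using m3(3) p q by (intro mult_pos_pos) auto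
  then show "0 < P0" unfolding P0_def by simp
  have "nn (999/1000) \<le> 2 * (m3 * (p * q))" using m3pq(1) by linarith
  also have "\<dots> \<le> (4 * pi) * (m3 * (p * q))" using m3pq(2) pi_gt3 by (intro mult_right_mono) auto
  finally have "sqrt (nn (999/1000)) \<le> sqrt (4 * pi * (m3 * (p * q)))" by (rule real_sqrt_le_mono)
  then have "nn (999/2000) \<le> sqrt (4 * pi * (m3 * (p * q)))" unfolding nn_sqrt by simp
  then have "P0 \<le> 1 / nn (999/2000)" unfolding P0_def using pos nn_pos[of "999/2000"]
    by (intro divide_left_mono mult_pos_pos) auto
  also have "\<dots> = nn (-999/2000)" using nn_divide[of 0 "999/2000"] nn_1(2) by simp
  also have "\<dots> \<le> nn (-499/1000)" by (rule nn_mono) simp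
  finally show "P0 \<le> nn (-499/1000)" .
qed

lemma e0_P0: "0 < e0" "e0 \<le> nn (-499/1000)" unfolding e0_def using nn_pos nn_mono by auto

lemma cV_nn: "real (card V) \<le> 3 * nn 1" "2 * nn 1 \<le> real (card V)"
proof -
  have "nn (1/1000) \<le> nn 1" by (rule nn_mono) simp
  then show "real (card V) \<le> 3 * nn 1" using \<Delta>b cV nn_1 by simp
qed (simp add: cV nn_1)

section \<open>Pivotal vertices and their number\<close>

definition pp :: "'a set \<Rightarrow> int \<Rightarrow> real" where
  "pp X k = EE (bern p (V - X)) (\<lambda>r. of_bool ((\<Sum>t\<in>V - X. x t * of_bool (r t)) = k))"

lemma pp_approx: "X \<subseteq> V \<Longrightarrow> card X \<le> 3 \<Longrightarrow> \<bar>k\<bar> \<le> 10 \<Longrightarrow> \<bar>pp X k - P0\<bar> \<le> e0"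
  unfolding pp_def by (rule point_prob)

lemma row_pp:
  "EE (bern p (V - {u})) (\<lambda>r. of_bool ((\<Sum>t\<in>V - insert u X. x t * of_bool (r t)) = k)) = pp (insert u X) k"
  unfolding pp_def
proof (rule EE_bern_restrict)
  fix f g :: "'a \<Rightarrow> bool" assume "\<And>t. t \<in> V - insert u X \<Longrightarrow> f t = g t"
  then have "(\<Sum>t\<in>V - insert u X. x t * of_bool (f t)) = (\<Sum>t\<in>V - insert u X. x t * of_bool (g t))"
    by (intro sum.cong) auto
  then show "of_bool ((\<Sum>t\<in>V - insert u X. x t * of_bool (f t)) = k) = (of_bool ((\<Sum>t\<in>V - insert u X. x t * of_bool (g t)) = k) :: real)"
    by simp
qed (use finV in auto)

lemma DX_prob:
  assumes "u \<in> V"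
  shows "EE PP (\<lambda>f. of_bool (DX X f u = k)) = pp (insert u X) k"
  by (subst resample[OF assms]) (simp add: DX_upd_self[OF assms] row_pp)

text \<open>The only value of \<open>DX {v} f u\<close> at which u is pivotal for v. The sum of two
  colors is even, so the division is exact; the value is symmetric in u and v.\<close>

definition kc :: "'a \<Rightarrow> 'a \<Rightarrow> int" where "kc v u = - ((x u + x v) div 2)"

lemma kc: "2 * j + x u + x v = 0 \<longleftrightarrow> j = kc v u" "\<bar>kc v u\<bar> \<le> 1"
  using x_cases[of u] x_cases[of v] by (auto simp: kc_def)

lemma kk_kc: "kk v f u = of_bool (DX {v} f u = kc v u)"
  unfolding kk_def kc ..

lemma kk_mean:
  assumes "v \<in> V" "u \<in> V - {v}"
  shows "\<bar>EE PP (\<lambda>f. kk v f u) - P0\<bar> \<le> e0"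
proof -
  have "EE PP (\<lambda>f. kk v f u) = pp {u,v} (kc v u)"
    unfolding kk_kc using assms by (subst DX_prob) auto
  then show ?thesis using assms kc(2)[of v u] by (simp only:) (intro pp_approx, auto)
qed

text \<open>The two events share only the edge uw. For each state of that edge they depend on
  disjoint sets of edges, so the probability is a product of two point probabilities, each within
  \<open>e0\<close> of \<open>P0\<close>.\<close>

lemma kk_pair:
  assumes v: "v \<in> V" "u \<in> V - {v}" "w \<in> V - {v}" "u \<noteq> w"
  shows "\<bar>EE PP (\<lambda>f. kk v f u * kk v f w) - P0\<^sup>2\<bar> \<le> 3 * nn (-499/1000) * e0"
proof -
  let ?Z = "V - {u,w,v}"
  let ?s = "\<lambda>r. \<Sum>t\<in>?Z. x t * of_bool (r t)"
  let ?a = "\<lambda>k. pp {u,w,v} k"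
  have Vuv: "V - {u,v} = insert w ?Z" using v by auto
  have sum_upd: "(\<Sum>t\<in>V - {u,v}. x t * of_bool ((r(w := b)) t)) = ?s r + x w * of_bool b" for r b
  proof -
    have "(\<Sum>t\<in>?Z. x t * of_bool ((r(w := b)) t)) = ?s r" by (rule sum.cong) auto
    then show ?thesis unfolding Vuv using finV by (subst sum.insert) (auto simp: add.commute)
  qed
  have inner: "EE (bern p (V - {u})) (\<lambda>r. kk v (upd u f r) u * kk v (upd u f r) w)
     = p * (?a (kc v u - x w) * of_bool (DX {u,v} f w = kc v w - x u)) + q * (?a (kc v u) * of_bool (DX {u,v} f w = kc v w))" for f
  proof -
    have k1: "kk v (upd u f r) u = of_bool ((\<Sum>t\<in>V - {u,v}. x t * of_bool (r t)) = kc v u)" for r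
      unfolding kk_kc using v by (simp add: DX_upd_self)
    have k2: "kk v (upd u f r) w = of_bool (DX {u,v} f w + x u * of_bool (r w) = kc v w)" for r
      unfolding kk_kc using v by (subst DX_upd_out) auto
    have "EE (bern p (V - {u})) (\<lambda>r. kk v (upd u f r) u * kk v (upd u f r) w)
      = EE (bern p (V - {u})) (\<lambda>r. p * (kk v (upd u f (r(w := True))) u * kk v (upd u f (r(w := True))) w) + q * (kk v (upd u f (r(w := False))) u * kk v (upd u f (r(w := False))) w))"
      by (rule EE_bern_resample) (use finV v in auto)
    also have "\<dots> = EE (bern p (V - {u})) (\<lambda>r. p * (of_bool (?s r = kc v u - x w) * of_bool (DX {u,v} f w = kc v w - x u))
          + q * (of_bool (?s r = kc v u) * of_bool (DX {u,v} f w = kc v w)))"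
      unfolding k1 k2 sum_upd by (simp only: fun_upd_same of_bool_eq mult_1_right mult_zero_right add_0_right eq_diff_eq)
    also have "\<dots> = p * (EE (bern p (V - {u})) (\<lambda>r. of_bool (?s r = kc v u - x w)) * of_bool (DX {u,v} f w = kc v w - x u))
         + q * (EE (bern p (V - {u})) (\<lambda>r. of_bool (?s r = kc v u)) * of_bool (DX {u,v} f w = kc v w))"
      unfolding EE_add[OF finite_set_row] by simp
    finally show ?thesis unfolding row_pp .
  qed
  have "EE PP (\<lambda>f. kk v f u * kk v f w) = p * (?a (kc v u - x w) * ?a (kc v w - x u)) + q * (?a (kc v u) * ?a (kc v w))"
    using v by (subst resample[of u]) (auto simp: inner EE_add[OF finite_set_PP] DX_prob insert_commute)
  moreover have "\<bar>?a k * ?a l - P0\<^sup>2\<bar> \<le> 3 * nn (-499/1000) * e0" if "\<bar>k\<bar> \<le> 10" "\<bar>l\<bar> \<le> 10" for k l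
  proof -
    have c3: "card {u,w,v} \<le> 3" by (simp add: card_insert_if)
    have A: "\<bar>?a k - P0\<bar> \<le> e0" "\<bar>?a l - P0\<bar> \<le> e0" using v that c3 by (auto intro!: pp_approx)
    have eq: "?a k * ?a l - P0\<^sup>2 = (?a k - P0) * (?a l - P0) + P0 * (?a k - P0) + P0 * (?a l - P0)"
      by (simp add: algebra_simps power2_eq_square)
    have P: "\<bar>(?a k - P0) * (?a l - P0)\<bar> \<le> e0 * e0" "\<bar>P0 * (?a k - P0)\<bar> \<le> P0 * e0" "\<bar>P0 * (?a l - P0)\<bar> \<le> P0 * e0"
      unfolding abs_mult using A P0_bounds e0_P0 by (intro mult_mono; simp)+
    have "\<bar>?a k * ?a l - P0\<^sup>2\<bar> \<le> e0 * e0 + P0 * e0 + P0 * e0" unfolding eq using P by linarith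
    also have "\<dots> \<le> 3 * nn (-499/1000) * e0"
    proof -
      have "e0 * e0 \<le> nn (-499/1000) * e0" "P0 * e0 \<le> nn (-499/1000) * e0"
        using e0_P0 P0_bounds by (intro mult_right_mono; simp)+
      then show ?thesis by linarith
    qed
    finally show ?thesis .
  qed
  moreover have "\<bar>kc v u - x w\<bar> \<le> 10" "\<bar>kc v w - x u\<bar> \<le> 10" "\<bar>kc v u\<bar> \<le> 10" "\<bar>kc v w\<bar> \<le> 10"
    using kc(2)[of v u] kc(2)[of v w] x_sq(3)[of u] x_sq(3)[of w] by linarith+
  ultimately have "EE PP (\<lambda>f. kk v f u * kk v f w) - P0\<^sup>2 = p * (?a (kc v u - x w) * ?a (kc v w - x u) - P0\<^sup>2) + q * (?a (kc v u) * ?a (kc v w) - P0\<^sup>2)"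
    "\<bar>?a (kc v u - x w) * ?a (kc v w - x u) - P0\<^sup>2\<bar> \<le> 3 * nn (-499/1000) * e0"
    "\<bar>?a (kc v u) * ?a (kc v w) - P0\<^sup>2\<bar> \<le> 3 * nn (-499/1000) * e0"
    by (simp_all add: q_def algebra_simps)
  then show ?thesis by (simp only: convex_abs_le)
qed

text \<open>There are n^2 off-diagonal pairs, each with covariance about n^(-1/2) *
  \<open>e0\<close>, together about n^(5/6); the diagonal gives only about n^(1/2). This lies below
  the square n of the mean count, so counts of pivotal vertices concentrate. Weights are allowed so
  that signed counts are covered as well.\<close>

lemma kk_second_moment:
  assumes v: "v \<in> V" and c: "\<And>u. u \<in> V - {v} \<Longrightarrow> \<bar>c u\<bar> \<le> 1"
  shows "EE PP (\<lambda>f. (\<Sum>u\<in>V - {v}. c u * (kk v f u - P0))\<^sup>2) \<le> nn (7/8)"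
proof -
  let ?A = "V - {v}"
  let ?z = "\<lambda>f u. kk v f u - P0"
  let ?h = "nn (-499/1000)"
  have pair: "EE PP (\<lambda>f. ?z f u * ?z f w) \<le> 5 * ?h * e0 + of_bool (u = w) * (2 * ?h) \<and> - EE PP (\<lambda>f. ?z f u * ?z f w) \<le> 5 * ?h * e0 + of_bool (u = w) * (2 * ?h)"
    if u: "u \<in> ?A" "w \<in> ?A" for u w
  proof -
    have e: "EE PP (\<lambda>f. ?z f u * ?z f w) = EE PP (\<lambda>f. kk v f u * kk v f w) - P0 * EE PP (\<lambda>f. kk v f u) - P0 * EE PP (\<lambda>f. kk v f w) + P0\<^sup>2"
    proof -
      have "EE PP (\<lambda>f. ?z f u * ?z f w) = EE PP (\<lambda>f. kk v f u * kk v f w - P0 * kk v f u - P0 * kk v f w + P0\<^sup>2)"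
        by (rule EE_cong) (simp add: algebra_simps power2_eq_square)
      also have "\<dots> = EE PP (\<lambda>f. kk v f u * kk v f w) - P0 * EE PP (\<lambda>f. kk v f u) - P0 * EE PP (\<lambda>f. kk v f w) + P0\<^sup>2"
        unfolding EE_add[OF finite_set_PP] EE_diff[OF finite_set_PP] by simp
      finally show ?thesis .
    qed
    have m: "\<bar>P0 * EE PP (\<lambda>f. kk v f u) - P0\<^sup>2\<bar> \<le> ?h * e0" if "u \<in> ?A" for u
    proof -
      have "\<bar>P0 * EE PP (\<lambda>f. kk v f u) - P0\<^sup>2\<bar> = P0 * \<bar>EE PP (\<lambda>f. kk v f u) - P0\<bar>"
      proof -
        have "P0 * EE PP (\<lambda>f. kk v f u) - P0\<^sup>2 = P0 * (EE PP (\<lambda>f. kk v f u) - P0)" by (simp add: right_diff_distrib power2_eq_square)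
        then show ?thesis using P0_bounds(1) by (simp only: abs_mult abs_of_pos)
      qed
      also have "\<dots> \<le> ?h * e0" using kk_mean[OF v that] P0_bounds nn_pos by (intro mult_mono) (auto simp: less_imp_le)
      finally show ?thesis .
    qed
    show ?thesis
    proof (cases "u = w")
      case False
      have r: "of_bool (u = w) * (2 * ?h) = 0" using False by simp
      have hh: "5 * ?h * e0 = 5 * (?h * e0)" "3 * ?h * e0 = 3 * (?h * e0)" by simp_all
      show ?thesis using kk_pair[OF v u False] m[OF u(1)] m[OF u(2)] unfolding e r hh abs_le_iff by linarith
    next
      case True
      let ?e = "EE PP (\<lambda>f. kk v f u)"
      have "kk v f u * kk v f u = kk v f u" for f using kk01(3)[of v f u] by (simp add: power2_eq_square)
      then have E: "EE PP (\<lambda>f. kk v f u * kk v f w) = ?e" unfolding True[symmetric] by presburger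
      have e2: "?e \<le> 2 * ?h" using kk_mean[OF v u(1)] P0_bounds e0_P0 unfolding abs_le_iff by linarith
      have ge: "0 \<le> ?e" by (intro integral_nonneg_AE AE_pmfI kk01)
      have P1: "P0 \<le> 1" using P0_bounds(2) nn_mono[of "-499/1000" 0] nn_1 by simp
      have a: "0 \<le> P0 * ?e" "P0 * ?e \<le> ?e" using ge P1 P0_bounds(1) by (simp_all add: mult_left_le_one_le)
      have b: "0 < ?h * e0" by (intro mult_pos_pos nn_pos e0_P0)
      have r: "of_bool (u = w) * (2 * ?h) = 2 * ?h" using True by simp
      have hh: "5 * ?h * e0 = 5 * (?h * e0)" by simp
      show ?thesis using m[OF u(1)] nn_pos[of "-499/1000"] e2 ge a b unfolding e E r hh unfolding True[symmetric] abs_le_iff by linarith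
    qed
  qed
  have "(\<Sum>u\<in>?A. c u * ?z f u)\<^sup>2 = (\<Sum>u\<in>?A. \<Sum>w\<in>?A. (c u * c w) * (?z f u * ?z f w))" for f
    unfolding power2_eq_square sum_product by (intro sum.cong refl) (simp add: mult_ac)
  then have "EE PP (\<lambda>f. (\<Sum>u\<in>?A. c u * ?z f u)\<^sup>2) = (\<Sum>u\<in>?A. \<Sum>w\<in>?A. (c u * c w) * EE PP (\<lambda>f. ?z f u * ?z f w))"
    by (simp only: EE_sum[OF finite_set_PP] integral_mult_right_zero)
  also have "\<dots> \<le> (\<Sum>u\<in>?A. \<Sum>w\<in>?A. 5 * ?h * e0 + of_bool (u = w) * (2 * ?h))"
  proof (intro sum_mono)
    fix u w assume u: "u \<in> ?A" "w \<in> ?A"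
    have "(c u * c w) * EE PP (\<lambda>f. ?z f u * ?z f w) \<le> \<bar>c u * c w\<bar> * \<bar>EE PP (\<lambda>f. ?z f u * ?z f w)\<bar>"
      unfolding abs_mult[symmetric] by (rule abs_ge_self)
    also have "\<dots> \<le> 1 * \<bar>EE PP (\<lambda>f. ?z f u * ?z f w)\<bar>"
      using c[OF u(1)] c[OF u(2)] by (intro mult_right_mono) (auto simp: abs_mult intro!: mult_le_one)
    also have "\<dots> \<le> 5 * ?h * e0 + of_bool (u = w) * (2 * ?h)" using pair[OF u] by linarith
    finally show "(c u * c w) * EE PP (\<lambda>f. ?z f u * ?z f w) \<le> 5 * ?h * e0 + of_bool (u = w) * (2 * ?h)" .
  qed
  also have "\<dots> = real (card ?A) * (real (card ?A) * (5 * ?h * e0)) + real (card ?A) * (2 * ?h)"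
  proof -
    have "(\<Sum>w\<in>?A. of_bool (u = w) * (2 * ?h)) = 2 * ?h" if "u \<in> ?A" for u
    proof -
      have "(\<Sum>w\<in>?A. of_bool (u = w) * (2 * ?h)) = (\<Sum>w\<in>?A. if w = u then 2 * ?h else 0)" by (rule sum.cong) auto
      then show ?thesis using that finV by simp
    qed
    then show ?thesis unfolding sum.distrib by simp
  qed
  also have "\<dots> \<le> (3 * nn 1) * ((3 * nn 1) * (5 * ?h * e0)) + (3 * nn 1) * (2 * ?h)"
  proof -
    have "card ?A \<le> card V" using finV by (intro card_mono) auto
    then have "real (card ?A) \<le> 3 * nn 1" using cV_nn(1) by linarith
    moreover have "0 \<le> 5 * ?h * e0" "0 \<le> 2 * ?h" using nn_pos[of "-499/1000"] e0_P0(1) by simp_all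
    moreover have "0 \<le> 3 * nn 1" using nn_pos[of 1] by simp
    ultimately show ?thesis by (intro add_mono mult_mono) (use e0_P0(1) in simp_all)
  qed
  also have "\<dots> = 45 * (nn 1 * (nn 1 * (?h * e0))) + 6 * (nn 1 * ?h)" by simp
  also have "\<dots> = 45 * nn (1 + (1 + (-499/1000 + -2/3))) + 6 * nn (1 + -499/1000)"
    unfolding e0_def nn_mult ..
  also have "\<dots> \<le> 45 * nn (84/100) + 6 * nn (84/100)" by (intro add_mono mult_left_mono nn_mono) auto
  also have "\<dots> = 51 * nn (84/100)" by simp
  also have "\<dots> \<le> nn (7/8)" by (rule nn_absorb) auto
  finally show ?thesis .
qed

text \<open>Jensen's inequality in the form |y| <= (y^2 / t + t) / 2 with t = n^a.\<close>

lemma EE_abs_from_sq: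
  assumes "EE PP (\<lambda>f. (F f)\<^sup>2) \<le> nn (2 * a)"
  shows "EE PP (\<lambda>f. \<bar>F f\<bar>) \<le> nn a"
proof -
  have "\<bar>y\<bar> \<le> (y\<^sup>2 / nn a + nn a) / 2" for y :: real
  proof -
    have "0 \<le> (\<bar>y\<bar> - nn a)\<^sup>2" by simp
    then have "2 * (\<bar>y\<bar> * nn a) \<le> y\<^sup>2 + nn a * nn a" by (simp add: power2_diff power2_eq_square algebra_simps)
    then have "(2 * (\<bar>y\<bar> * nn a)) / nn a \<le> (y\<^sup>2 + nn a * nn a) / nn a" by (rule divide_right_mono) simp
    then show ?thesis by (simp add: add_divide_distrib)
  qed
  then have "EE PP (\<lambda>f. \<bar>F f\<bar>) \<le> EE PP (\<lambda>f. ((F f)\<^sup>2 / nn a + nn a) / 2)"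
    by (intro EE_mono finite_set_PP)
  also have "\<dots> = (EE PP (\<lambda>f. (F f)\<^sup>2) / nn a + nn a) / 2" by (simp add: EE_add[OF finite_set_PP])
  also have "\<dots> \<le> (nn (2 * a) / nn a + nn a) / 2" using assms nn_pos[of a] by (intro divide_right_mono add_mono) auto
  also have "\<dots> = nn a" by (simp add: nn_divide)
  finally show ?thesis .
qed

definition kap :: real where "kap = real (card V) * P0"

lemma kk_weighted_L1:
  assumes v: "v \<in> V" and c: "\<And>u. u \<in> V - {v} \<Longrightarrow> \<bar>c u\<bar> \<le> 1"
  shows "EE PP (\<lambda>f. \<bar>(\<Sum>u\<in>V - {v}. c u * kk v f u) - P0 * (\<Sum>u\<in>V - {v}. c u)\<bar>) \<le> nn (7/16)"
proof -
  have "(\<Sum>u\<in>V - {v}. c u * kk v f u) - P0 * (\<Sum>u\<in>V - {v}. c u) = (\<Sum>u\<in>V - {v}. c u * (kk v f u - P0))" for f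
    by (simp add: sum_distrib_left sum_subtractf algebra_simps)
  then show ?thesis using EE_abs_from_sq[of _ "7/16"] kk_second_moment[OF v c] by simp
qed

lemma card_row: "v \<in> V \<Longrightarrow> real (card (V - {v})) = real (card V) - 1"
  using card_Suc_Diff1[OF finV, of v] by linarith

lemma KN_L1: assumes "v \<in> V" shows "EE PP (\<lambda>f. \<bar>KN v f - kap\<bar>) \<le> 2 * nn (7/16)"
proof -
  have c1: "real (card (V - {v})) = real (card V) - 1" using card_row[OF assms] .
  have "EE PP (\<lambda>f. \<bar>KN v f - kap\<bar>) \<le> EE PP (\<lambda>f. \<bar>(\<Sum>u\<in>V - {v}. 1 * kk v f u) - P0 * (\<Sum>u\<in>V - {v}. 1)\<bar> + P0)"
  proof (intro EE_mono finite_set_PP)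
    fix f
    have "KN v f - kap = ((\<Sum>u\<in>V - {v}. 1 * kk v f u) - P0 * (\<Sum>u\<in>V - {v}. 1)) - P0"
      by (simp add: KN_def kap_def c1 algebra_simps)
    then show "\<bar>KN v f - kap\<bar> \<le> \<bar>(\<Sum>u\<in>V - {v}. 1 * kk v f u) - P0 * (\<Sum>u\<in>V - {v}. 1)\<bar> + P0"
      using P0_bounds(1) by linarith
  qed
  also have "\<dots> \<le> nn (7/16) + nn (7/16)"
    using kk_weighted_L1[OF assms, of "\<lambda>_. 1"] P0_bounds(2) nn_mono[of "-499/1000" "7/16"] by (simp add: EE_add[OF finite_set_PP])
  finally show ?thesis by simp
qed

lemma kap_bounds: "0 < kap" "kap \<le> 3 * nn (501/1000)"
proof -
  have "0 < real (card V)" using cV_nn(2) nn_pos[of 1] by linarith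
  then show "0 < kap" using P0_bounds by (simp add: kap_def)
  have "kap \<le> (3 * nn 1) * nn (-499/1000)" unfolding kap_def using cV_nn P0_bounds nn_pos by (intro mult_mono) (auto simp: less_imp_le)
  then show "kap \<le> 3 * nn (501/1000)" by (simp add: nn_mult mult.assoc)
qed

lemma KN_moments:
  assumes v: "v \<in> V"
  shows "EE PP (KN v) \<le> nn (502/1000)" "EE PP (\<lambda>f. (KN v f)\<^sup>2) \<le> nn (1004/1000)"
proof -
  let ?z = "\<lambda>f. \<Sum>u\<in>V - {v}. 1 * (kk v f u - P0)"
  have k: "\<bar>KN v f\<bar> \<le> \<bar>?z f\<bar> + kap" for f
  proof -
    have "KN v f = ?z f + real (card (V - {v})) * P0" by (simp add: KN_def sum_subtractf)
    moreover have "real (card (V - {v})) * P0 \<le> kap" "0 \<le> real (card (V - {v})) * P0"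
      unfolding kap_def using finV P0_bounds by (auto intro!: mult_right_mono card_mono)
    ultimately show ?thesis by linarith
  qed
  have "EE PP (KN v) \<le> EE PP (\<lambda>f. \<bar>?z f\<bar> + kap)" 
  proof (intro EE_mono finite_set_PP)
    show "KN v f \<le> \<bar>?z f\<bar> + kap" for f using k[of f] by linarith
  qed
  also have "\<dots> \<le> nn (7/16) + 3 * nn (501/1000)"
    using EE_abs_from_sq[of ?z "7/16"] kk_second_moment[OF v, of "\<lambda>_. 1"] kap_bounds by (simp add: EE_add[OF finite_set_PP])
  also have "\<dots> \<le> 4 * nn (501/1000)" using nn_mono[of "7/16" "501/1000"] by simp
  also have "\<dots> \<le> nn (502/1000)" by (rule nn_absorb) auto
  finally show "EE PP (KN v) \<le> nn (502/1000)" .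
  have sq: "(KN v f)\<^sup>2 \<le> 2 * (?z f)\<^sup>2 + 2 * kap\<^sup>2" for f
  proof -
    have "\<bar>KN v f\<bar>\<^sup>2 \<le> (\<bar>?z f\<bar> + kap)\<^sup>2" using k by (intro power_mono) auto
    also have "\<dots> \<le> 2 * \<bar>?z f\<bar>\<^sup>2 + 2 * kap\<^sup>2"
      using zero_le_power2[of "\<bar>?z f\<bar> - kap"] unfolding power2_sum power2_diff by linarith
    finally show ?thesis by simp
  qed
  have "EE PP (\<lambda>f. (KN v f)\<^sup>2) \<le> EE PP (\<lambda>f. 2 * (?z f)\<^sup>2 + 2 * kap\<^sup>2)" by (intro EE_mono finite_set_PP sq)
  also have "\<dots> \<le> 2 * nn (7/8) + 2 * (3 * nn (501/1000))\<^sup>2"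
    using kk_second_moment[OF v, of "\<lambda>_. 1"] power_mono[OF kap_bounds(2), of 2] kap_bounds(1) by (simp add: EE_add[OF finite_set_PP])
  also have "\<dots> = 2 * nn (7/8) + 18 * nn (1002/1000)" by (simp add: power_mult_distrib nn_power)
  also have "\<dots> \<le> 20 * nn (1002/1000)" using nn_mono[of "7/8" "1002/1000"] by simp
  also have "\<dots> \<le> nn (1004/1000)" by (rule nn_absorb) auto
  finally show "EE PP (\<lambda>f. (KN v f)\<^sup>2) \<le> nn (1004/1000)" .
qed

end

section \<open>Central limit theorem after one step\<close>

lemma taylor3:
  fixes g :: "real \<Rightarrow> real"
  assumes "\<And>y. (g has_real_derivative g1 y) (at y)" "\<And>y. (g1 has_real_derivative g2 y) (at y)"
    "\<And>y. (g2 has_real_derivative g3 y) (at y)" and L: "\<And>y. \<bar>g3 y\<bar> \<le> L"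
  shows "\<bar>g (w + d) - (g w + g1 w * d + g2 w * d\<^sup>2 / 2)\<bar> \<le> L * \<bar>d\<bar>^3"
proof (cases "d = 0")
  case False
  define diff where "diff m = (if m = 0 then g else if m = 1 then g1 else if m = 2 then g2 else g3)" for m :: nat
  have D: "\<forall>m t. m < 3 \<and> min w (w+d) \<le> t \<and> t \<le> max w (w+d) \<longrightarrow> DERIV (diff m) t :> diff (Suc m) t"
  proof (intro allI impI)
    fix m t assume "m < (3::nat) \<and> min w (w+d) \<le> t \<and> t \<le> max w (w+d)"
    then have "m = 0 \<or> m = 1 \<or> m = 2" by linarith
    then show "DERIV (diff m) t :> diff (Suc m) t" using assms(1-3) by (auto simp: diff_def)
  qed
  obtain t where t: "g (w + d) = (\<Sum>m<3. diff m w / fact m * (w + d - w)^m) + diff 3 t / fact 3 * (w + d - w)^3"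
    using Taylor[of 3 diff g "min w (w+d)" "max w (w+d)" w "w+d", OF _ _ D] False by (auto simp: diff_def)
  have "(\<Sum>m<3. diff m w / fact m * (w + d - w)^m) = g w + g1 w * d + g2 w * d\<^sup>2 / 2"
    by (simp add: eval_nat_numeral lessThan_Suc diff_def)
  then have "g (w + d) - (g w + g1 w * d + g2 w * d\<^sup>2 / 2) = g3 t / 6 * d^3"
    using t by (simp add: diff_def fact_numeral)
  then have "\<bar>g (w + d) - (g w + g1 w * d + g2 w * d\<^sup>2 / 2)\<bar> = \<bar>g3 t / 6 * d^3\<bar>" by (simp only:)
  also have "\<dots> = \<bar>g3 t\<bar> / 6 * \<bar>d\<bar>^3" by (simp add: abs_mult power_abs)
  also have "\<dots> \<le> L * \<bar>d\<bar>^3" using L[of t] by (intro mult_right_mono) auto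
  finally show ?thesis .
qed simp

context regime begin

section \<open>Moments over the edges at one vertex\<close>

definition Er :: "'a \<Rightarrow> (('a \<Rightarrow> bool) \<Rightarrow> real) \<Rightarrow> real" where "Er v F = EE (bern p (V - {v})) F"

lemma Er_add: "Er v (\<lambda>r. F r + G r) = Er v F + Er v G" unfolding Er_def by (rule EE_add[OF finite_set_row])
lemma Er_diff: "Er v (\<lambda>r. F r - G r) = Er v F - Er v G" unfolding Er_def by (rule EE_diff[OF finite_set_row])
lemma Er_cmult: "Er v (\<lambda>r. c * F r) = c * Er v F" unfolding Er_def by simp
lemma Er_const: "Er v (\<lambda>r. c) = c" unfolding Er_def by simp
lemma Er_sum: "Er v (\<lambda>r. \<Sum>i\<in>I. F i r) = (\<Sum>i\<in>I. Er v (F i))" unfolding Er_def by (rule EE_sum[OF finite_set_row])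
lemma Er_mono: "(\<And>r. F r \<le> G r) \<Longrightarrow> Er v F \<le> Er v G" unfolding Er_def by (rule EE_mono[OF finite_set_row])
lemma Er_abs_le: "(\<And>r. \<bar>F r\<bar> \<le> G r) \<Longrightarrow> \<bar>Er v F\<bar> \<le> Er v G" unfolding Er_def by (rule EE_abs_le[OF finite_set_row])
lemma Er_nonneg: "(\<And>r. 0 \<le> F r) \<Longrightarrow> 0 \<le> Er v F" using Er_mono[of "\<lambda>_. 0" F v] by (simp add: Er_const)
lemma Er_Yr: "Er v (\<lambda>r. Yr v r) = mv v" by (simp add: Er_def mv_def)
lemma resampleE: "v \<in> V \<Longrightarrow> EE PP F = EE PP (\<lambda>f. Er v (\<lambda>r. F (upd v f r)))" unfolding Er_def by (rule resample)
lemma finVv: "finite (V - {v})" using finV by simp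

lemma TT_moments:
  "Er v (\<lambda>r. TT v f r) = 0" "Er v (\<lambda>r. (TT v f r)\<^sup>2) \<le> KN v f" "Er v (\<lambda>r. (TT v f r)^4) \<le> 3 * (KN v f)\<^sup>2"
proof -
  show "Er v (\<lambda>r. TT v f r) = 0" unfolding Er_def TT_def using csum_moments(1)[OF finVv] by simp
  have "Er v (\<lambda>r. (TT v f r)\<^sup>2) = p * q * KN v f"
    unfolding Er_def TT_def csum_moments(2)[OF finVv] sum_kk_sq ..
  also have "\<dots> \<le> 1 * KN v f" using pq KN_nonneg by (intro mult_right_mono) auto
  finally show "Er v (\<lambda>r. (TT v f r)\<^sup>2) \<le> KN v f" by simp
  show "Er v (\<lambda>r. (TT v f r)^4) \<le> 3 * (KN v f)\<^sup>2"
    unfolding Er_def TT_def using csum_moments(3)[OF finVv[of v], of "kk v f"] unfolding sum_kk_sq .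
qed

text \<open>The scale n^(251/1000) is the square root of the bound on the mean of \<open>KN\<close>,
  so the quadratic bound on |y| is balanced there. Multiplied by y^2 it interpolates the third
  moment between the second and the fourth.\<close>

lemma TT_abs_moments:
  assumes v: "v \<in> V"
  shows "EE PP (\<lambda>f. Er v (\<lambda>r. \<bar>TT v f r\<bar>)) \<le> nn (251/1000)"
    and "EE PP (\<lambda>f. Er v (\<lambda>r. \<bar>TT v f r\<bar>^3)) \<le> 2 * nn (753/1000)"
proof -
  let ?A = "nn (251/1000)"
  have 1: "\<bar>y\<bar> \<le> (1 / (2 * ?A)) * y\<^sup>2 + ?A / 2" for y :: real
  proof -
    have "0 \<le> (\<bar>y\<bar> - ?A)\<^sup>2" by simp
    then have "2 * ?A * \<bar>y\<bar> \<le> y\<^sup>2 + ?A * ?A" by (simp add: power2_diff power2_eq_square algebra_simps)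
    then have "(2 * ?A * \<bar>y\<bar>) / (2 * ?A) \<le> (y\<^sup>2 + ?A * ?A) / (2 * ?A)" by (rule divide_right_mono) simp
    then show ?thesis by (simp add: add_divide_distrib)
  qed
  have "EE PP (\<lambda>f. Er v (\<lambda>r. \<bar>TT v f r\<bar>)) \<le> EE PP (\<lambda>f. (1 / (2 * ?A)) * KN v f + ?A / 2)"
  proof (rule EE_mono[OF finite_set_PP])
    fix f
    have "Er v (\<lambda>r. \<bar>TT v f r\<bar>) \<le> Er v (\<lambda>r. (1 / (2 * ?A)) * (TT v f r)\<^sup>2 + ?A / 2)" by (rule Er_mono) (rule 1)
    also have "\<dots> = (1 / (2 * ?A)) * Er v (\<lambda>r. (TT v f r)\<^sup>2) + ?A / 2" unfolding Er_add Er_cmult Er_const ..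
    also have "\<dots> \<le> (1 / (2 * ?A)) * KN v f + ?A / 2" using TT_moments(2) by (intro add_right_mono mult_left_mono) auto
    finally show "Er v (\<lambda>r. \<bar>TT v f r\<bar>) \<le> (1 / (2 * ?A)) * KN v f + ?A / 2" .
  qed
  also have "\<dots> = (1 / (2 * ?A)) * EE PP (KN v) + ?A / 2" unfolding EE_add[OF finite_set_PP] by simp
  also have "\<dots> \<le> (1 / (2 * ?A)) * nn (502/1000) + ?A / 2" using KN_moments(1)[OF v] by (intro add_right_mono mult_left_mono) auto
  also have "\<dots> = ?A" using nn_divide[of "502/1000" "251/1000"] by simp
  finally show "EE PP (\<lambda>f. Er v (\<lambda>r. \<bar>TT v f r\<bar>)) \<le> nn (251/1000)" .
  have 3: "\<bar>y\<bar>^3 \<le> (1 / (2 * ?A)) * y^4 + (?A / 2) * y\<^sup>2" for y :: real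
  proof -
    have "y\<^sup>2 * \<bar>y\<bar> \<le> y\<^sup>2 * ((1 / (2 * ?A)) * y\<^sup>2 + ?A / 2)" using 1[of y] by (intro mult_left_mono) auto
    moreover have "y\<^sup>2 * \<bar>y\<bar> = \<bar>y\<bar>^3" by (simp add: power3_eq_cube power2_eq_square)
    moreover have "y\<^sup>2 * ((1 / (2 * ?A)) * y\<^sup>2 + ?A / 2) = (1 / (2 * ?A)) * y^4 + (?A / 2) * y\<^sup>2"
      by (simp add: power2_eq_square power4_eq_xxxx algebra_simps)
    ultimately show ?thesis by simp
  qed
  have "EE PP (\<lambda>f. Er v (\<lambda>r. \<bar>TT v f r\<bar>^3)) \<le> EE PP (\<lambda>f. (1 / (2 * ?A)) * (3 * (KN v f)\<^sup>2) + (?A / 2) * KN v f)"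
  proof (rule EE_mono[OF finite_set_PP])
    fix f
    have "Er v (\<lambda>r. \<bar>TT v f r\<bar>^3) \<le> Er v (\<lambda>r. (1 / (2 * ?A)) * (TT v f r)^4 + (?A / 2) * (TT v f r)\<^sup>2)" by (rule Er_mono) (rule 3)
    also have "\<dots> = (1 / (2 * ?A)) * Er v (\<lambda>r. (TT v f r)^4) + (?A / 2) * Er v (\<lambda>r. (TT v f r)\<^sup>2)" unfolding Er_add Er_cmult ..
    also have "\<dots> \<le> (1 / (2 * ?A)) * (3 * (KN v f)\<^sup>2) + (?A / 2) * KN v f"
      using TT_moments(2,3) by (intro add_mono mult_left_mono) auto
    finally show "Er v (\<lambda>r. \<bar>TT v f r\<bar>^3) \<le> (1 / (2 * ?A)) * (3 * (KN v f)\<^sup>2) + (?A / 2) * KN v f" .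
  qed
  also have "\<dots> = (1 / (2 * ?A)) * (3 * EE PP (\<lambda>f. (KN v f)\<^sup>2)) + (?A / 2) * EE PP (KN v)" unfolding EE_add[OF finite_set_PP] by simp
  also have "\<dots> \<le> (1 / (2 * ?A)) * (3 * nn (1004/1000)) + (?A / 2) * nn (502/1000)"
    using KN_moments[OF v] by (intro add_mono mult_left_mono) auto
  also have "\<dots> = (3/2) * (nn (1004/1000) / ?A) + (1/2) * (?A * nn (502/1000))" by simp
  also have "\<dots> = 2 * nn (753/1000)" unfolding nn_divide nn_mult by simp
  finally show "EE PP (\<lambda>f. Er v (\<lambda>r. \<bar>TT v f r\<bar>^3)) \<le> 2 * nn (753/1000)" .
qed

lemma Yr_upd:
  assumes "v \<in> V" "u \<in> V - {v}"
  shows "Yr v (r(u := True)) - Yr v (r(u := False)) = 2 * real_of_int (x u) * of_bool ((\<Sum>t\<in>V - {v,u}. x t * of_bool (r t)) = kc v u)"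
proof -
  let ?s = "\<Sum>t\<in>V - {v,u}. x t * of_bool (r t)"
  have s: "(\<Sum>t\<in>V - {v}. x t * of_bool ((r(u := b)) t)) = ?s + x u * of_bool b" for b
  proof -
    have e: "V - {v} = insert u (V - {v,u})" using assms by auto
    have "(\<Sum>t\<in>V - {v,u}. x t * of_bool ((r(u := b)) t)) = ?s" by (rule sum.cong) auto
    then show ?thesis unfolding e using finV by (subst sum.insert) (simp_all del: sum_mult_of_bool_eq)
  qed
  have "Yr v (r(u := True)) = sg (real_of_int ((2 * ?s + x v) + 2 * x u))" unfolding Yr_def s by (simp add: algebra_simps del: sum_mult_of_bool_eq)
  moreover have "Yr v (r(u := False)) = sg (real_of_int (2 * ?s + x v))" unfolding Yr_def s by (simp del: sum_mult_of_bool_eq)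
  moreover have "(2 * ?s + x v) + x u = 0 \<longleftrightarrow> ?s = kc v u" using kc(1)[of ?s u v] by (simp only: ac_simps)
  ultimately show ?thesis using sg_flip[of "2 * ?s + x v" "x u"] x_sq(5)[of v] x_cases[of u] by (simp del: sum_mult_of_bool_eq)
qed

text \<open>After \<open>EE_bern_cov\<close> this is the probability that the edge uv decides the
  color of v; since \<open>kc\<close> is symmetric, the critical value is the one at which u is
  pivotal for v.\<close>

lemma Yr_cov1:
  assumes "v \<in> V" "u \<in> V - {v}"
  shows "Er v (\<lambda>r. (of_bool (r u) - p) * Yr v r) = p * q * (2 * real_of_int (x u) * pp {v,u} (kc v u))"
  unfolding Er_def EE_bern_cov[OF finVv assms(2)] Yr_upd[OF assms] by (simp add: row_pp del: sum_mult_of_bool_eq)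

lemma pp_pair_approx: "v \<in> V \<Longrightarrow> u \<in> V \<Longrightarrow> \<bar>pp {v,u} (kc v u) - P0\<bar> \<le> e0"
  using kc(2)[of v u] by (intro pp_approx) (auto simp: card_insert_if)

text \<open>
  The two conditional moments that decide the central limit theorem. Both are small because red and blue pivotal vertices
  are almost equinumerous (\<open>aa\<close>) and because point probabilities vary slowly (\<open>cc\<close>).
\<close>

definition aa where "aa v f = Er v (\<lambda>r. Yr v r * TT v f r)"
definition cc where "cc v f = Er v (\<lambda>r. (Yr v r - mv v) * (TT v f r)\<^sup>2)"

text \<open>By \<open>Yr_cov1\<close> a pivotal vertex u contributes a multiple of its initial color
  times a point probability. With \<open>P0\<close> in place of the latter a signed count remains,
  and the replacement costs \<open>e0\<close> per pivotal vertex.\<close>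

lemma aa_pt:
  assumes "v \<in> V"
  shows "\<bar>aa v f\<bar> \<le> P0 * \<bar>\<Sum>u\<in>V - {v}. real_of_int (x u) * kk v f u\<bar> + e0 * KN v f"
proof -
  have "aa v f = Er v (\<lambda>r. \<Sum>u\<in>V - {v}. kk v f u * ((of_bool (r u) - p) * Yr v r))"
    unfolding aa_def TT_def csum_def sum_distrib_left by (simp only: mult_ac)
  also have "\<dots> = (\<Sum>u\<in>V - {v}. kk v f u * (p * q * (2 * real_of_int (x u) * pp {v,u} (kc v u))))"
    unfolding Er_sum Er_cmult by (rule sum.cong) (use Yr_cov1[OF assms] in auto)
  also have "\<dots> = p * q * 2 * ((\<Sum>u\<in>V - {v}. P0 * (real_of_int (x u) * kk v f u)) + (\<Sum>u\<in>V - {v}. real_of_int (x u) * kk v f u * (pp {v,u} (kc v u) - P0)))"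
    unfolding sum.distrib[symmetric] sum_distrib_left by (rule sum.cong) (simp_all add: algebra_simps)
  finally have e: "aa v f = p * q * (2 * (P0 * (\<Sum>u\<in>V - {v}. real_of_int (x u) * kk v f u) + (\<Sum>u\<in>V - {v}. real_of_int (x u) * kk v f u * (pp {v,u} (kc v u) - P0))))"
    unfolding sum_distrib_left[symmetric] by simp
  have b: "\<bar>\<Sum>u\<in>V - {v}. real_of_int (x u) * kk v f u * (pp {v,u} (kc v u) - P0)\<bar> \<le> e0 * KN v f"
  proof -
    have "\<bar>\<Sum>u\<in>V - {v}. real_of_int (x u) * kk v f u * (pp {v,u} (kc v u) - P0)\<bar> \<le> (\<Sum>u\<in>V - {v}. e0 * kk v f u)"
    proof (rule order_trans[OF sum_abs sum_mono])
      fix u assume u: "u \<in> V - {v}"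
      have "\<bar>real_of_int (x u) * kk v f u * (pp {v,u} (kc v u) - P0)\<bar> = kk v f u * \<bar>pp {v,u} (kc v u) - P0\<bar>"
        unfolding abs_mult x_sq using kk01(1) by simp
      also have "\<dots> \<le> kk v f u * e0" using pp_pair_approx[of v u] u assms kk01(1) by (intro mult_left_mono) auto
      finally show "\<bar>real_of_int (x u) * kk v f u * (pp {v,u} (kc v u) - P0)\<bar> \<le> e0 * kk v f u" by (simp only: mult.commute)
    qed
    then show ?thesis by (simp add: KN_def sum_distrib_left)
  qed
  let ?Q = "P0 * (\<Sum>u\<in>V - {v}. real_of_int (x u) * kk v f u) + (\<Sum>u\<in>V - {v}. real_of_int (x u) * kk v f u * (pp {v,u} (kc v u) - P0))"
  have "\<bar>aa v f\<bar> = p * q * \<bar>2 * ?Q\<bar>" unfolding e abs_pq ..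
  also have "\<dots> \<le> (1/4) * \<bar>2 * ?Q\<bar>" using pq by (intro mult_right_mono) auto
  also have "\<dots> \<le> \<bar>?Q\<bar>" unfolding abs_mult[of 2 ?Q] by simp
  also have "\<dots> \<le> \<bar>P0 * (\<Sum>u\<in>V - {v}. real_of_int (x u) * kk v f u)\<bar> + e0 * KN v f" using b by linarith
  finally show ?thesis using P0_bounds(1) by (simp only: abs_mult abs_of_pos)
qed

text \<open>The signed count of pivotal vertices has negligible mean, because red exceeds blue by
  \<open>\<Delta>\<close> only, and fluctuates by at most n^(7/16). The factor \<open>P0\<close>
  brings this below 1.\<close>

lemma aa_L1: assumes v: "v \<in> V" shows "EE PP (\<lambda>f. \<bar>aa v f\<bar>) \<le> nn (-1/20)"
proof -
  let ?X = "\<lambda>f. \<Sum>u\<in>V - {v}. real_of_int (x u) * kk v f u"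
  have sx: "\<bar>\<Sum>u\<in>V - {v}. real_of_int (x u)\<bar> \<le> nn (2/1000)"
  proof -
    have "(\<Sum>u\<in>V - {v}. real_of_int (x u)) = real \<Delta> - x v" using sum_x sum.remove[OF finV v, of "\<lambda>u. real_of_int (x u)"] by simp
    then have "\<bar>\<Sum>u\<in>V - {v}. real_of_int (x u)\<bar> \<le> real \<Delta> + 1" using x_sq(4)[of v] by linarith
    also have "\<dots> \<le> 2 * nn (1/1000)" using \<Delta>b nb by linarith
    also have "\<dots> \<le> nn (2/1000)" by (rule nn_absorb) auto
    finally show ?thesis .
  qed
  have X: "EE PP (\<lambda>f. \<bar>?X f\<bar>) \<le> 2 * nn (7/16)"
  proof -
    have "EE PP (\<lambda>f. \<bar>?X f\<bar>) \<le> EE PP (\<lambda>f. \<bar>?X f - P0 * (\<Sum>u\<in>V - {v}. real_of_int (x u))\<bar> + nn (7/16))"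
    proof (rule EE_mono[OF finite_set_PP])
      fix f
      have "\<bar>P0 * (\<Sum>u\<in>V - {v}. real_of_int (x u))\<bar> \<le> nn (-499/1000) * nn (2/1000)"
        unfolding abs_mult using P0_bounds sx by (intro mult_mono) auto
      also have "\<dots> \<le> nn (7/16)" unfolding nn_mult by (rule nn_mono) simp
      finally show "\<bar>?X f\<bar> \<le> \<bar>?X f - P0 * (\<Sum>u\<in>V - {v}. real_of_int (x u))\<bar> + nn (7/16)" by linarith
    qed
    also have "\<dots> \<le> nn (7/16) + nn (7/16)" unfolding EE_add[OF finite_set_PP]
      using kk_weighted_L1[OF v, of "\<lambda>u. real_of_int (x u)"] x_sq by simp
    finally show ?thesis by simp
  qed
  have "EE PP (\<lambda>f. \<bar>aa v f\<bar>) \<le> EE PP (\<lambda>f. P0 * \<bar>?X f\<bar> + e0 * KN v f)" by (rule EE_mono[OF finite_set_PP]) (rule aa_pt[OF v])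
  also have "\<dots> = P0 * EE PP (\<lambda>f. \<bar>?X f\<bar>) + e0 * EE PP (KN v)" unfolding EE_add[OF finite_set_PP] by simp
  also have "\<dots> \<le> nn (-499/1000) * (2 * nn (7/16)) + nn (-2/3) * nn (502/1000)"
    using X KN_moments(1)[OF v] P0_bounds unfolding e0_def by (intro add_mono mult_mono) (auto intro!: integral_nonneg_AE AE_pmfI KN_nonneg)
  also have "\<dots> = 2 * nn (-499/1000 + 7/16) + nn (-2/3 + 502/1000)" unfolding nn_mult[symmetric] by simp
  also have "\<dots> \<le> 2 * nn (-6/100) + nn (-6/100)" by (intro add_mono mult_left_mono nn_mono) auto
  also have "\<dots> = 3 * nn (-6/100)" by simp
  also have "\<dots> \<le> nn (-1/20)" by (rule nn_absorb) auto
  finally show ?thesis .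
qed

text \<open>Integrating by parts twice leaves the difference of two point probabilities at
  neighboring values. Each is within \<open>e0\<close> of \<open>P0\<close>, so the leading parts
  cancel.\<close>

lemma Yr_cov2:
  assumes v: "v \<in> V" and u: "u \<in> V - {v}" and w: "w \<in> V - {v}" and ne: "u \<noteq> w"
  shows "\<bar>Er v (\<lambda>r. (of_bool (r u) - p) * ((of_bool (r w) - p) * Yr v r))\<bar> \<le> e0"
proof -
  let ?Z = "V - {v,w,u}"
  let ?s = "\<lambda>r. \<Sum>t\<in>?Z. x t * of_bool (r t)"
  have s: "(\<Sum>t\<in>V - {v,u}. x t * of_bool ((r(w := b)) t)) = ?s r + x w * of_bool b" for r b
  proof -
    have e: "V - {v,u} = insert w ?Z" using u w ne by auto
    have "(\<Sum>t\<in>?Z. x t * of_bool ((r(w := b)) t)) = ?s r" by (rule sum.cong) auto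
    then show ?thesis unfolding e using finV by (subst sum.insert) (simp_all del: sum_mult_of_bool_eq)
  qed
  have "Er v (\<lambda>r. (of_bool (r u) - p) * ((of_bool (r w) - p) * Yr v r))
    = p * q * Er v (\<lambda>r. (of_bool (r w) - p) * Yr v (r(u := True)) - (of_bool (r w) - p) * Yr v (r(u := False)))"
    unfolding Er_def EE_bern_cov[OF finVv u] by (simp only: fun_upd_other[OF ne[symmetric]])
  also have "(\<lambda>r. (of_bool (r w) - p) * Yr v (r(u := True)) - (of_bool (r w) - p) * Yr v (r(u := False)))
     = (\<lambda>r. (of_bool (r w) - p) * (2 * real_of_int (x u) * of_bool ((\<Sum>t\<in>V - {v,u}. x t * of_bool (r t)) = kc v u)))"
    unfolding right_diff_distrib[symmetric] Yr_upd[OF v u] ..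
  also have "Er v \<dots> = p * q * Er v (\<lambda>r. 2 * real_of_int (x u) * of_bool (?s r = kc v u - x w) - 2 * real_of_int (x u) * of_bool (?s r = kc v u))"
    unfolding Er_def EE_bern_cov[OF finVv w] s by (simp only: of_bool_eq mult_1_right mult_zero_right add_0_right eq_diff_eq)
  also have "\<dots> = p * q * (2 * real_of_int (x u) * (pp {v,w,u} (kc v u - x w) - pp {v,w,u} (kc v u)))"
    unfolding Er_diff Er_cmult unfolding Er_def row_pp right_diff_distrib ..
  finally have e: "Er v (\<lambda>r. (of_bool (r u) - p) * ((of_bool (r w) - p) * Yr v r))
     = p * q * (p * q * (2 * real_of_int (x u) * (pp {v,w,u} (kc v u - x w) - pp {v,w,u} (kc v u))))" .
  have c3: "card {v,w,u} \<le> 3" by (simp add: card_insert_if)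
  have "\<bar>pp {v,w,u} (kc v u - x w) - P0\<bar> \<le> e0" "\<bar>pp {v,w,u} (kc v u) - P0\<bar> \<le> e0"
    using kc(2)[of v u] x_sq(3)[of w] v u w c3 by (intro pp_approx; auto)+
  then have d: "\<bar>pp {v,w,u} (kc v u - x w) - pp {v,w,u} (kc v u)\<bar> \<le> 2 * e0" by linarith
  have "\<bar>Er v (\<lambda>r. (of_bool (r u) - p) * ((of_bool (r w) - p) * Yr v r))\<bar>
     = p * q * (p * q * (2 * \<bar>pp {v,w,u} (kc v u - x w) - pp {v,w,u} (kc v u)\<bar>))"
    unfolding e abs_pq abs_mult[of "2 * real_of_int (x u)"] abs_mult[of 2] x_sq by simp
  also have "\<dots> \<le> (1/4) * ((1/4) * (2 * (2 * e0)))"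
    using pq d by (intro mult_mono) auto
  finally show ?thesis using e0_P0(1) by linarith
qed

text \<open>Expanding the square gives pairs of pivotal vertices: off the diagonal
  \<open>Yr_cov2\<close> yields about \<open>e0\<close> * n, roughly n^(1/3), and the diagonal is
  smaller. The comparison is with the second moment of \<open>TT\<close>, bounded by about
  n^(1/2).\<close>

lemma cc_L1: assumes v: "v \<in> V" shows "EE PP (\<lambda>f. \<bar>cc v f\<bar>) \<le> nn (35/100)"
proof -
  let ?h = "nn (-499/1000)"
  have pair: "\<bar>Er v (\<lambda>r. (Yr v r - mv v) * ((of_bool (r u) - p) * (of_bool (r w) - p)))\<bar> \<le> e0 + of_bool (u = w) * (2 * ?h)"
    if u: "u \<in> V - {v}" "w \<in> V - {v}" for u w
  proof (cases "u = w")
    case False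
    have "(\<lambda>r. (Yr v r - mv v) * ((of_bool (r u) - p) * (of_bool (r w) - p)))
      = (\<lambda>r. (of_bool (r u) - p) * ((of_bool (r w) - p) * Yr v r) - mv v * ((of_bool (r u) - p) * (of_bool (r w) - p)))"
      by (simp add: fun_eq_iff algebra_simps)
    moreover have "Er v (\<lambda>r. (of_bool (r u) - p) * (of_bool (r w) - p)) = 0"
      unfolding Er_def EE_bern_cov[OF finVv u(1)] using False by simp
    ultimately have "Er v (\<lambda>r. (Yr v r - mv v) * ((of_bool (r u) - p) * (of_bool (r w) - p)))
       = Er v (\<lambda>r. (of_bool (r u) - p) * ((of_bool (r w) - p) * Yr v r))" by (simp only: Er_diff Er_cmult mult_zero_right diff_0_right)
    then show ?thesis using Yr_cov2[OF v u False] False by simp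
  next
    case True
    \<comment> \<open>For a bit b, (b - p)^2 = p q + (1 - 2 p) (b - p); this reduces the diagonal to
      a first-order covariance.\<close>
    have "(\<lambda>r. (Yr v r - mv v) * ((of_bool (r u) - p) * (of_bool (r u) - p)))
      = (\<lambda>r. p * q * (Yr v r - mv v) + (1 - 2 * p) * ((of_bool (r u) - p) * Yr v r - mv v * (of_bool (r u) - p)))"
      by (simp add: fun_eq_iff q_def algebra_simps)
    moreover have "Er v (\<lambda>r. Yr v r - mv v) = 0" by (simp add: Er_diff Er_const Er_Yr)
    moreover have "Er v (\<lambda>r. of_bool (r u) - p) = 0"
      using EE_bern_cov[OF finVv u(1), of "\<lambda>_. 1"] by (simp add: Er_def)
    ultimately have e: "Er v (\<lambda>r. (Yr v r - mv v) * ((of_bool (r u) - p) * (of_bool (r u) - p)))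
      = (1 - 2 * p) * (p * q * (2 * real_of_int (x u) * pp {v,u} (kc v u)))"
      by (simp only: Er_add Er_cmult Er_diff[of v "\<lambda>r. (of_bool (r u) - p) * Yr v r"] Yr_cov1[OF v u(1)] mult_zero_right add_0 diff_0_right)
    have pb: "\<bar>pp {v,u} (kc v u)\<bar> \<le> 2 * ?h" using pp_pair_approx[of v u] v u P0_bounds e0_P0 unfolding abs_le_iff by auto
    have "\<bar>Er v (\<lambda>r. (Yr v r - mv v) * ((of_bool (r u) - p) * (of_bool (r u) - p)))\<bar> = \<bar>1 - 2 * p\<bar> * (p * q * (2 * \<bar>pp {v,u} (kc v u)\<bar>))"
      unfolding e abs_mult[of "1 - 2 * p"] abs_pq abs_mult[of "2 * real_of_int (x u)"] abs_mult[of 2] x_sq by simp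
    also have "\<dots> \<le> 1 * ((1/4) * (2 * (2 * ?h)))"
      using p pq pb by (intro mult_mono) (auto simp: abs_le_iff)
    finally show ?thesis using True e0_P0(1) by simp
  qed
  have pt: "\<bar>cc v f\<bar> \<le> e0 * (KN v f)\<^sup>2 + 2 * ?h * KN v f" for f
  proof -
    let ?k = "kk v f"
    have "(Yr v r - mv v) * (TT v f r)\<^sup>2 = (\<Sum>u\<in>V - {v}. \<Sum>w\<in>V - {v}. (?k u * ?k w) * ((Yr v r - mv v) * ((of_bool (r u) - p) * (of_bool (r w) - p))))" for r
      unfolding TT_def csum_def power2_eq_square unfolding sum_product unfolding sum_distrib_left
      by (intro sum.cong refl) (simp only: mult_ac)
    then have "cc v f = (\<Sum>u\<in>V - {v}. \<Sum>w\<in>V - {v}. (?k u * ?k w) * Er v (\<lambda>r. (Yr v r - mv v) * ((of_bool (r u) - p) * (of_bool (r w) - p))))"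
      unfolding cc_def by (simp only: Er_sum Er_cmult)
    then have "\<bar>cc v f\<bar> \<le> (\<Sum>u\<in>V - {v}. \<Sum>w\<in>V - {v}. (?k u * ?k w) * (e0 + of_bool (u = w) * (2 * ?h)))"
    proof (simp only:, intro order_trans[OF sum_abs] sum_mono)
      fix u w assume u: "u \<in> V - {v}" "w \<in> V - {v}"
      show "\<bar>(?k u * ?k w) * Er v (\<lambda>r. (Yr v r - mv v) * ((of_bool (r u) - p) * (of_bool (r w) - p)))\<bar> \<le> (?k u * ?k w) * (e0 + of_bool (u = w) * (2 * ?h))"
        unfolding abs_mult using pair[OF u] kk01(1)[of v f] by (intro mult_mono) (auto simp: abs_mult)
    qed
    also have "\<dots> = (\<Sum>u\<in>V - {v}. e0 * (?k u * KN v f) + 2 * ?h * ?k u)"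
    proof (rule sum.cong[OF refl])
      fix u assume u: "u \<in> V - {v}"
      have "(\<Sum>w\<in>V - {v}. (?k u * ?k w) * (of_bool (u = w) * (2 * ?h))) = (\<Sum>w\<in>V - {v}. if w = u then 2 * ?h * ?k u else 0)"
        using kk01(3)[of v f u] by (intro sum.cong) (auto simp: power2_eq_square)
      also have "\<dots> = 2 * ?h * ?k u" using u finV by simp
      finally have 1: "(\<Sum>w\<in>V - {v}. (?k u * ?k w) * (of_bool (u = w) * (2 * ?h))) = 2 * ?h * ?k u" .
      have 2: "(\<Sum>w\<in>V - {v}. (?k u * ?k w) * e0) = e0 * (?k u * KN v f)"
        unfolding KN_def sum_distrib_left by (intro sum.cong) auto
      show "(\<Sum>w\<in>V - {v}. (?k u * ?k w) * (e0 + of_bool (u = w) * (2 * ?h))) = e0 * (?k u * KN v f) + 2 * ?h * ?k u"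
        unfolding distrib_left sum.distrib 1 2 ..
    qed
    also have "\<dots> = e0 * (KN v f)\<^sup>2 + 2 * ?h * KN v f"
    proof -
      have "(\<Sum>u\<in>V - {v}. e0 * (?k u * KN v f) + 2 * ?h * ?k u) = e0 * ((\<Sum>u\<in>V - {v}. ?k u) * KN v f) + 2 * ?h * (\<Sum>u\<in>V - {v}. ?k u)"
        unfolding sum.distrib sum_distrib_left sum_distrib_right ..
      then show ?thesis unfolding KN_def[symmetric] power2_eq_square .
    qed
    finally show ?thesis .
  qed
  have "EE PP (\<lambda>f. \<bar>cc v f\<bar>) \<le> EE PP (\<lambda>f. e0 * (KN v f)\<^sup>2 + 2 * ?h * KN v f)" by (rule EE_mono[OF finite_set_PP]) (rule pt)
  also have "\<dots> = e0 * EE PP (\<lambda>f. (KN v f)\<^sup>2) + 2 * ?h * EE PP (KN v)" unfolding EE_add[OF finite_set_PP] by simp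
  also have "\<dots> \<le> nn (-2/3) * nn (1004/1000) + 2 * ?h * nn (502/1000)"
    using KN_moments[OF v] unfolding e0_def by (intro add_mono mult_left_mono) auto
  also have "\<dots> = nn (-2/3 + 1004/1000) + 2 * nn (-499/1000 + 502/1000)" unfolding nn_mult[symmetric] by simp
  also have "\<dots> \<le> nn (34/100) + 2 * nn (34/100)" by (intro add_mono mult_left_mono nn_mono) auto
  also have "\<dots> = 3 * nn (34/100)" by simp
  also have "\<dots> \<le> nn (35/100)" by (rule nn_absorb) auto
  finally show ?thesis .
qed

lemma mv_bound: assumes "v \<in> V" shows "\<bar>mv v\<bar> \<le> nn (-48/100)" "(mv v)\<^sup>2 \<le> nn (-96/100)" "\<bar>mv v\<bar> \<le> 1"
proof -
  have c: "\<bar>real_of_int (x v) + 2 * p * (real \<Delta> - x v)\<bar> \<le> 5 * nn (1/1000)"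
  proof -
    have "\<bar>2 * p * (real \<Delta> - x v)\<bar> \<le> 2 * 1 * (real \<Delta> + 1)"
      unfolding abs_mult using p x_sq(4)[of v] by (intro mult_mono) auto
    then have "\<bar>real_of_int (x v)\<bar> + \<bar>2 * p * (real \<Delta> - x v)\<bar> \<le> 5 * nn (1/1000)"
      unfolding x_sq using \<Delta>b nb by simp
    then show ?thesis by (rule order_trans[OF abs_triangle_ineq])
  qed
  have "\<bar>P0 * (x v + 2 * p * (real \<Delta> - x v))\<bar> \<le> nn (-499/1000) * (5 * nn (1/1000))"
    unfolding abs_mult using P0_bounds c by (intro mult_mono) auto
  also have "\<dots> = 5 * nn (-499/1000 + 1/1000)" unfolding nn_mult[symmetric] by simp
  finally have "\<bar>mv v\<bar> \<le> 5 * nn (-498/1000) + nn (-3/5)" using mv_approx[OF assms] by simp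
  also have "\<dots> \<le> 6 * nn (-49/100)" using nn_mono[of "-498/1000" "-49/100"] nn_mono[of "-3/5" "-49/100"] by simp
  also have "\<dots> \<le> nn (-48/100)" by (rule nn_absorb) auto
  finally show m: "\<bar>mv v\<bar> \<le> nn (-48/100)" .
  then have "\<bar>mv v\<bar>\<^sup>2 \<le> (nn (-48/100))\<^sup>2" by (intro power_mono) auto
  then show "(mv v)\<^sup>2 \<le> nn (-96/100)" by (simp add: nn_power)
  show "\<bar>mv v\<bar> \<le> 1" using m nn_mono[of "-48/100" 0] nn_1(2) by simp
qed

section \<open>Stein's identity for the surplus after one step\<close>

definition N :: real where "N = real (card V)"
definition sig :: real where "sig = sqrt N"
definition mu :: real where "mu = (\<Sum>v\<in>V. mv v)"

lemma N_bounds: "nn 1 \<le> N" "0 < N" "N \<le> 3 * nn 1"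
proof -
  show "nn 1 \<le> N" using cV_nn(2) nn_pos[of 1] unfolding N_def by linarith
  then show "0 < N" using nn_pos[of 1] by linarith
  show "N \<le> 3 * nn 1" using cV_nn unfolding N_def by simp
qed

lemma sig_bounds: "nn (1/2) \<le> sig" "0 < sig" "sig * sig = N" "1 / sig \<le> nn (-1/2)" "1 / N \<le> nn (-1)"
proof -
  show s: "nn (1/2) \<le> sig" unfolding sig_def using real_sqrt_le_mono[OF N_bounds(1)] unfolding nn_sqrt .
  show s0: "0 < sig" "sig * sig = N" unfolding sig_def using N_bounds by simp_all
  have "1 / sig \<le> 1 / nn (1/2)" using s s0 by (intro divide_left_mono) auto
  then show "1 / sig \<le> nn (-1/2)" using nn_divide[of 0 "1/2"] nn_1(2) by simp
  have "1 / N \<le> 1 / nn 1" using N_bounds by (intro divide_left_mono) auto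
  then show "1 / N \<le> nn (-1)" using nn_divide[of 0 1] nn_1(2) by simp
qed

definition dl where "dl v f r = (Yr v r + 2 * real_of_int (x v) * TT v f r) / sig"

lemma W_upd: "v \<in> V \<Longrightarrow> (S1 (upd v f r) - mu) / sig = (M v f - mu) / sig + dl v f r"
  unfolding S1_upd dl_def by (simp add: add_divide_distrib diff_divide_distrib)

text \<open>The leading term 1/sig, due to the square of a color being 1, is the source of E[g'(W)]:
  there are N = sig^2 vertices and W carries another factor 1/sig.\<close>

lemma dl_moment1: "Er v (\<lambda>r. (Yr v r - mv v) * dl v f r) = (1 - (mv v)\<^sup>2 + 2 * real_of_int (x v) * aa v f) / sig"
proof -
  have "(Yr v r - mv v) * dl v f r = (1/sig) * ((1 - mv v * Yr v r) + ((2 * real_of_int (x v)) * (Yr v r * TT v f r) - (2 * real_of_int (x v) * mv v) * TT v f r))" for r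
  proof -
    have "(Yr v r - mv v) * (Yr v r + 2 * real_of_int (x v) * TT v f r) = (Yr v r * Yr v r - mv v * Yr v r) + ((2 * real_of_int (x v)) * (Yr v r * TT v f r) - (2 * real_of_int (x v) * mv v) * TT v f r)"
      by (simp add: algebra_simps)
    then show ?thesis unfolding Yr_pm dl_def by simp
  qed
  then have "Er v (\<lambda>r. (Yr v r - mv v) * dl v f r) = (1/sig) * ((1 - mv v * mv v) + ((2 * real_of_int (x v)) * aa v f - (2 * real_of_int (x v) * mv v) * 0))"
    by (simp only: Er_add Er_diff Er_cmult Er_const Er_Yr TT_moments(1) aa_def)
  then show ?thesis by (simp add: power2_eq_square)
qed

lemma dl_moment2: "Er v (\<lambda>r. (Yr v r - mv v) * (dl v f r)\<^sup>2) = (4 * cc v f - 4 * real_of_int (x v) * (mv v * aa v f)) / N"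
proof -
  have "(Yr v r - mv v) * (dl v f r)\<^sup>2 = (1/N) * ((Yr v r - mv v) + ((4 * real_of_int (x v)) * (TT v f r - mv v * (Yr v r * TT v f r)) + 4 * ((Yr v r - mv v) * (TT v f r)\<^sup>2)))" for r
  proof -
    have Y: "Yr v r * Yr v r = 1" by (rule Yr_pm)
    have X: "real_of_int (x v) * real_of_int (x v) = 1" by (rule x_sq)
    have "(Yr v r + 2 * real_of_int (x v) * TT v f r)\<^sup>2 = Yr v r * Yr v r + 4 * real_of_int (x v) * (Yr v r * TT v f r) + 4 * (real_of_int (x v) * real_of_int (x v)) * (TT v f r)\<^sup>2"
      by (simp add: power2_eq_square algebra_simps)
    then have e: "(dl v f r)\<^sup>2 = (1/N) * (1 + 4 * real_of_int (x v) * (Yr v r * TT v f r) + 4 * (TT v f r)\<^sup>2)"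
      unfolding Y X dl_def power_divide using sig_bounds(3) by (simp add: power2_eq_square)
    have "(Yr v r - mv v) * (1 + 4 * real_of_int (x v) * (Yr v r * TT v f r) + 4 * (TT v f r)\<^sup>2)
      = (Yr v r - mv v) + ((4 * real_of_int (x v)) * ((Yr v r * Yr v r) * TT v f r - mv v * (Yr v r * TT v f r)) + 4 * ((Yr v r - mv v) * (TT v f r)\<^sup>2))"
      by (simp add: algebra_simps)
    then show ?thesis unfolding e Y by simp
  qed
  then have "Er v (\<lambda>r. (Yr v r - mv v) * (dl v f r)\<^sup>2) = (1/N) * ((mv v - mv v) + ((4 * real_of_int (x v)) * (0 - mv v * aa v f) + 4 * cc v f))"
    by (simp only: Er_add Er_diff Er_cmult Er_const Er_Yr TT_moments(1) aa_def cc_def)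
  moreover have "(1/N) * ((m - m) + ((4 * X) * (0 - m * a) + 4 * c)) = (4 * c - 4 * X * (m * a)) / N" for m X a c :: real
    using N_bounds(2) by (simp add: field_simps)
  ultimately show ?thesis by (simp only:)
qed

lemma dl_abs: "\<bar>dl v f r\<bar> \<le> (1 + 2 * \<bar>TT v f r\<bar>) / sig" "\<bar>dl v f r\<bar>^3 \<le> (4 + 32 * \<bar>TT v f r\<bar>^3) / (N * sig)"
proof -
  let ?t = "\<bar>TT v f r\<bar>"
  have "\<bar>Yr v r + 2 * real_of_int (x v) * TT v f r\<bar> \<le> \<bar>Yr v r\<bar> + \<bar>2 * real_of_int (x v) * TT v f r\<bar>" by (rule abs_triangle_ineq)
  also have "\<dots> = 1 + 2 * ?t" unfolding Yr_pm abs_mult x_sq by simp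
  finally show d: "\<bar>dl v f r\<bar> \<le> (1 + 2 * ?t) / sig"
    unfolding dl_def using sig_bounds(2) by (simp add: divide_right_mono)
  have "(1 + 2 * t)^3 \<le> 4 + 32 * t^3" if "t \<ge> 0" for t :: real
  proof -
    have "0 \<le> (1 + 2 * t) * (1 - 2 * t)\<^sup>2" using that by simp
    then show ?thesis by (simp add: power2_eq_square power3_eq_cube algebra_simps)
  qed
  then have b: "(1 + 2 * ?t)^3 \<le> 4 + 32 * ?t^3" by simp
  have "\<bar>dl v f r\<bar>^3 \<le> ((1 + 2 * ?t) / sig)^3" using d by (intro power_mono) auto
  also have "\<dots> = (1 + 2 * ?t)^3 / (N * sig)" unfolding power_divide sig_bounds(3)[symmetric] by (simp add: power3_eq_cube)
  also have "\<dots> \<le> (4 + 32 * ?t^3) / (N * sig)" using b N_bounds sig_bounds by (intro divide_right_mono) auto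
  finally show "\<bar>dl v f r\<bar>^3 \<le> (4 + 32 * ?t^3) / (N * sig)" .
qed

text \<open>Taylor expansion of g at \<open>w f\<close>, the value of W without the contribution of
  v, averaged against the centered color of v. Order 0 vanishes. Order 1 gives g'(w)/sig up to
  \<open>aa\<close>. Order 2 is governed by \<open>cc\<close>: without cancellation it would compare
  to E[TT^2] / N, of order n^(-1/2) like 1/sig itself. Order 3 is small by moments of
  \<open>TT\<close>. Finally g' is moved from w to W by its Lipschitz bound.\<close>

lemma stein_vertex:
  assumes v: "v \<in> V"
    and d: "\<And>y. (g has_real_derivative g1 y) (at y)" "\<And>y. (g1 has_real_derivative g2 y) (at y)" "\<And>y. (g2 has_real_derivative g3 y) (at y)"
    and L: "\<And>y. \<bar>g1 y\<bar> \<le> L" "\<And>y. \<bar>g2 y\<bar> \<le> L" "\<And>y. \<bar>g3 y\<bar> \<le> L"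
  shows "\<bar>EE PP (\<lambda>f. (Y f v - mv v) * g ((S1 f - mu) / sig)) - EE PP (\<lambda>f. g1 ((S1 f - mu) / sig)) / sig\<bar> \<le> L / sig * nn (-1/25)"
proof -
  define w where "w f = (M v f - mu) / sig" for f
  have L0: "0 \<le> L" using L(1)[of 0] by linarith
  let ?m = "mv v"
  let ?t1 = "\<lambda>f. Er v (\<lambda>r. \<bar>TT v f r\<bar>)" and ?t3 = "\<lambda>f. Er v (\<lambda>r. \<bar>TT v f r\<bar>^3)"
  let ?G = "\<lambda>f. ?m\<^sup>2 + 2 * \<bar>aa v f\<bar> + (2 * \<bar>aa v f\<bar> + 2 * \<bar>cc v f\<bar>) * (1/sig) + (8 + 64 * ?t3 f) * (1/N) + (1 + 2 * ?t1 f) * (1/sig)"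
  have mul: "\<bar>a * b\<bar> \<le> L * \<bar>b\<bar>" if "\<bar>a\<bar> \<le> L" for a b :: real
    unfolding abs_mult using that by (intro mult_right_mono) auto
  have pt: "\<bar>Er v (\<lambda>r. (Yr v r - ?m) * g (w f + dl v f r)) - Er v (\<lambda>r. g1 (w f + dl v f r)) / sig\<bar> \<le> L / sig * ?G f" for f
  proof -
    let ?R = "\<lambda>r. (Yr v r - ?m) * (g (w f + dl v f r) - (g (w f) + g1 (w f) * dl v f r + g2 (w f) * (dl v f r)\<^sup>2 / 2))"
    have "(Yr v r - ?m) * g (w f + dl v f r) = g (w f) * (Yr v r - ?m) + g1 (w f) * ((Yr v r - ?m) * dl v f r) + (g2 (w f) / 2) * ((Yr v r - ?m) * (dl v f r)\<^sup>2) + ?R r" for r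
    proof -
      have "y * G = G0 * y + G1 * (y * e) + (G2 / 2) * (y * e\<^sup>2) + y * (G - (G0 + G1 * e + G2 * e\<^sup>2 / 2))" for y G G0 G1 G2 e :: real
        by (simp add: field_simps)
      then show ?thesis .
    qed
    then have e: "Er v (\<lambda>r. (Yr v r - ?m) * g (w f + dl v f r)) = g (w f) * (?m - ?m) + g1 (w f) * ((1 - ?m\<^sup>2 + 2 * real_of_int (x v) * aa v f) / sig)
      + (g2 (w f) / 2) * ((4 * cc v f - 4 * real_of_int (x v) * (?m * aa v f)) / N) + Er v ?R"
      by (simp only: Er_add Er_cmult Er_diff Er_const Er_Yr dl_moment1 dl_moment2)
    have R: "\<bar>Er v ?R\<bar> \<le> L / sig * ((8 + 64 * ?t3 f) * (1/N))"
    proof -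
      have "\<bar>Er v ?R\<bar> \<le> Er v (\<lambda>r. (2 * L / (N * sig)) * (4 + 32 * \<bar>TT v f r\<bar>^3))"
      proof (rule Er_abs_le)
        fix r
        have y: "\<bar>Yr v r - ?m\<bar> \<le> 2" using mv_bound(3)[OF v] Yr_pm(1)[of v r] by linarith
        have "\<bar>?R r\<bar> \<le> 2 * (L * \<bar>dl v f r\<bar>^3)" unfolding abs_mult
          by (rule mult_mono[OF y taylor3[OF d L(3)]]) auto
        also have "\<dots> \<le> 2 * (L * ((4 + 32 * \<bar>TT v f r\<bar>^3) / (N * sig)))"
          using dl_abs(2) L0 by (intro mult_left_mono) auto
        finally show "\<bar>?R r\<bar> \<le> (2 * L / (N * sig)) * (4 + 32 * \<bar>TT v f r\<bar>^3)" by simp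
      qed
      also have "\<dots> = (2 * L / (N * sig)) * (4 + 32 * ?t3 f)" unfolding Er_cmult Er_add Er_const ..
      also have "\<dots> = L / sig * ((8 + 64 * ?t3 f) * (1/N))" by (simp add: field_simps)
      finally show ?thesis .
    qed
    have a1: "\<bar>- ?m\<^sup>2 + 2 * real_of_int (x v) * aa v f\<bar> \<le> ?m\<^sup>2 + 2 * \<bar>aa v f\<bar>"
      by (rule order_trans[OF abs_triangle_ineq]) (simp add: abs_mult x_sq)
    have a2: "\<bar>4 * cc v f - 4 * real_of_int (x v) * (?m * aa v f)\<bar> \<le> 4 * \<bar>aa v f\<bar> + 4 * \<bar>cc v f\<bar>"
    proof -
      have "\<bar>?m * aa v f\<bar> \<le> 1 * \<bar>aa v f\<bar>" unfolding abs_mult using mv_bound(3)[OF v] by (intro mult_right_mono) auto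
      then have "\<bar>4 * real_of_int (x v) * (?m * aa v f)\<bar> \<le> 4 * \<bar>aa v f\<bar>" unfolding abs_mult[of "4 * real_of_int (x v)"] abs_mult[of 4] x_sq by simp
      then show ?thesis using abs_triangle_ineq4[of "4 * cc v f" "4 * real_of_int (x v) * (?m * aa v f)"] by (simp add: abs_mult)
    qed
    have T1: "\<bar>g1 (w f) * ((- ?m\<^sup>2 + 2 * real_of_int (x v) * aa v f) / sig)\<bar> \<le> L / sig * (?m\<^sup>2 + 2 * \<bar>aa v f\<bar>)"
    proof -
      have "\<bar>(- ?m\<^sup>2 + 2 * real_of_int (x v) * aa v f) / sig\<bar> \<le> (?m\<^sup>2 + 2 * \<bar>aa v f\<bar>) / sig"
        using a1 sig_bounds(2) by (simp only: abs_divide abs_of_pos) (rule divide_right_mono, auto)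
      then have "L * \<bar>(- ?m\<^sup>2 + 2 * real_of_int (x v) * aa v f) / sig\<bar> \<le> L * ((?m\<^sup>2 + 2 * \<bar>aa v f\<bar>) / sig)"
        using L0 by (rule mult_left_mono)
      moreover have "L * ((?m\<^sup>2 + 2 * \<bar>aa v f\<bar>) / sig) = L / sig * (?m\<^sup>2 + 2 * \<bar>aa v f\<bar>)" by simp
      ultimately show ?thesis using mul[OF L(1)[of "w f"], of "(- ?m\<^sup>2 + 2 * real_of_int (x v) * aa v f) / sig"] by linarith
    qed
    have T2: "\<bar>(g2 (w f) / 2) * ((4 * cc v f - 4 * real_of_int (x v) * (?m * aa v f)) / N)\<bar> \<le> L / sig * ((2 * \<bar>aa v f\<bar> + 2 * \<bar>cc v f\<bar>) * (1/sig))"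
    proof -
      have "\<bar>(g2 (w f) / 2) * ((4 * cc v f - 4 * real_of_int (x v) * (?m * aa v f)) / N)\<bar> = \<bar>g2 (w f)\<bar> * (\<bar>4 * cc v f - 4 * real_of_int (x v) * (?m * aa v f)\<bar> / (2 * N))"
        using N_bounds(2) by (simp add: abs_mult)
      also have "\<dots> \<le> L * ((4 * \<bar>aa v f\<bar> + 4 * \<bar>cc v f\<bar>) / (2 * N))"
        using L(2) a2 N_bounds(2) L0 by (intro mult_mono divide_right_mono) auto
      also have "\<dots> = L / sig * ((2 * \<bar>aa v f\<bar> + 2 * \<bar>cc v f\<bar>) * (1/sig))"
        unfolding sig_bounds(3)[symmetric] by (simp add: add_divide_distrib distrib_left)
      finally show ?thesis .
    qed
    have T3: "\<bar>g1 (w f) / sig - Er v (\<lambda>r. g1 (w f + dl v f r)) / sig\<bar> \<le> L / sig * ((1 + 2 * ?t1 f) * (1/sig))"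
    proof -
      have lip: "\<bar>g1 a - g1 b\<bar> \<le> L * \<bar>a - b\<bar>" for a b
        using field_differentiable_bound[of UNIV g1 g2 L a b] d(2) L(2) by auto
      have "\<bar>Er v (\<lambda>r. g1 (w f) - g1 (w f + dl v f r))\<bar> \<le> Er v (\<lambda>r. (L / sig) * (1 + 2 * \<bar>TT v f r\<bar>))"
      proof (rule Er_abs_le)
        fix r
        have "\<bar>g1 (w f) - g1 (w f + dl v f r)\<bar> \<le> L * \<bar>dl v f r\<bar>" using lip[of "w f" "w f + dl v f r"] by simp
        also have "\<dots> \<le> L * ((1 + 2 * \<bar>TT v f r\<bar>) / sig)" using dl_abs(1) L0 by (intro mult_left_mono) auto
        finally show "\<bar>g1 (w f) - g1 (w f + dl v f r)\<bar> \<le> (L / sig) * (1 + 2 * \<bar>TT v f r\<bar>)" by simp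
      qed
      then have "\<bar>g1 (w f) - Er v (\<lambda>r. g1 (w f + dl v f r))\<bar> \<le> (L / sig) * (1 + 2 * ?t1 f)"
        unfolding Er_cmult Er_add Er_const Er_diff .
      then have "\<bar>g1 (w f) - Er v (\<lambda>r. g1 (w f + dl v f r))\<bar> / sig \<le> (L / sig) * (1 + 2 * ?t1 f) / sig"
        using sig_bounds(2) by (intro divide_right_mono) auto
      then show ?thesis using sig_bounds(2) by (simp add: diff_divide_distrib[symmetric])
    qed
    have split: "g1 (w f) * ((1 - ?m\<^sup>2 + 2 * real_of_int (x v) * aa v f) / sig) = g1 (w f) / sig + g1 (w f) * ((- ?m\<^sup>2 + 2 * real_of_int (x v) * aa v f) / sig)"
      by (simp add: add_divide_distrib diff_divide_distrib algebra_simps)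
    have "L / sig * ?G f = L / sig * (?m\<^sup>2 + 2 * \<bar>aa v f\<bar>) + L / sig * ((2 * \<bar>aa v f\<bar> + 2 * \<bar>cc v f\<bar>) * (1/sig))
       + L / sig * ((8 + 64 * ?t3 f) * (1/N)) + L / sig * ((1 + 2 * ?t1 f) * (1/sig))"
      by (simp only: distrib_left)
    moreover have "\<bar>z * (m - m) + (c + a) + b + R - d\<bar> \<le> B" if "B = b1 + b2 + r + b3" "\<bar>R\<bar> \<le> r" "\<bar>a\<bar> \<le> b1" "\<bar>b\<bar> \<le> b2" "\<bar>c - d\<bar> \<le> b3"
      for z m a b c d R B b1 b2 b3 r :: real
      unfolding diff_self mult_zero_right using that by linarith
    ultimately show ?thesis unfolding e split using R T1 T2 T3 by blast
  qed
  have eq: "EE PP (\<lambda>f. (Y f v - ?m) * g ((S1 f - mu) / sig)) - EE PP (\<lambda>f. g1 ((S1 f - mu) / sig)) / sig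
    = EE PP (\<lambda>f. Er v (\<lambda>r. (Yr v r - ?m) * g (w f + dl v f r)) - Er v (\<lambda>r. g1 (w f + dl v f r)) / sig)"
  proof -
    have 1: "EE PP (\<lambda>f. (Y f v - ?m) * g ((S1 f - mu) / sig)) = EE PP (\<lambda>f. Er v (\<lambda>r. (Yr v r - ?m) * g (w f + dl v f r)))"
      by (subst resampleE[OF v]) (simp only: Y_upd_self[OF v] W_upd[OF v] w_def)
    have 2: "EE PP (\<lambda>f. g1 ((S1 f - mu) / sig)) = EE PP (\<lambda>f. Er v (\<lambda>r. g1 (w f + dl v f r)))"
      by (subst resampleE[OF v]) (simp only: W_upd[OF v] w_def)
    show ?thesis unfolding 1 2 EE_diff[OF finite_set_PP] by simp
  qed
  have "\<bar>EE PP (\<lambda>f. (Y f v - ?m) * g ((S1 f - mu) / sig)) - EE PP (\<lambda>f. g1 ((S1 f - mu) / sig)) / sig\<bar> \<le> EE PP (\<lambda>f. L / sig * ?G f)"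
    unfolding eq by (rule EE_abs_le[OF finite_set_PP]) (rule pt)
  moreover have "EE PP (\<lambda>f. L / sig * ?G f) = L / sig * EE PP ?G" by (rule integral_mult_right_zero)
  moreover have "EE PP ?G = ?m\<^sup>2 + 2 * EE PP (\<lambda>f. \<bar>aa v f\<bar>) + (2 * EE PP (\<lambda>f. \<bar>aa v f\<bar>) + 2 * EE PP (\<lambda>f. \<bar>cc v f\<bar>)) * (1/sig)
      + (8 + 64 * EE PP ?t3) * (1/N) + (1 + 2 * EE PP ?t1) * (1/sig)"
    unfolding EE_add[OF finite_set_PP] integral_mult_left_zero integral_mult_right_zero by simp
  moreover have "L / sig * (?m\<^sup>2 + 2 * EE PP (\<lambda>f. \<bar>aa v f\<bar>) + (2 * EE PP (\<lambda>f. \<bar>aa v f\<bar>) + 2 * EE PP (\<lambda>f. \<bar>cc v f\<bar>)) * (1/sig)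
      + (8 + 64 * EE PP ?t3) * (1/N) + (1 + 2 * EE PP ?t1) * (1/sig)) \<le> L / sig * nn (-1/25)"
  proof (rule mult_left_mono)
    let ?a = "nn (-1/20)"
    have s: "0 \<le> 1/sig" "1/sig \<le> nn (-1/2)" "0 \<le> 1/N" "1/N \<le> nn (-1)" using sig_bounds N_bounds by auto
    have tn: "0 \<le> EE PP ?t1" "0 \<le> EE PP ?t3" by (auto intro!: integral_nonneg_AE AE_pmfI Er_nonneg)
    have b1: "?m\<^sup>2 \<le> ?a" using mv_bound(2)[OF v] nn_mono[of "-96/100" "-1/20"] by simp
    have b3: "(2 * EE PP (\<lambda>f. \<bar>aa v f\<bar>) + 2 * EE PP (\<lambda>f. \<bar>cc v f\<bar>)) * (1/sig) \<le> 4 * ?a"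
    proof -
      have "(2 * EE PP (\<lambda>f. \<bar>aa v f\<bar>) + 2 * EE PP (\<lambda>f. \<bar>cc v f\<bar>)) * (1/sig) \<le> (2 * nn (35/100) + 2 * nn (35/100)) * nn (-1/2)"
        using aa_L1[OF v] cc_L1[OF v] nn_mono[of "-1/20" "35/100"] s by (intro mult_mono add_mono) auto
      also have "\<dots> = 4 * nn (35/100 + -1/2)" unfolding nn_mult[symmetric] by simp
      also have "\<dots> \<le> 4 * ?a" by (intro mult_left_mono nn_mono) auto
      finally show ?thesis .
    qed
    have b4: "(8 + 64 * EE PP ?t3) * (1/N) \<le> 136 * ?a"
    proof -
      have "(8 + 64 * EE PP ?t3) * (1/N) \<le> (8 * nn (753/1000) + 64 * (2 * nn (753/1000))) * nn (-1)"
        using TT_abs_moments(2)[OF v] nn_mono[of 0 "753/1000"] nn_1(2) s tn by (intro mult_mono add_mono) auto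
      also have "\<dots> = 136 * nn (753/1000 + -1)" unfolding nn_mult[symmetric] by simp
      also have "\<dots> \<le> 136 * ?a" by (intro mult_left_mono nn_mono) auto
      finally show ?thesis .
    qed
    have b5: "(1 + 2 * EE PP ?t1) * (1/sig) \<le> 3 * ?a"
    proof -
      have "(1 + 2 * EE PP ?t1) * (1/sig) \<le> (nn (251/1000) + 2 * nn (251/1000)) * nn (-1/2)"
        using TT_abs_moments(1)[OF v] nn_mono[of 0 "251/1000"] nn_1(2) s tn by (intro mult_mono add_mono) auto
      also have "\<dots> = 3 * nn (251/1000 + -1/2)" unfolding nn_mult[symmetric] by simp
      also have "\<dots> \<le> 3 * ?a" by (intro mult_left_mono nn_mono) auto
      finally show ?thesis .
    qed
    have "146 * ?a \<le> nn (-1/25)" by (rule nn_absorb) auto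
    then show "?m\<^sup>2 + 2 * EE PP (\<lambda>f. \<bar>aa v f\<bar>) + (2 * EE PP (\<lambda>f. \<bar>aa v f\<bar>) + 2 * EE PP (\<lambda>f. \<bar>cc v f\<bar>)) * (1/sig)
      + (8 + 64 * EE PP ?t3) * (1/N) + (1 + 2 * EE PP ?t1) * (1/sig) \<le> nn (-1/25)"
      using b1 b3 b4 b5 aa_L1[OF v] by linarith
    show "0 \<le> L / sig" using L0 sig_bounds(2) by simp
  qed
  ultimately show ?thesis by (simp only:)
qed

text \<open>N vertex errors of size L n^(-1/25) / sig and the normalisation 1/sig combine to L
  n^(-1/25).\<close>

lemma stein_S1: "stein_bound PP (\<lambda>f. (S1 f - mu) / sig) (nn (-1/25))"
  unfolding stein_bound_def
proof (intro allI impI)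
  fix g g1 g2 g3 :: "real \<Rightarrow> real" and L
  assume d: "\<forall>y. (g has_real_derivative g1 y) (at y)" "\<forall>y. (g1 has_real_derivative g2 y) (at y)" "\<forall>y. (g2 has_real_derivative g3 y) (at y)"
    and L: "\<forall>y. \<bar>g y\<bar> \<le> L \<and> \<bar>g1 y\<bar> \<le> L \<and> \<bar>g2 y\<bar> \<le> L \<and> \<bar>g3 y\<bar> \<le> L"
  let ?W = "\<lambda>f. (S1 f - mu) / sig"
  let ?d = "\<lambda>v. EE PP (\<lambda>f. (Y f v - mv v) * g (?W f)) - EE PP (\<lambda>f. g1 (?W f)) / sig"
  have b: "\<bar>?d v\<bar> \<le> L / sig * nn (-1/25)" if "v \<in> V" for v
    by (rule stein_vertex[OF that, of g g1 g2 g3 L]) (use d L in auto)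
  have "?W f * g (?W f) = (1/sig) * (\<Sum>v\<in>V. (Y f v - mv v) * g (?W f))" for f
    unfolding sum_distrib_right[symmetric] sum_subtractf S1_def[symmetric] mu_def[symmetric] by simp
  then have 1: "EE PP (\<lambda>f. ?W f * g (?W f)) = (1/sig) * (\<Sum>v\<in>V. EE PP (\<lambda>f. (Y f v - mv v) * g (?W f)))"
    by (simp only: integral_mult_right_zero EE_sum[OF finite_set_PP])
  have 2: "EE PP (\<lambda>f. g1 (?W f)) = (1/sig) * (\<Sum>v\<in>V. EE PP (\<lambda>f. g1 (?W f)) / sig)"
    using sig_bounds(2,3) N_bounds(2) unfolding N_def by (simp add: field_simps)
  have e: "EE PP (\<lambda>f. ?W f * g (?W f)) - EE PP (\<lambda>f. g1 (?W f)) = (1/sig) * (\<Sum>v\<in>V. ?d v)"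
    unfolding sum_subtractf right_diff_distrib 1[symmetric] 2[symmetric] ..
  have "\<bar>\<Sum>v\<in>V. ?d v\<bar> \<le> (\<Sum>v\<in>V. L / sig * nn (-1/25))" by (rule order_trans[OF sum_abs sum_mono]) (rule b)
  also have "\<dots> = N * (L / sig * nn (-1/25))" unfolding N_def by simp
  finally have "\<bar>(1/sig) * (\<Sum>v\<in>V. ?d v)\<bar> \<le> (1/sig) * (N * (L / sig * nn (-1/25)))"
    unfolding abs_mult using sig_bounds(2) by (intro mult_mono) auto
  also have "\<dots> = L * nn (-1/25)" unfolding sig_bounds(3)[symmetric] using sig_bounds(2) by simp
  finally show "\<bar>EE PP (\<lambda>f. ?W f * g (?W f)) - EE PP (\<lambda>f. g1 (?W f))\<bar> \<le> L * nn (-1/25)" unfolding e .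
qed

lemma clt_S1: "\<bar>measure_pmf.prob PP {f. S1 f \<le> z} - Phi ((z - mu) / sig)\<bar> \<le> 7 * nn (-1/400)"
proof -
  have "\<bar>measure_pmf.prob PP {f. (S1 f - mu) / sig \<le> (z - mu) / sig} - Phi ((z - mu) / sig)\<bar> \<le> 7 * nn (-1/25) powr (1/16)"
    by (rule stein_kolmogorov[OF finite_set_PP stein_S1]) (use nn_mono[of "-1/25" 0] nn_1 in auto)
  moreover have "(S1 f - mu) / sig \<le> (z - mu) / sig \<longleftrightarrow> S1 f \<le> z" for f
    using sig_bounds(2) by (simp add: divide_le_cancel)
  moreover have "nn (-1/25) powr (1/16) = nn (-1/400)" by (simp add: nn powr_powr)
  ultimately show ?thesis by simp
qed

end

section \<open>The second step\<close>

context majority begin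

lemma DX_split:
  assumes "v \<in> V" "u \<noteq> v"
  shows "DX {} f u = DX {v} f u + x v * of_bool (f {v,u})"
proof -
  have "V - insert u {} = insert v (V - insert u {v})" using assms by auto
  then have "DX {} f u = x v * of_bool (f {u,v}) + DX {v} f u"
    unfolding DX_def using finV by (simp del: sum_mult_of_bool_eq)
  then show ?thesis by (simp add: insert_commute)
qed

lemma Y_split:
  assumes "v \<in> V" "u \<noteq> v"
  shows "Y f u = Y0 v f u + 2 * real_of_int (x v) * kk v f u * of_bool (f {v,u})"
proof (cases "f {v,u}")
  case True
  have "2 * (DX {v} f u + x v) + x u = (2 * DX {v} f u + x u) + 2 * x v" by simp
  moreover have "sg (real_of_int ((2 * DX {v} f u + x u) + 2 * x v)) = sg (real_of_int (2 * DX {v} f u + x u)) + 2 * real_of_int (x v) * kk v f u"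
    using sg_flip[of "2 * DX {v} f u + x u" "x v"] x_sq(5)[of u] x_cases[of v] unfolding kk_def by simp
  moreover have "DX {} f u = DX {v} f u + x v" using DX_split[OF assms] True by simp
  ultimately show ?thesis using True unfolding Y_def Y0_def by (simp only: of_bool_eq mult_1_right)
qed (use DX_split[OF assms, of f] in \<open>simp add: Y_def Y0_def\<close>)

text \<open>The color of u at time 1 with the edge uv present, as \<open>Y0\<close> is with it
  absent. It is the color that v sees if u is a neighbor, and it is determined by the graph without
  v.\<close>

definition yy where "yy v f u = Y0 v f u + 2 * real_of_int (x v) * kk v f u"

lemma yy_pm: "yy v f u = 1 \<or> yy v f u = -1"
proof -
  have "yy v f u = sg (real_of_int ((2 * DX {v} f u + x u) + 2 * x v))"
    using sg_flip[of "2 * DX {v} f u + x u" "x v"] x_sq(5)[of u] x_cases[of v] unfolding yy_def kk_def Y0_def by simp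
  then show ?thesis by (auto simp: sg_def)
qed

text \<open>
  \<open>HH v f w\<close> is \<open>D1 f w\<close> with the edges at \<open>v\<close> replaced by their expectation, so \<open>Yt v f w\<close> predicts the color of \<open>w\<close> at
  time 2 from the graph without \<open>v\<close>; the prediction can fail only if \<open>D1 f w\<close> is small.
\<close>

definition D1 where "D1 f w = (\<Sum>u\<in>V - {w}. of_bool (f {w,u}) * Y f u)"
definition Y2 where "Y2 f w = sg (2 * D1 f w + Y f w)"
definition S2 where "S2 f = (\<Sum>w\<in>V. Y2 f w)"
definition D2 where "D2 f w = (\<Sum>u\<in>V - {w}. of_bool (f {w,u}) * Y2 f u)"
definition Y3 where "Y3 f w = sg (2 * D2 f w + Y2 f w)"
definition ck :: "'a \<Rightarrow> ('a set \<Rightarrow> bool) \<Rightarrow> 'a \<Rightarrow> 'a \<Rightarrow> real" where "ck v f w u = (if u = w then 0 else of_bool (f {w,u}) * kk v f u)"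
definition HH where "HH v f w = (\<Sum>u\<in>V - {v,w}. of_bool (f {w,u}) * (Y0 v f u + 2 * real_of_int (x v) * p * kk v f u))"
definition row :: "'a \<Rightarrow> ('a set \<Rightarrow> bool) \<Rightarrow> 'a \<Rightarrow> bool" where "row v f u = f {v,u}"
definition cs where "cs v f w r = csum (ck v f w) (V - {v}) r"
definition Yt where "Yt v f w = sg (HH v f w)"

text \<open>A non-neighbor contributes nothing and a neighbor shows \<open>yy\<close>. So, given the
  graph without w, this is a sum of independent bits with fixed signs, although the colors
  \<open>Y\<close> themselves depend on the edges at w.\<close>

lemma D1_self: "w \<in> V \<Longrightarrow> D1 f w = (\<Sum>u\<in>V - {w}. yy w f u * of_bool (row w f u))"
  unfolding D1_def row_def by (rule sum.cong) (auto simp: Y_split[of w] yy_def)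

text \<open>The edges at v reach w only through neighbors of w that are pivotal for v, a centered
  sum over about sqrt n vertices and thus of size n^(1/4), and through the color of v
  itself.\<close>

lemma D1_other:
  assumes "v \<in> V" "w \<in> V" "v \<noteq> w"
  shows "D1 f w = HH v f w + 2 * real_of_int (x v) * cs v f w (row v f) + of_bool (f {v,w}) * Y f v"
proof -
  have e: "V - {w} = insert v (V - {v,w})" using assms by auto
  have "D1 f w = of_bool (f {w,v}) * Y f v + (\<Sum>u\<in>V - {v,w}. of_bool (f {w,u}) * Y f u)"
    unfolding D1_def e using finV by (subst sum.insert) auto
  also have "(\<Sum>u\<in>V - {v,w}. of_bool (f {w,u}) * Y f u) = (\<Sum>u\<in>V - {v,w}. of_bool (f {w,u}) * (Y0 v f u + 2 * real_of_int (x v) * p * kk v f u)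
     + 2 * real_of_int (x v) * (ck v f w u * (of_bool (f {v,u}) - p)))"
    by (rule sum.cong) (auto simp: Y_split[OF assms(1)] ck_def algebra_simps)
  also have "\<dots> = HH v f w + 2 * real_of_int (x v) * (\<Sum>u\<in>V - {v,w}. ck v f w u * (of_bool (f {v,u}) - p))"
    unfolding sum.distrib HH_def sum_distrib_left ..
  also have "(\<Sum>u\<in>V - {v,w}. ck v f w u * (of_bool (f {v,u}) - p)) = cs v f w (row v f)"
  proof -
    have "V - {v} = insert w (V - {v,w})" using assms by auto
    then show ?thesis unfolding cs_def csum_def row_def using finV by (simp add: ck_def)
  qed
  finally show ?thesis by (simp add: insert_commute)
qed

lemma Y0_inv: "u \<noteq> v \<Longrightarrow> Y0 v (upd v f r) u = Y0 v f u"
  unfolding Y0_def by (subst DX_upd_in) auto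
lemma kk_inv: "u \<noteq> v \<Longrightarrow> kk v (upd v f r) u = kk v f u"
  unfolding kk_def by (subst DX_upd_in) auto
lemma yy_inv: "u \<noteq> v \<Longrightarrow> yy v (upd v f r) u = yy v f u"
  unfolding yy_def by (simp add: Y0_inv kk_inv)
lemma KN_inv: "KN v (upd v f r) = KN v f"
  unfolding KN_def by (rule sum.cong) (auto simp: kk_inv)
lemma HH_inv: "w \<noteq> v \<Longrightarrow> HH v (upd v f r) w = HH v f w"
  unfolding HH_def by (rule sum.cong) (auto simp: kk_inv Y0_inv upd_off)
lemma Yt_inv: "w \<noteq> v \<Longrightarrow> Yt v (upd v f r) w = Yt v f w"
  unfolding Yt_def by (simp add: HH_inv)
lemma ck_inv: "w \<noteq> v \<Longrightarrow> u \<noteq> v \<Longrightarrow> ck v (upd v f r) w u = ck v f w u"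
  unfolding ck_def by (simp add: kk_inv upd_off)
lemma row_upd: "v \<in> V \<Longrightarrow> u \<in> V - {v} \<Longrightarrow> row v (upd v f r) u = r u"
  unfolding row_def by (rule upd_at)
lemma cs_inv:
  assumes "v \<in> V" "w \<noteq> v" shows "cs v (upd v f r) w (row v (upd v f r)) = cs v f w r"
  unfolding cs_def csum_def by (rule sum.cong) (use assms in \<open>auto simp: ck_inv row_upd\<close>)
lemma D1_upd_self:
  assumes "w \<in> V" shows "D1 (upd w f r) w = (\<Sum>u\<in>V - {w}. yy w f u * of_bool (r u))"
  unfolding D1_self[OF assms] by (rule sum.cong) (use assms in \<open>auto simp: yy_inv row_upd\<close>)

lemma sum_ck_sq: "(\<Sum>u\<in>V - {v}. (ck v f w u)\<^sup>2) \<le> KN v f"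
  unfolding sum_kk_sq[symmetric] by (rule sum_mono) (auto simp: ck_def)

text \<open>\<open>HH\<close> and \<open>D1\<close> differ by at most t/4 + 1, less than t, so they
  have the same sign once |D1| exceeds t; the tie-breaking term cannot change that sign
  either.\<close>

lemma Y2_eq_Yt:
  assumes "v \<in> V" "w \<in> V" "v \<noteq> w" "\<bar>D1 f w\<bar> > t" "t \<ge> 4" "\<bar>cs v f w (row v f)\<bar> \<le> t / 8"
  shows "Y2 f w = Yt v f w"
proof -
  let ?c = "2 * real_of_int (x v) * cs v f w (row v f)"
  have "\<bar>?c\<bar> = 2 * \<bar>cs v f w (row v f)\<bar>" unfolding abs_mult x_sq by simp
  then have c: "\<bar>?c\<bar> \<le> t / 4" using assms(6) by linarith
  have b: "\<bar>of_bool (f {v,w}) * Y f v\<bar> \<le> 1" using Y_pm(1)[of f v] by (simp add: abs_mult)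
  have D: "D1 f w = HH v f w + ?c + of_bool (f {v,w}) * Y f v" by (rule D1_other[OF assms(1-3)])
  have yp: "\<bar>Y f w\<bar> \<le> 1" using Y_pm(1)[of f w] by simp
  have *: "(0 < 2 * d + y) = (0 < h)" if "d = h + c + b" "\<bar>c\<bar> \<le> t/4" "\<bar>b\<bar> \<le> 1" "\<bar>y\<bar> \<le> 1" "\<bar>d\<bar> > t" for d h c b y :: real
    using that assms(5) by linarith
  have "(0 < 2 * D1 f w + Y f w) = (0 < HH v f w)" by (rule *[OF D c b yp assms(4)])
  then show ?thesis unfolding Y2_def Yt_def sg_def by simp
qed

lemma Y2_pm: "\<bar>Y2 f w\<bar> = 1" "Y2 f w = 1 \<or> Y2 f w = -1" by (auto simp: Y2_def sg_simps sg_def)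
lemma Yt_pm: "\<bar>Yt v f w\<bar> = 1" "(Yt v f w)\<^sup>2 = 1" by (auto simp: Yt_def sg_simps)

end

context regime begin

section \<open>Conditional law of a color at time 2\<close>

definition ss :: real where "ss = sqrt ((N - 1) * (p * q))"
text \<open>The mean sign of a normal variable with mean p s and standard deviation
  \<open>ss\<close>: the approximate mean color of a vertex that would see the surplus s if it were
  joined to every other vertex.\<close>

definition Th :: "real \<Rightarrow> real" where "Th s = 2 * Phi (p * s / ss) - 1"

lemma N_minus_1_bounds: "nn 1 \<le> N - 1" "N - 1 \<le> 3 * nn 1"
proof -
  have "nn 0 \<le> nn 1" by (rule nn_mono) simp
  then show "nn 1 \<le> N - 1" using cV_nn(2) nn_1(2) unfolding N_def by linarith
  show "N - 1 \<le> 3 * nn 1" using N_bounds(3) by linarith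
qed

lemma row_variance_lower: "nn (999/1000) \<le> (N - 1) * (p * q)" using pq_mono[of 1 1 "N - 1"] N_minus_1_bounds by simp

lemma ss_bounds: "nn (4995/10000) \<le> ss" "0 < ss" "1 / ss \<le> nn (-499/1000)" "ss \<le> 2 * nn (1/2)"
proof -
  show s: "nn (4995/10000) \<le> ss" unfolding ss_def using real_sqrt_le_mono[OF row_variance_lower] unfolding nn_sqrt by simp
  then show s0: "0 < ss" using nn_pos[of "4995/10000"] by linarith
  have "1 / ss \<le> 1 / nn (4995/10000)" using s s0 by (intro divide_left_mono) auto
  also have "\<dots> = nn (-4995/10000)" using nn_divide[of 0 "4995/10000"] nn_1(2) by simp
  also have "\<dots> \<le> nn (-499/1000)" by (rule nn_mono) simp
  finally show "1 / ss \<le> nn (-499/1000)" .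
  have "(N - 1) * (p * q) \<le> (3 * nn 1) * 1" using N_minus_1_bounds pq nn_pos[of 1] by (intro mult_mono) auto
  then have "ss \<le> sqrt (4 * nn 1)" unfolding ss_def by (intro real_sqrt_le_mono) (use nn_pos[of 1] in linarith)
  then show "ss \<le> 2 * nn (1/2)" unfolding real_sqrt_mult nn_sqrt by simp
qed

definition s2 where "s2 w f = (\<Sum>u\<in>V - {w}. yy w f u)"

text \<open>\<open>M\<close> averages over the edges at w, while \<open>s2\<close> has all of them
  present, so each pivotal vertex counts 2 q more in favor of the initial color of w. The gap is
  typically of order sqrt n up to powers of p and q and cannot be dropped.\<close>

lemma s2_M: "s2 w f = M w f + 2 * real_of_int (x w) * q * KN w f"
  unfolding s2_def yy_def M_def KN_def sum.distrib sum_distrib_left[symmetric] by (simp add: q_def algebra_simps)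

lemma D1_row_cdf:
  assumes w: "w \<in> V"
  shows "\<bar>Er w (\<lambda>r. of_bool (D1 (upd w f r) w \<le> z)) - Phi ((z - p * s2 w f) / ss)\<bar> \<le> nn (-3/100)"
proof -
  have c: "real (card (V - {w})) = N - 1" using card_row[OF w] by (simp add: N_def)
  have m1: "1 \<le> real (card (V - {w})) * (p * q)" unfolding c using row_variance_lower nn_mono[of 0 "999/1000"] nn_1(2) by simp
  have "\<bar>measure_pmf.prob (bern p (V - {w})) {r. (\<Sum>u\<in>V - {w}. yy w f u * of_bool (r u)) \<le> z}
     - Phi ((z - p * s2 w f) / ss)\<bar> \<le> 7 * ((N - 1) * (p * q)) powr (-1/32)"
    using signed_sum_cdf[OF finVv[of w] _ m1, of "yy w f" z] yy_pm unfolding c ss_def s2_def by blast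
  moreover have "7 * ((N - 1) * (p * q)) powr (-1/32) \<le> nn (-3/100)"
  proof -
    have "((N - 1) * (p * q)) powr (-1/32) \<le> nn (999/1000) powr (-1/32)" using row_variance_lower by (intro powr_mono2') auto
    also have "\<dots> = nn (-999/32000)" by (simp add: nn powr_powr)
    finally have "7 * ((N - 1) * (p * q)) powr (-1/32) \<le> 7 * nn (-999/32000)" by simp
    also have "\<dots> \<le> nn (-3/100)" by (rule nn_absorb) auto
    finally show ?thesis .
  qed
  moreover have "Er w (\<lambda>r. of_bool (D1 (upd w f r) w \<le> z)) = measure_pmf.prob (bern p (V - {w})) {r. (\<Sum>u\<in>V - {w}. yy w f u * of_bool (r u)) \<le> z}"
    unfolding Er_def EE_prob D1_upd_self[OF w] mem_Collect_eq ..
  ultimately show ?thesis by linarith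
qed

text \<open>Between n^(1/4), the influence of one row on \<open>D1\<close>, and n^(1/2), the spread
  of \<open>D1\<close>.\<close>

definition tau :: real where "tau = nn (3/10)"

lemma tau4: "4 \<le> tau" using nn_absorb[of 4 0 "3/10"] nn_1(2) by (simp add: tau_def)

lemma D1_anticoncentration: assumes w: "w \<in> V" shows "EE PP (\<lambda>f. of_bool (\<bar>D1 f w\<bar> \<le> tau)) \<le> nn (-29/1000)"
proof -
  have pt: "Er w (\<lambda>r. of_bool (\<bar>D1 (upd w f r) w\<bar> \<le> tau)) \<le> nn (-29/1000)" for f
  proof -
    \<comment> \<open>Subtracting the distribution function at - tau would lose the point - tau; one
      unit further down keeps it.\<close>
    have "Er w (\<lambda>r. of_bool (\<bar>D1 (upd w f r) w\<bar> \<le> tau)) \<le> Er w (\<lambda>r. of_bool (D1 (upd w f r) w \<le> tau) - of_bool (D1 (upd w f r) w \<le> - tau - 1))"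
      using tau4 by (intro Er_mono) (auto simp: of_bool_def abs_le_iff)
    also have "\<dots> = Er w (\<lambda>r. of_bool (D1 (upd w f r) w \<le> tau)) - Er w (\<lambda>r. of_bool (D1 (upd w f r) w \<le> - tau - 1))" by (rule Er_diff)
    also have "\<dots> \<le> (Phi ((tau - p * s2 w f) / ss) - Phi ((- tau - 1 - p * s2 w f) / ss)) + 2 * nn (-3/100)"
      using D1_row_cdf[OF w, of f tau] D1_row_cdf[OF w, of f "- tau - 1"] by linarith
    also have "Phi ((tau - p * s2 w f) / ss) - Phi ((- tau - 1 - p * s2 w f) / ss) \<le> (2 * tau + 1) * (1 / ss)"
    proof -
      have "(tau - p * s2 w f) / ss - (- tau - 1 - p * s2 w f) / ss = (2 * tau + 1) * (1 / ss)"
        by (simp add: diff_divide_distrib[symmetric])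
      then show ?thesis using Phi_lipschitz[of "(tau - p * s2 w f) / ss" "(- tau - 1 - p * s2 w f) / ss"] tau4 ss_bounds(2) by simp
    qed
    also have "(2 * tau + 1) * (1 / ss) \<le> (3 * nn (3/10)) * nn (-499/1000)"
      using tau4 ss_bounds by (intro mult_mono) (auto simp: tau_def)
    also have "(3 * nn (3/10)) * nn (-499/1000) = 3 * nn (3/10 + -499/1000)" unfolding nn_mult[symmetric] by simp
    also have "3 * nn (3/10 + -499/1000) \<le> 3 * nn (-3/100)" by (intro mult_left_mono nn_mono) auto
    finally have "Er w (\<lambda>r. of_bool (\<bar>D1 (upd w f r) w\<bar> \<le> tau)) \<le> 5 * nn (-3/100)" by simp
    also have "\<dots> \<le> nn (-29/1000)" by (rule nn_absorb) auto
    finally show ?thesis .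
  qed
  show ?thesis by (subst resampleE[OF w]) (rule EE_le_const[OF finite_set_PP pt])
qed

lemma cond_mean:
  assumes w: "w \<in> V"
  shows "\<bar>Er w (\<lambda>r. Y2 (upd w f r) w) - Th (s2 w f)\<bar> \<le> nn (-28/1000)"
proof -
  let ?P = "\<lambda>z. Er w (\<lambda>r. of_bool (D1 (upd w f r) w \<le> z))"
  have yp: "\<bar>Y g w\<bar> = 1" for g by (rule Y_pm)
  \<comment> \<open>Whatever the tie-breaking color, 2 D1 + Y is positive for D1 > 1 and negative
    for D1 <= -1. This avoids the joint law of \<open>D1\<close> and \<open>Y\<close>, which depend
    on the same edges.\<close>
  have le: "1 - 2 * of_bool (D1 g w \<le> 1) \<le> Y2 g w" "Y2 g w \<le> 1 - 2 * of_bool (D1 g w \<le> -1)" for g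
    using yp[of g] by (auto simp: Y2_def sg_def)
  have "Er w (\<lambda>r. 1 - 2 * of_bool (D1 (upd w f r) w \<le> 1)) \<le> Er w (\<lambda>r. Y2 (upd w f r) w)" by (rule Er_mono) (rule le)
  then have lo: "1 - 2 * ?P 1 \<le> Er w (\<lambda>r. Y2 (upd w f r) w)" unfolding Er_diff Er_const Er_cmult .
  have "Er w (\<lambda>r. Y2 (upd w f r) w) \<le> Er w (\<lambda>r. 1 - 2 * of_bool (D1 (upd w f r) w \<le> -1))" by (rule Er_mono) (rule le)
  then have up: "Er w (\<lambda>r. Y2 (upd w f r) w) \<le> 1 - 2 * ?P (-1)" unfolding Er_diff Er_const Er_cmult .
  have sh: "\<bar>Phi ((z - p * s2 w f) / ss) - Phi (- (p * s2 w f / ss))\<bar> \<le> nn (-499/1000)" if "\<bar>z\<bar> = 1" for z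
  proof -
    have "(z - p * s2 w f) / ss - (- (p * s2 w f / ss)) = z * (1 / ss)" by (simp add: diff_divide_distrib)
    moreover have "\<bar>z * (1 / ss)\<bar> = 1 / ss" unfolding abs_mult that using ss_bounds(2) by simp
    ultimately show ?thesis using Phi_lipschitz[of "(z - p * s2 w f) / ss" "- (p * s2 w f / ss)"] ss_bounds(3) by simp
  qed
  have T: "Th (s2 w f) = 1 - 2 * Phi (- (p * s2 w f / ss))" unfolding Th_def Phi_minus by simp
  have "\<bar>Er w (\<lambda>r. Y2 (upd w f r) w) - Th (s2 w f)\<bar> \<le> 2 * (nn (-3/100) + nn (-499/1000))"
    unfolding T using lo up sh[of 1] sh[of "-1"] D1_row_cdf[OF w, of f 1] D1_row_cdf[OF w, of f "-1"] by simp
  also have "\<dots> \<le> 4 * nn (-3/100)" using nn_mono[of "-499/1000" "-3/100"] by simp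
  also have "\<dots> \<le> nn (-28/1000)" by (rule nn_absorb) auto
  finally show ?thesis .
qed

lemma Th_lip: "\<bar>Th a - Th b\<bar> \<le> 2 * nn (-499/1000) * \<bar>a - b\<bar>"
proof -
  have "Th a - Th b = 2 * (Phi (p * a / ss) - Phi (p * b / ss))" unfolding Th_def by simp
  then have "\<bar>Th a - Th b\<bar> = 2 * \<bar>Phi (p * a / ss) - Phi (p * b / ss)\<bar>" by (simp only: abs_mult abs_numeral)
  also have "\<dots> \<le> 2 * \<bar>p * a / ss - p * b / ss\<bar>" using Phi_lipschitz by simp
  also have "p * a / ss - p * b / ss = p * (1 / ss) * (a - b)" by (simp add: algebra_simps diff_divide_distrib)
  also have "\<bar>p * (1 / ss) * (a - b)\<bar> = (p * (1 / ss)) * \<bar>a - b\<bar>" unfolding abs_mult using p ss_bounds(2) by simp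
  also have "2 * ((p * (1 / ss)) * \<bar>a - b\<bar>) \<le> 2 * ((1 * nn (-499/1000)) * \<bar>a - b\<bar>)"
    using p ss_bounds by (intro mult_left_mono mult_right_mono mult_mono) auto
  finally show ?thesis by simp
qed

lemma Th_bound: "\<bar>Th a\<bar> \<le> 1" unfolding Th_def using Phi_range[of "p * a / ss"] by (simp add: abs_le_iff)
lemma Th_mono: "a \<le> b \<Longrightarrow> Th a \<le> Th b"
proof -
  assume "a \<le> b"
  then have "p * a / ss \<le> p * b / ss" using p ss_bounds(2) by (intro divide_right_mono mult_left_mono) auto
  then show ?thesis unfolding Th_def using Phi_mono by simp
qed
lemma Th_minus: "Th (- a) = - Th a" unfolding Th_def using Phi_minus[of "p * a / ss"] by simp

text \<open>\<open>th w (S1 f)\<close> approximates the conditional mean of the color of \<open>w\<close> at time 2; \<open>kap\<close> is the typical number of vertices pivotal for \<open>w\<close>.\<close>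

definition th where "th w S = Th (S + 2 * real_of_int (x w) * q * kap)"
definition U where "U f w = Y2 f w - th w (S1 f)"

lemma U_bound: "\<bar>U f w\<bar> \<le> 2" unfolding U_def th_def using Y2_pm(1)[of f w] Th_bound[of "S1 f + 2 * real_of_int (x w) * q * kap"] by linarith

lemma th_S1:
  assumes "v \<in> V"
  shows "\<bar>th w (S1 (upd v f r)) - th w (M v f)\<bar> \<le> 2 * nn (-499/1000) * (1 + 2 * \<bar>TT v f r\<bar>)"
proof -
  have "\<bar>th w (S1 (upd v f r)) - th w (M v f)\<bar> \<le> 2 * nn (-499/1000) * \<bar>Yr v r + 2 * real_of_int (x v) * TT v f r\<bar>"
    unfolding th_def S1_upd[OF assms] using Th_lip by (rule order_trans) (simp add: algebra_simps)
  also have "\<bar>Yr v r + 2 * real_of_int (x v) * TT v f r\<bar> \<le> \<bar>Yr v r\<bar> + \<bar>2 * real_of_int (x v) * TT v f r\<bar>" by (rule abs_triangle_ineq)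
  also have "\<bar>Yr v r\<bar> + \<bar>2 * real_of_int (x v) * TT v f r\<bar> = 1 + 2 * \<bar>TT v f r\<bar>" unfolding Yr_pm abs_mult x_sq by simp
  finally show ?thesis by simp
qed

lemma th_S1_L1:
  assumes "v \<in> V"
  shows "EE PP (\<lambda>f. Er v (\<lambda>r. \<bar>th w (S1 (upd v f r)) - th w (M v f)\<bar>)) \<le> nn (-2/10)"
proof -
  have "EE PP (\<lambda>f. Er v (\<lambda>r. \<bar>th w (S1 (upd v f r)) - th w (M v f)\<bar>)) \<le> EE PP (\<lambda>f. 2 * nn (-499/1000) * (1 + 2 * Er v (\<lambda>r. \<bar>TT v f r\<bar>)))"
  proof (rule EE_mono[OF finite_set_PP])
    fix f
    have "Er v (\<lambda>r. \<bar>th w (S1 (upd v f r)) - th w (M v f)\<bar>) \<le> Er v (\<lambda>r. 2 * nn (-499/1000) * (1 + 2 * \<bar>TT v f r\<bar>))"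
      by (rule Er_mono) (rule th_S1[OF assms])
    then show "Er v (\<lambda>r. \<bar>th w (S1 (upd v f r)) - th w (M v f)\<bar>) \<le> 2 * nn (-499/1000) * (1 + 2 * Er v (\<lambda>r. \<bar>TT v f r\<bar>))"
      unfolding Er_cmult Er_add Er_const .
  qed
  also have "\<dots> = 2 * nn (-499/1000) * (1 + 2 * EE PP (\<lambda>f. Er v (\<lambda>r. \<bar>TT v f r\<bar>)))"
    unfolding integral_mult_right_zero EE_add[OF finite_set_PP] by simp
  also have "\<dots> \<le> 2 * nn (-499/1000) * (nn (251/1000) + 2 * nn (251/1000))"
    using TT_abs_moments(1)[OF assms] nn_mono[of 0 "251/1000"] nn_1(2) by (intro mult_left_mono add_mono) auto
  also have "\<dots> = 6 * nn (-499/1000 + 251/1000)" unfolding nn_mult[symmetric] by simp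
  also have "\<dots> \<le> nn (-2/10)" by (rule nn_absorb) auto
  finally show ?thesis .
qed

text \<open>Three replacements: the conditional mean by \<open>Th\<close> of \<open>s2\<close>, the
  number of pivotal vertices by \<open>kap\<close>, and \<open>S1\<close> by \<open>M\<close>, the
  part of it fixed by the graph without w.\<close>

lemma U_cond_L1: assumes w: "w \<in> V" shows "EE PP (\<lambda>f. \<bar>Er w (\<lambda>r. U (upd w f r) w)\<bar>) \<le> nn (-27/1000)"
proof -
  let ?t = "\<lambda>f. Er w (\<lambda>r. \<bar>th w (S1 (upd w f r)) - th w (M w f)\<bar>)"
  have pt: "\<bar>Er w (\<lambda>r. U (upd w f r) w)\<bar> \<le> nn (-28/1000) + (4 * nn (-499/1000)) * \<bar>KN w f - kap\<bar> + ?t f" for f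
  proof -
    have e: "Er w (\<lambda>r. U (upd w f r) w) = (Er w (\<lambda>r. Y2 (upd w f r) w) - Th (s2 w f)) + (Th (s2 w f) - th w (M w f))
        - Er w (\<lambda>r. th w (S1 (upd w f r)) - th w (M w f))"
      unfolding U_def Er_diff Er_const by simp
    have 1: "\<bar>Er w (\<lambda>r. th w (S1 (upd w f r)) - th w (M w f))\<bar> \<le> ?t f" by (rule Er_abs_le) simp
    have 2: "\<bar>Th (s2 w f) - th w (M w f)\<bar> \<le> (4 * nn (-499/1000)) * \<bar>KN w f - kap\<bar>"
    proof -
      have "s2 w f - (M w f + 2 * real_of_int (x w) * q * kap) = (2 * real_of_int (x w) * q) * (KN w f - kap)"
        unfolding s2_M by (simp add: algebra_simps)
      then have "\<bar>s2 w f - (M w f + 2 * real_of_int (x w) * q * kap)\<bar> = 2 * q * \<bar>KN w f - kap\<bar>"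
        using q by (simp add: abs_mult x_sq)
      also have "\<dots> \<le> 2 * 1 * \<bar>KN w f - kap\<bar>" using q by (intro mult_right_mono mult_left_mono) auto
      finally have b: "\<bar>s2 w f - (M w f + 2 * real_of_int (x w) * q * kap)\<bar> \<le> 2 * \<bar>KN w f - kap\<bar>" by simp
      have "\<bar>Th (s2 w f) - th w (M w f)\<bar> \<le> 2 * nn (-499/1000) * \<bar>s2 w f - (M w f + 2 * real_of_int (x w) * q * kap)\<bar>"
        unfolding th_def by (rule Th_lip)
      also have "\<dots> \<le> 2 * nn (-499/1000) * (2 * \<bar>KN w f - kap\<bar>)" using b by (intro mult_left_mono) auto
      finally show ?thesis by simp
    qed
    show ?thesis unfolding e using 1 2 cond_mean[OF w, of f] by linarith
  qed
  have "EE PP (\<lambda>f. \<bar>Er w (\<lambda>r. U (upd w f r) w)\<bar>) \<le> EE PP (\<lambda>f. nn (-28/1000) + (4 * nn (-499/1000)) * \<bar>KN w f - kap\<bar> + ?t f)"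
    by (rule EE_mono[OF finite_set_PP]) (rule pt)
  also have "\<dots> = nn (-28/1000) + (4 * nn (-499/1000)) * EE PP (\<lambda>f. \<bar>KN w f - kap\<bar>) + EE PP ?t"
    unfolding EE_add[OF finite_set_PP] integral_mult_right_zero by simp
  also have "\<dots> \<le> nn (-28/1000) + (4 * nn (-499/1000)) * (2 * nn (7/16)) + nn (-2/10)"
    using KN_L1[OF w] th_S1_L1[OF w, of w] by (intro add_mono mult_left_mono) auto
  also have "\<dots> = nn (-28/1000) + 8 * nn (-499/1000 + 7/16) + nn (-2/10)" unfolding nn_mult[symmetric] by simp
  also have "\<dots> \<le> nn (-28/1000) + 8 * nn (-28/1000) + nn (-28/1000)" by (intro add_mono mult_left_mono nn_mono) auto
  also have "\<dots> = 10 * nn (-28/1000)" by simp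
  also have "\<dots> \<le> nn (-27/1000)" by (rule nn_absorb) auto
  finally show ?thesis .
qed

lemma Y2_Yt_L1:
  assumes v: "v \<in> V" and w: "w \<in> V" and ne: "v \<noteq> w"
  shows "EE PP (\<lambda>f. Er v (\<lambda>r. \<bar>Y2 (upd v f r) w - Yt v f w\<bar>)) \<le> nn (-28/1000)"
proof -
  \<comment> \<open>Chosen so that C * (tau/8)^2 = 2, the largest possible difference of two colors:
    Chebyshev's inequality at tau/8.\<close>
  let ?C = "128 * nn (-6/10)"
  have pt: "\<bar>Y2 (upd v f r) w - Yt v f w\<bar> \<le> 2 * of_bool (\<bar>D1 (upd v f r) w\<bar> \<le> tau) + ?C * (cs v f w r)\<^sup>2" for f r
  proof (cases "\<bar>D1 (upd v f r) w\<bar> \<le> tau \<or> \<bar>cs v f w r\<bar> > tau / 8")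
    case False
    have "Y2 (upd v f r) w = Yt v (upd v f r) w"
      by (rule Y2_eq_Yt[OF v w ne, of tau]) (use False tau4 cs_inv[OF v, of w f r] ne in auto)
    then have "Y2 (upd v f r) w = Yt v f w" using Yt_inv[of w v f r] ne by simp
    then show ?thesis by simp
  next
    case True
    have b: "\<bar>Y2 (upd v f r) w - Yt v f w\<bar> \<le> 2" using Y2_pm(1)[of "upd v f r" w] Yt_pm(1)[of v f w] by linarith
    have n0: "0 \<le> ?C * (cs v f w r)\<^sup>2" by simp
    show ?thesis
    proof (cases "\<bar>D1 (upd v f r) w\<bar> \<le> tau")
      case True
      then have "of_bool (\<bar>D1 (upd v f r) w\<bar> \<le> tau) = (1::real)" by simp
      then show ?thesis using b n0 by linarith
    next
      case False
      then have "tau / 8 \<le> \<bar>cs v f w r\<bar>" using True by simp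
      then have "(tau / 8)\<^sup>2 \<le> \<bar>cs v f w r\<bar>\<^sup>2" using tau4 by (intro power_mono) auto
      then have "?C * (tau / 8)\<^sup>2 \<le> ?C * (cs v f w r)\<^sup>2" by (intro mult_left_mono) auto
      moreover have "?C * (tau / 8)\<^sup>2 = 2"
      proof -
        have "(tau / 8)\<^sup>2 = nn (6/10) / 64" by (simp add: tau_def power_divide nn_power)
        then have "?C * (tau / 8)\<^sup>2 = 2 * (nn (-6/10) * nn (6/10))" by simp
        also have "nn (-6/10) * nn (6/10) = 1" unfolding nn_mult using nn_1(2) by simp
        finally show ?thesis by simp
      qed
      moreover have "of_bool (\<bar>D1 (upd v f r) w\<bar> \<le> tau) = (0::real)" using False by simp
      ultimately show ?thesis using b by linarith
    qed
  qed
  have csq: "Er v (\<lambda>r. (cs v f w r)\<^sup>2) \<le> KN v f" for f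
  proof -
    have "Er v (\<lambda>r. (cs v f w r)\<^sup>2) = p * q * (\<Sum>u\<in>V - {v}. (ck v f w u)\<^sup>2)"
      unfolding Er_def cs_def by (rule csum_moments(2)[OF finVv])
    also have "\<dots> \<le> 1 * (\<Sum>u\<in>V - {v}. (ck v f w u)\<^sup>2)" using pq by (intro mult_right_mono sum_nonneg) auto
    finally show ?thesis using sum_ck_sq[of v f w] by linarith
  qed
  have "EE PP (\<lambda>f. Er v (\<lambda>r. \<bar>Y2 (upd v f r) w - Yt v f w\<bar>)) \<le> EE PP (\<lambda>f. 2 * Er v (\<lambda>r. of_bool (\<bar>D1 (upd v f r) w\<bar> \<le> tau)) + ?C * KN v f)"
  proof (rule EE_mono[OF finite_set_PP])
    fix f
    have "Er v (\<lambda>r. \<bar>Y2 (upd v f r) w - Yt v f w\<bar>) \<le> Er v (\<lambda>r. 2 * of_bool (\<bar>D1 (upd v f r) w\<bar> \<le> tau) + ?C * (cs v f w r)\<^sup>2)"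
      by (rule Er_mono) (rule pt)
    also have "\<dots> = 2 * Er v (\<lambda>r. of_bool (\<bar>D1 (upd v f r) w\<bar> \<le> tau)) + ?C * Er v (\<lambda>r. (cs v f w r)\<^sup>2)" unfolding Er_add Er_cmult ..
    also have "\<dots> \<le> 2 * Er v (\<lambda>r. of_bool (\<bar>D1 (upd v f r) w\<bar> \<le> tau)) + ?C * KN v f" using csq[of f] by (intro add_left_mono mult_left_mono) auto
    finally show "Er v (\<lambda>r. \<bar>Y2 (upd v f r) w - Yt v f w\<bar>) \<le> 2 * Er v (\<lambda>r. of_bool (\<bar>D1 (upd v f r) w\<bar> \<le> tau)) + ?C * KN v f" .
  qed
  also have "\<dots> = 2 * EE PP (\<lambda>f. of_bool (\<bar>D1 f w\<bar> \<le> tau)) + ?C * EE PP (KN v)"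
    unfolding EE_add[OF finite_set_PP] integral_mult_right_zero resampleE[OF v, of "\<lambda>f. of_bool (\<bar>D1 f w\<bar> \<le> tau)"] ..
  also have "\<dots> \<le> 2 * nn (-29/1000) + ?C * nn (502/1000)" using D1_anticoncentration[OF w] KN_moments(1)[OF v] by (intro add_mono mult_left_mono) auto
  also have "\<dots> = 2 * nn (-29/1000) + 128 * nn (-6/10 + 502/1000)" unfolding nn_mult[symmetric] by simp
  also have "\<dots> \<le> 2 * nn (-29/1000) + 128 * nn (-29/1000)" by (intro add_mono mult_left_mono nn_mono) auto
  also have "\<dots> = 130 * nn (-29/1000)" by simp
  also have "\<dots> \<le> nn (-28/1000)" by (rule nn_absorb) auto
  finally show ?thesis .
qed

text \<open>Given the graph without v, \<open>U f w\<close> is nearly the constant \<open>Ut\<close>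
  and \<open>U f v\<close> has nearly mean 0, so the product does too.\<close>

lemma U_pair:
  assumes v: "v \<in> V" and w: "w \<in> V" and ne: "v \<noteq> w"
  shows "\<bar>EE PP (\<lambda>f. U f v * U f w)\<bar> \<le> nn (-25/1000)"
proof -
  define Ut where "Ut f = Yt v f w - th w (M v f)" for f
  have Utb: "\<bar>Ut f\<bar> \<le> 2" for f
    unfolding Ut_def th_def using Yt_pm(1)[of v f w] Th_bound[of "M v f + 2 * real_of_int (x w) * q * kap"] by linarith
  let ?a = "\<lambda>f. Er v (\<lambda>r. \<bar>Y2 (upd v f r) w - Yt v f w\<bar>)" and ?b = "\<lambda>f. Er v (\<lambda>r. \<bar>th w (S1 (upd v f r)) - th w (M v f)\<bar>)"
  have pt: "\<bar>Er v (\<lambda>r. U (upd v f r) v * U (upd v f r) w)\<bar> \<le> 2 * \<bar>Er v (\<lambda>r. U (upd v f r) v)\<bar> + (2 * ?a f + 2 * ?b f)" for f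
  proof -
    have "Er v (\<lambda>r. U (upd v f r) v * U (upd v f r) w) = Er v (\<lambda>r. Ut f * U (upd v f r) v + U (upd v f r) v * (U (upd v f r) w - Ut f))"
      by (simp add: algebra_simps)
    then have e: "Er v (\<lambda>r. U (upd v f r) v * U (upd v f r) w) = Ut f * Er v (\<lambda>r. U (upd v f r) v) + Er v (\<lambda>r. U (upd v f r) v * (U (upd v f r) w - Ut f))"
      unfolding Er_add Er_cmult .
    have 1: "\<bar>Ut f * Er v (\<lambda>r. U (upd v f r) v)\<bar> \<le> 2 * \<bar>Er v (\<lambda>r. U (upd v f r) v)\<bar>"
      unfolding abs_mult using Utb by (intro mult_right_mono) auto
    have "\<bar>Er v (\<lambda>r. U (upd v f r) v * (U (upd v f r) w - Ut f))\<bar> \<le> Er v (\<lambda>r. 2 * \<bar>Y2 (upd v f r) w - Yt v f w\<bar> + 2 * \<bar>th w (S1 (upd v f r)) - th w (M v f)\<bar>)"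
    proof (rule Er_abs_le)
      fix r
      have "\<bar>U (upd v f r) w - Ut f\<bar> \<le> \<bar>Y2 (upd v f r) w - Yt v f w\<bar> + \<bar>th w (S1 (upd v f r)) - th w (M v f)\<bar>"
        unfolding U_def Ut_def by linarith
      then have "\<bar>U (upd v f r) v\<bar> * \<bar>U (upd v f r) w - Ut f\<bar> \<le> 2 * (\<bar>Y2 (upd v f r) w - Yt v f w\<bar> + \<bar>th w (S1 (upd v f r)) - th w (M v f)\<bar>)"
        using U_bound[of "upd v f r" v] by (intro mult_mono) auto
      then show "\<bar>U (upd v f r) v * (U (upd v f r) w - Ut f)\<bar> \<le> 2 * \<bar>Y2 (upd v f r) w - Yt v f w\<bar> + 2 * \<bar>th w (S1 (upd v f r)) - th w (M v f)\<bar>"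
        unfolding abs_mult by simp
    qed
    then have 2: "\<bar>Er v (\<lambda>r. U (upd v f r) v * (U (upd v f r) w - Ut f))\<bar> \<le> 2 * ?a f + 2 * ?b f" unfolding Er_add Er_cmult .
    show ?thesis unfolding e using 1 2 by linarith
  qed
  have "\<bar>EE PP (\<lambda>f. U f v * U f w)\<bar> \<le> EE PP (\<lambda>f. 2 * \<bar>Er v (\<lambda>r. U (upd v f r) v)\<bar> + (2 * ?a f + 2 * ?b f))"
    by (subst resampleE[OF v]) (rule EE_abs_le[OF finite_set_PP], rule pt)
  also have "\<dots> = 2 * EE PP (\<lambda>f. \<bar>Er v (\<lambda>r. U (upd v f r) v)\<bar>) + (2 * EE PP ?a + 2 * EE PP ?b)"
    unfolding EE_add[OF finite_set_PP] integral_mult_right_zero ..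
  also have "\<dots> \<le> 2 * nn (-27/1000) + (2 * nn (-28/1000) + 2 * nn (-2/10))"
    using U_cond_L1[OF v] Y2_Yt_L1[OF v w ne] th_S1_L1[OF v, of w] by (intro add_mono mult_left_mono) auto
  also have "\<dots> \<le> 6 * nn (-27/1000)" using nn_mono[of "-28/1000" "-27/1000"] nn_mono[of "-2/10" "-27/1000"] by simp
  also have "\<dots> \<le> nn (-25/1000)" by (rule nn_absorb) auto
  finally show ?thesis .
qed

text \<open>Chebyshev's inequality: the n^2 pairs contribute about n^(1975/1000), just below the
  squared threshold n^(1980/1000).\<close>

lemma U_sum_tail: "measure_pmf.prob PP {f. nn (990/1000) \<le> \<bar>\<Sum>w\<in>V. U f w\<bar>} \<le> nn (-3/1000)"
proof -
  have sq: "EE PP (\<lambda>f. (\<Sum>w\<in>V. U f w)\<^sup>2) \<le> nn (1977/1000)"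
  proof -
    have "EE PP (\<lambda>f. (\<Sum>w\<in>V. U f w)\<^sup>2) = (\<Sum>v\<in>V. \<Sum>w\<in>V. EE PP (\<lambda>f. U f v * U f w))"
      unfolding power2_eq_square sum_product EE_sum[OF finite_set_PP] ..
    also have "\<dots> \<le> (\<Sum>v\<in>V. \<Sum>w\<in>V. nn (-25/1000) + of_bool (v = w) * 4)"
    proof (intro sum_mono)
      fix v w assume vw: "v \<in> V" "w \<in> V"
      show "EE PP (\<lambda>f. U f v * U f w) \<le> nn (-25/1000) + of_bool (v = w) * 4"
      proof (cases "v = w")
        case True
        have "EE PP (\<lambda>f. U f v * U f w) \<le> 4"
        proof (rule EE_le_const[OF finite_set_PP])
          fix f
          have "\<bar>U f v\<bar> * \<bar>U f w\<bar> \<le> 2 * 2" using U_bound by (intro mult_mono) auto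
          then show "U f v * U f w \<le> 4" using abs_ge_self[of "U f v * U f w"] by (simp add: abs_mult)
        qed
        then show ?thesis using True by (simp add: add_increasing)
      next
        case False then show ?thesis using U_pair[OF vw False] by (simp add: abs_le_iff)
      qed
    qed
    also have "\<dots> = N * (N * nn (-25/1000)) + N * 4"
    proof -
      have "(\<Sum>w\<in>V. of_bool (v = w) * (4::real)) = 4" if "v \<in> V" for v
      proof -
        have "(\<Sum>w\<in>V. of_bool (v = w) * (4::real)) = (\<Sum>w\<in>V. if w = v then 4 else 0)" by (rule sum.cong) auto
        then show ?thesis using that finV by simp
      qed
      then show ?thesis unfolding sum.distrib N_def by simp
    qed
    also have "\<dots> \<le> (3 * nn 1) * ((3 * nn 1) * nn (-25/1000)) + (3 * nn 1) * 4"
      using N_bounds by (intro add_mono mult_mono) auto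
    also have "\<dots> = 9 * nn (1 + (1 + -25/1000)) + 12 * nn 1" unfolding nn_mult[symmetric] by simp
    also have "\<dots> \<le> 9 * nn (1975/1000) + 12 * nn (1975/1000)" by (intro add_mono mult_left_mono nn_mono) auto
    also have "\<dots> = 21 * nn (1975/1000)" by simp
    also have "\<dots> \<le> nn (1977/1000)" by (rule nn_absorb) auto
    finally show ?thesis .
  qed
  have "measure_pmf.prob PP {f. nn (990/1000) \<le> \<bar>\<Sum>w\<in>V. U f w\<bar>} = measure_pmf.prob PP {f. nn (1980/1000) \<le> (\<Sum>w\<in>V. U f w)\<^sup>2}"
  proof -
    have "nn (990/1000) \<le> \<bar>y\<bar> \<longleftrightarrow> nn (1980/1000) \<le> y\<^sup>2" for y
    proof -
      have "(nn (990/1000))\<^sup>2 = nn (1980/1000)" by (simp add: nn_power)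
      then show ?thesis using abs_le_square_iff[of "nn (990/1000)" y] by simp
    qed
    then show ?thesis by simp
  qed
  also have "\<dots> \<le> EE PP (\<lambda>f. (\<Sum>w\<in>V. U f w)\<^sup>2) / nn (1980/1000)" by (rule EE_markov[OF finite_set_PP]) auto
  also have "\<dots> \<le> nn (1977/1000) / nn (1980/1000)" using sq by (intro divide_right_mono) auto
  also have "\<dots> = nn (-3/1000)" unfolding nn_divide by simp
  finally show ?thesis .
qed

text \<open>The factors p q cancel and the ratio tends to sqrt (2/pi). The shift by
  \<open>kap\<close> thus moves the argument of Phi by a bounded amount, where the density is
  bounded below.\<close>

lemma kap_ss: "p * (2 * q * kap) / ss \<le> 3"
proof -
  have "N * N \<le> 9 * (m3 * (N - 1)) * 2"
  proof -
    have "N * N \<le> (3 * nn 1) * (3 * nn 1)" using N_bounds by (intro mult_mono) auto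
    also have "\<dots> = 9 * (((1/2) * nn 1) * nn 1) * 2" by simp
    also have "\<dots> \<le> 9 * (m3 * (N - 1)) * 2" using m3(1,3) N_minus_1_bounds(1) by (intro mult_right_mono mult_left_mono mult_mono) auto
    finally show ?thesis .
  qed
  also have "\<dots> \<le> 9 * pi * (m3 * (N - 1))"
  proof -
    have "0 \<le> m3 * (N - 1)" using m3(3) N_minus_1_bounds(1) nn_pos[of 1] by (intro mult_nonneg_nonneg) linarith+
    then show ?thesis using pi_gt3 by (simp add: mult_right_mono)
  qed
  finally have "sqrt (N * N) \<le> sqrt (9 * pi * (m3 * (N - 1)))" by (rule real_sqrt_le_mono)
  then have NN: "N \<le> 3 * sqrt (pi * (m3 * (N - 1)))" using N_bounds(2) by (simp add: real_sqrt_mult)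
  have pos: "0 < p * q" "0 < m3" "0 < N - 1" using pq m3 N_minus_1_bounds(1) nn_pos[of 1] by linarith+
  have d: "sqrt (4 * pi * (m3 * (p * q))) * ss = 2 * (p * q) * sqrt (pi * (m3 * (N - 1)))"
  proof -
    have "sqrt (4 * pi * (m3 * (p * q))) * ss = sqrt ((4 * pi * (m3 * (p * q))) * ((N - 1) * (p * q)))" unfolding ss_def real_sqrt_mult[symmetric] ..
    also have "(4 * pi * (m3 * (p * q))) * ((N - 1) * (p * q)) = (2 * (p * q))\<^sup>2 * (pi * (m3 * (N - 1)))" by (simp add: power2_eq_square)
    also have "sqrt \<dots> = 2 * (p * q) * sqrt (pi * (m3 * (N - 1)))" using pos by (simp add: real_sqrt_mult)
    finally show ?thesis .
  qed
  have sp: "0 < sqrt (pi * (m3 * (N - 1)))" using pos by simp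
  have "p * (2 * q * kap) / ss = 2 * (p * q) * N / (sqrt (4 * pi * (m3 * (p * q))) * ss)"
    unfolding kap_def P0_def N_def by simp
  also have "\<dots> = N / sqrt (pi * (m3 * (N - 1)))" unfolding d using pos sp p q by (simp add: field_simps)
  also have "\<dots> \<le> 3" using NN sp by (simp add: divide_le_eq)
  finally show ?thesis .
qed

text \<open>The shift b can exceed S, so blue vertices may still lean blue when S favors red. But
  \<open>Th\<close> is odd: Th (S + b) + Th (S - b) = Th (b + S) - Th (b - S) is an increment over
  length 2 S, and the density bounds it below. The surplus of red vertices costs at most
  \<open>\<Delta>\<close>.\<close>

lemma th_sum_lower:
  assumes z: "z = 1 \<or> z = -1" and S: "z * S \<ge> nn (498/1000)"
  shows "z * (\<Sum>w\<in>V. th w S) \<ge> 2 * nn (994/1000)"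
proof -
  let ?b = "2 * q * kap" and ?s = "nn (498/1000)"
  have sumth: "(\<Sum>w\<in>V. th w S) = real (n + \<Delta>) * Th (S + ?b) + real n * Th (S - ?b)"
  proof -
    have "(\<Sum>w\<in>V. th w S) = (\<Sum>w\<in>R0. th w S) + (\<Sum>w\<in>B0. th w S)"
      unfolding V by (rule sum.union_disjoint) (use finV V disj in auto)
    also have "(\<Sum>w\<in>R0. th w S) = (\<Sum>w\<in>R0. Th (S + ?b))" by (rule sum.cong) (auto simp: th_def x_def)
    also have "(\<Sum>w\<in>B0. th w S) = (\<Sum>w\<in>B0. Th (S - ?b))" by (rule sum.cong) (use disj in \<open>auto simp: th_def x_def\<close>)
    finally show ?thesis using cR cB by simp
  qed
  have d: "Th (z * S + ?b) + Th (z * S - ?b) \<ge> (1/10000) * nn (-3/1000)"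
  proof -
    have "Th (?s + ?b) + Th (?s - ?b) \<le> Th (z * S + ?b) + Th (z * S - ?b)" using S by (intro add_mono Th_mono) auto
    moreover have "Th (?s - ?b) = - Th (?b - ?s)" using Th_minus[of "?b - ?s"] by simp
    moreover have "(1/20000) * (p * (?b + ?s) / ss - p * (?b - ?s) / ss) \<le> Phi (p * (?b + ?s) / ss) - Phi (p * (?b - ?s) / ss)"
    proof (rule Phi_diff_ge)
      show "p * (?b - ?s) / ss \<le> p * (?b + ?s) / ss" using p ss_bounds(2) by (intro divide_right_mono mult_left_mono) auto
      fix y assume y: "p * (?b - ?s) / ss \<le> y" "y \<le> p * (?b + ?s) / ss"
      have ps: "p * ?s / ss \<le> 1"
      proof -
        have "p * ?s \<le> 1 * ?s" using p by (intro mult_right_mono) auto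
        also have "\<dots> \<le> ss" using ss_bounds(1) nn_mono[of "498/1000" "4995/10000"] by simp
        finally show ?thesis using ss_bounds(2) by (simp add: divide_le_eq)
      qed
      have b0: "0 \<le> p * ?b / ss" using p q kap_bounds(1) ss_bounds(2) by simp
      \<comment> \<open>At most 3 from \<open>kap_ss\<close> and 1 from the surplus. The density is
        then at least exp (-8) / 3, whence 1/20000.\<close>
      have "\<bar>y\<bar> \<le> 4" using y ps b0 kap_ss by (simp add: distrib_left right_diff_distrib add_divide_distrib diff_divide_distrib abs_le_iff)
      then have "y\<^sup>2 \<le> 4\<^sup>2" using abs_le_square_iff[of y 4] by simp
      then have "exp (- 8) \<le> exp (- y\<^sup>2 / 2)" by simp
      moreover have "1/6561 \<le> exp (- 8 :: real)"
      proof -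
        have "exp (8::real) = exp 1 ^ 8" by (simp flip: exp_of_nat_mult)
        also have "\<dots> \<le> 3 ^ 8" by (intro power_mono) (auto simp: exp_le)
        finally show ?thesis by (simp add: exp_minus field_simps)
      qed
      moreover have "1/3 \<le> 1 / sqrt (2 * pi)"
      proof -
        have "2 * pi \<le> 3\<^sup>2" using pi_less_4 by simp
        then have "sqrt (2 * pi) \<le> sqrt (3\<^sup>2)" by (rule real_sqrt_le_mono)
        then have "sqrt (2 * pi) \<le> 3" by simp
        then show ?thesis by (intro divide_left_mono) auto
      qed
      ultimately have e: "1/6561 \<le> exp (- y\<^sup>2 / 2)" "1/3 \<le> 1 / sqrt (2 * pi)" by linarith+
      have "(1/3) * (1/6561) \<le> 1 / sqrt (2 * pi) * exp (- y\<^sup>2 / 2)" by (rule mult_mono[OF e(2,1)]) auto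
      moreover have "(1/20000 :: real) \<le> (1/3) * (1/6561)" by simp
      ultimately show "1/20000 \<le> std_normal_density y" unfolding std_normal_density_def by linarith
    qed
    moreover have "nn (-3/1000) \<le> p * (?b + ?s) / ss - p * (?b - ?s) / ss"
    proof -
      have "p * (?b + ?s) / ss - p * (?b - ?s) / ss = 2 * (p * ?s / ss)" by (simp add: distrib_left right_diff_distrib add_divide_distrib diff_divide_distrib)
      moreover have "(1/2) * nn (-3/1000) \<le> p * ?s / ss"
      proof -
        have "((1/2) * nn (-3/1000)) * ss \<le> ((1/2) * nn (-3/1000)) * (2 * nn (1/2))" using ss_bounds(4) by (intro mult_left_mono) auto
        also have "\<dots> = nn (-1/1000) * ?s" by (simp add: nn_mult)
        also have "\<dots> \<le> p * ?s" using p_lower(1) by (intro mult_right_mono) auto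
        finally show ?thesis using ss_bounds(2) by (simp add: le_divide_eq)
      qed
      ultimately show ?thesis by linarith
    qed
    moreover have "Th (?s + ?b) - Th (?b - ?s) = 2 * (Phi (p * (?b + ?s) / ss) - Phi (p * (?b - ?s) / ss))"
      unfolding Th_def by (simp add: add.commute)
    moreover have "(1/10000) * e \<le> t" if "a1 + a2 \<le> t" "a2 = - b" "(1/20000) * d \<le> f" "e \<le> d" "a1 - b = 2 * f" for a1 a2 b d e f t :: real
      using that by linarith
    ultimately show ?thesis by blast
  qed
  have zz: "z * Th a = Th (z * a)" for a using z Th_minus[of a] by auto
  have sm: "z * Th (S + ?b) + z * Th (S - ?b) = Th (z * S + ?b) + Th (z * S - ?b)"
    unfolding zz using z by (auto simp: algebra_simps)
  have "z * (\<Sum>w\<in>V. th w S) = real n * (z * Th (S + ?b) + z * Th (S - ?b)) + real \<Delta> * (z * Th (S + ?b))"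
    unfolding sumth by (simp add: algebra_simps)
  also have "\<dots> \<ge> real n * ((1/10000) * nn (-3/1000)) - real \<Delta>"
  proof -
    have "\<bar>z * Th (S + ?b)\<bar> \<le> 1" unfolding zz by (rule Th_bound)
    then have "real \<Delta> * (-1) \<le> real \<Delta> * (z * Th (S + ?b))" by (intro mult_left_mono) auto
    moreover have "real n * ((1/10000) * nn (-3/1000)) \<le> real n * (z * Th (S + ?b) + z * Th (S - ?b))"
      unfolding sm using d by (intro mult_left_mono) auto
    ultimately show ?thesis by linarith
  qed
  finally have "z * (\<Sum>w\<in>V. th w S) \<ge> (1/10000) * (nn 1 * nn (-3/1000)) - real \<Delta>" by (simp add: nn_1)
  moreover have "nn 1 * nn (-3/1000) = nn (997/1000)" by (simp add: nn_mult)
  moreover have "30000 * nn (994/1000) \<le> nn (997/1000)" by (rule nn_absorb) auto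
  moreover have "real \<Delta> \<le> nn (994/1000)" using \<Delta>b nn_mono[of "1/1000" "994/1000"] by simp
  ultimately show ?thesis by simp
qed

lemma S2_lower:
  assumes z: "z = 1 \<or> z = -1" and S: "z * S1 f \<ge> nn (498/1000)" and U: "\<bar>\<Sum>w\<in>V. U f w\<bar> < nn (990/1000)"
  shows "z * S2 f \<ge> nn (994/1000)"
proof -
  have "S2 f = (\<Sum>w\<in>V. th w (S1 f)) + (\<Sum>w\<in>V. U f w)" unfolding S2_def U_def by (simp add: sum_subtractf)
  then have "z * S2 f = z * (\<Sum>w\<in>V. th w (S1 f)) + z * (\<Sum>w\<in>V. U f w)" by (simp add: distrib_left)
  moreover have "\<bar>z * (\<Sum>w\<in>V. U f w)\<bar> < nn (990/1000)" using z U by (auto simp: abs_mult)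
  moreover have "nn (990/1000) \<le> nn (994/1000)" by (rule nn_mono) simp
  ultimately show ?thesis using th_sum_lower[OF z S] by linarith
qed

end

section \<open>The third step\<close>

context regime begin

text \<open>\<open>ZZ\<close> bounds the number of vertices pivotal for v, and \<open>QQ\<close> the
  number of prediction errors at v under the Hoeffding bounds. Neither depends on v, so one
  polynomial tail bound for each serves all vertices and no union bound is taken.\<close>

definition ZZ where "ZZ f = (\<Sum>u\<in>V. of_bool (\<bar>DX {} f u\<bar> \<le> 2) :: real)"
definition QQ where "QQ f = (\<Sum>w\<in>V. of_bool (\<bar>D1 f w\<bar> \<le> tau) :: real)"

lemma KN_ZZ: assumes v: "v \<in> V" shows "KN v f \<le> ZZ f"
proof -
  have "KN v f \<le> (\<Sum>u\<in>V - {v}. of_bool (\<bar>DX {} f u\<bar> \<le> 2))"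
    unfolding KN_def
  proof (rule sum_mono)
    fix u assume u: "u \<in> V - {v}"
    have "\<bar>DX {} f u\<bar> \<le> 2" if "DX {v} f u = kc v u"
    proof -
      have "DX {} f u = kc v u + x v * of_bool (f {v,u})" using DX_split[OF v, of u f] u that by simp
      moreover have "\<bar>x v * of_bool (f {v,u})\<bar> \<le> 1" using x_sq(3)[of v] by simp
      ultimately show ?thesis using kc(2)[of v u] by linarith
    qed
    then show "kk v f u \<le> of_bool (\<bar>DX {} f u\<bar> \<le> 2)" unfolding kk_kc by auto
  qed
  also have "\<dots> \<le> ZZ f" unfolding ZZ_def by (rule sum_mono2) (use finV in auto)
  finally show ?thesis .
qed

lemma ZZ_tail: "measure_pmf.prob PP {f. nn (51/100) \<le> ZZ f} \<le> nn (-8/1000)"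
proof -
  have one: "EE PP (\<lambda>f. of_bool (\<bar>DX {} f u\<bar> \<le> 2)) \<le> 10 * nn (-499/1000)" if u: "u \<in> V" for u
  proof -
    have "(of_bool (\<bar>d\<bar> \<le> 2) :: real) = (\<Sum>k\<in>{-2,-1,0,1,2}. of_bool (d = k))" for d :: int
    proof -
      have "(\<Sum>k\<in>{-2,-1,0,1,2}. of_bool (d = k) :: real) = (\<Sum>k\<in>{-2,-1,0,1,2}. if d = k then 1 else 0)" by (simp only: of_bool_def)
      also have "\<dots> = (if d \<in> {-2,-1,0,1,2} then 1 else 0)" by (rule sum.delta') simp
      also have "d \<in> {-2,-1,0,1,2} \<longleftrightarrow> \<bar>d\<bar> \<le> 2" by auto
      finally show ?thesis by (simp add: of_bool_def)
    qed
    then have "EE PP (\<lambda>f. of_bool (\<bar>DX {} f u\<bar> \<le> 2)) = (\<Sum>k\<in>{-2,-1,0,1,2}. EE PP (\<lambda>f. of_bool (DX {} f u = k)))"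
      by (simp only: EE_sum[OF finite_set_PP])
    also have "\<dots> = (\<Sum>k\<in>{-2,-1,0,1,2}. pp {u} k)" unfolding DX_prob[OF u] ..
    also have "\<dots> \<le> (\<Sum>k\<in>{-2,-1,0,1,2::int}. 2 * nn (-499/1000))"
    proof (rule sum_mono)
      fix k :: int assume "k \<in> {-2,-1,0,1,2}"
      then have "\<bar>k\<bar> \<le> 10" by auto
      then have "\<bar>pp {u} k - P0\<bar> \<le> e0" using u by (intro pp_approx) auto
      then show "pp {u} k \<le> 2 * nn (-499/1000)" using P0_bounds(2) e0_P0(2) by linarith
    qed
    finally show ?thesis by simp
  qed
  have "measure_pmf.prob PP {f. nn (51/100) \<le> ZZ f} \<le> EE PP ZZ / nn (51/100)"
    by (rule EE_markov[OF finite_set_PP]) (auto simp: ZZ_def intro!: sum_nonneg)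
  also have "EE PP ZZ \<le> (\<Sum>u\<in>V. 10 * nn (-499/1000))"
  proof -
    have "EE PP ZZ = (\<Sum>u\<in>V. EE PP (\<lambda>f. of_bool (\<bar>DX {} f u\<bar> \<le> 2)))" unfolding ZZ_def by (rule EE_sum[OF finite_set_PP])
    then show ?thesis using sum_mono[OF one] by simp
  qed
  also have "(\<Sum>u\<in>V. 10 * nn (-499/1000)) = N * (10 * nn (-499/1000))" by (simp add: N_def)
  also have "N * (10 * nn (-499/1000)) \<le> (3 * nn 1) * (10 * nn (-499/1000))" using N_bounds by (intro mult_right_mono) auto
  also have "(3 * nn 1) * (10 * nn (-499/1000)) / nn (51/100) = 30 * (nn 1 * nn (-499/1000) / nn (51/100))" by simp
  also have "\<dots> \<le> nn (-8/1000)" unfolding nn_mult nn_divide by (rule nn_absorb) auto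
  finally show ?thesis by (simp add: divide_right_mono)
qed

lemma QQ_tail: "measure_pmf.prob PP {f. nn (985/1000) \<le> QQ f} \<le> nn (-13/1000)"
proof -
  have "measure_pmf.prob PP {f. nn (985/1000) \<le> QQ f} \<le> EE PP QQ / nn (985/1000)"
    by (rule EE_markov[OF finite_set_PP]) (auto simp: QQ_def intro!: sum_nonneg)
  also have "EE PP QQ \<le> (\<Sum>u\<in>V. nn (-29/1000))"
  proof -
    have "EE PP QQ = (\<Sum>w\<in>V. EE PP (\<lambda>f. of_bool (\<bar>D1 f w\<bar> \<le> tau)))" unfolding QQ_def by (rule EE_sum[OF finite_set_PP])
    then show ?thesis using sum_mono[OF D1_anticoncentration] by simp
  qed
  also have "(\<Sum>u\<in>V. nn (-29/1000)) = N * nn (-29/1000)" by (simp add: N_def)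
  also have "N * nn (-29/1000) \<le> (3 * nn 1) * nn (-29/1000)" using N_bounds by (intro mult_right_mono) auto
  also have "(3 * nn 1) * nn (-29/1000) / nn (985/1000) = 3 * (nn 1 * nn (-29/1000) / nn (985/1000))" by simp
  also have "\<dots> \<le> nn (-13/1000)" unfolding nn_mult nn_divide by (rule nn_absorb) auto
  finally show ?thesis by (simp add: divide_right_mono)
qed

text \<open>The bound on \<open>KN\<close> belongs to the event because \<open>KN\<close> has only
  polynomial tails. It is fixed by the graph without v, so on its support Hoeffding's inequality
  applies to the edges at v.\<close>

definition Ev1 where "Ev1 v w f \<longleftrightarrow> tau / 8 \<le> \<bar>cs v f w (row v f)\<bar> \<and> KN v f \<le> nn (51/100)"
definition Ev2 where "Ev2 v f \<longleftrightarrow> nn (6/10) \<le> \<bar>csum (Yt v f) (V - {v}) (row v f)\<bar>"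

text \<open>The hypothesis on t makes the exponent at least n^(1/1000); the resulting n^(-5)
  survives a union over all pairs of vertices.\<close>

lemma hoeffding_row:
  assumes "(\<Sum>u\<in>V - {v}. (c u)\<^sup>2) \<le> s" "s > 0" "t > 0" "2 * s * nn (1/1000) \<le> t\<^sup>2"
  shows "Er v (\<lambda>r. of_bool (t \<le> \<bar>csum c (V - {v}) r\<bar>)) \<le> 2 * nn (-5)"
proof -
  have "Er v (\<lambda>r. of_bool (t \<le> \<bar>csum c (V - {v}) r\<bar>)) = measure_pmf.prob (bern p (V - {v})) {r. t \<le> \<bar>csum c (V - {v}) r\<bar>}"
    unfolding Er_def EE_prob by simp
  also have "\<dots> \<le> 2 * exp (- t\<^sup>2 / (2 * s))" by (rule csum_tail[OF finVv assms(1-3)])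
  also have "\<dots> \<le> 2 * exp (- nn (1/1000))"
  proof -
    have "nn (1/1000) \<le> t\<^sup>2 / (2 * s)" using assms(2,4) by (simp add: le_divide_eq mult.commute)
    then show ?thesis by simp
  qed
  also have "\<dots> \<le> 2 * nn (-5)" using expb by simp
  finally show ?thesis .
qed

lemma Ev1_prob: assumes v: "v \<in> V" and w: "w \<in> V - {v}" shows "EE PP (\<lambda>f. of_bool (Ev1 v w f)) \<le> 2 * nn (-5)"
proof -
  have pt: "Er v (\<lambda>r. of_bool (Ev1 v w (upd v f r))) \<le> 2 * nn (-5)" for f
  proof (cases "KN v f \<le> nn (51/100)")
    case True
    have "Er v (\<lambda>r. of_bool (Ev1 v w (upd v f r))) \<le> Er v (\<lambda>r. of_bool (tau / 8 \<le> \<bar>csum (ck v f w) (V - {v}) r\<bar>))"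
      by (rule Er_mono) (use cs_inv[OF v, of w f] w in \<open>auto simp: Ev1_def cs_def\<close>)
    also have "\<dots> \<le> 2 * nn (-5)"
    proof (rule hoeffding_row)
      show "(\<Sum>u\<in>V - {v}. (ck v f w u)\<^sup>2) \<le> nn (51/100)" using sum_ck_sq[of v f w] True by linarith
      have "128 * (nn (51/100) * nn (1/1000)) \<le> nn (6/10)" unfolding nn_mult by (rule nn_absorb) auto
      moreover have "(tau / 8)\<^sup>2 = nn (6/10) / 64" by (simp add: tau_def power_divide nn_power)
      ultimately show "2 * nn (51/100) * nn (1/1000) \<le> (tau / 8)\<^sup>2" by simp
    qed (use tau4 in auto)
    finally show ?thesis .
  next
    case False
    then have "Er v (\<lambda>r. of_bool (Ev1 v w (upd v f r))) = 0" by (simp add: Ev1_def KN_inv Er_const)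
    then show ?thesis by simp
  qed
  show ?thesis by (subst resampleE[OF v]) (rule EE_le_const[OF finite_set_PP pt])
qed

lemma Ev2_prob: assumes v: "v \<in> V" shows "EE PP (\<lambda>f. of_bool (Ev2 v f)) \<le> 2 * nn (-5)"
proof -
  have inv: "csum (Yt v (upd v f r)) (V - {v}) (row v (upd v f r)) = csum (Yt v f) (V - {v}) r" for f r
    unfolding csum_def by (rule sum.cong) (use v in \<open>auto simp: Yt_inv row_upd\<close>)
  have pt: "Er v (\<lambda>r. of_bool (Ev2 v (upd v f r))) \<le> 2 * nn (-5)" for f
    unfolding Ev2_def inv
  proof (rule hoeffding_row)
    have "(\<Sum>u\<in>V - {v}. (Yt v f u)\<^sup>2) = N - 1" using card_row[OF v] by (simp add: Yt_pm N_def)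
    then show "(\<Sum>u\<in>V - {v}. (Yt v f u)\<^sup>2) \<le> 3 * nn 1" using N_minus_1_bounds(2) by simp
    have "6 * (nn 1 * nn (1/1000)) \<le> nn (12/10)" unfolding nn_mult by (rule nn_absorb) auto
    then show "2 * (3 * nn 1) * nn (1/1000) \<le> (nn (6/10))\<^sup>2" by (simp add: nn_power)
  qed auto
  show ?thesis by (subst resampleE[OF v]) (rule EE_le_const[OF finite_set_PP pt])
qed

definition Bad where "Bad f \<longleftrightarrow> (\<exists>v\<in>V. Ev2 v f) \<or> (\<exists>v\<in>V. \<exists>w\<in>V - {v}. Ev1 v w f)"

text \<open>A union bound over N + N (N - 1) = N^2 events.\<close>

lemma Bad_tail: "measure_pmf.prob PP {f. Bad f} \<le> nn (-2)"
proof -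
  have b: "of_bool (Bad f) \<le> (\<Sum>v\<in>V. (of_bool (Ev2 v f) + (\<Sum>w\<in>V - {v}. of_bool (Ev1 v w f)) :: real))" for f
  proof (cases "Bad f")
    case True
    then obtain v where v: "v \<in> V" "Ev2 v f \<or> (\<exists>w\<in>V - {v}. Ev1 v w f)" unfolding Bad_def by blast
    have "1 \<le> of_bool (Ev2 v f) + (\<Sum>w\<in>V - {v}. of_bool (Ev1 v w f) :: real)"
    proof (cases "Ev2 v f")
      case False
      then obtain w where w: "w \<in> V - {v}" "Ev1 v w f" using v by blast
      have "of_bool (Ev1 v w f) \<le> (\<Sum>w\<in>V - {v}. of_bool (Ev1 v w f) :: real)"
        by (rule member_le_sum[OF w(1)]) (use finV in auto)
      then show ?thesis using w by simp
    qed (simp add: sum_nonneg)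
    also have "\<dots> \<le> (\<Sum>v\<in>V. (of_bool (Ev2 v f) + (\<Sum>w\<in>V - {v}. of_bool (Ev1 v w f)) :: real))"
      by (rule member_le_sum[OF v(1)]) (use finV in \<open>auto intro!: add_nonneg_nonneg sum_nonneg\<close>)
    finally show ?thesis using True by simp
  qed (auto intro!: sum_nonneg add_nonneg_nonneg)
  have "measure_pmf.prob PP {f. Bad f} = EE PP (\<lambda>f. of_bool (Bad f))" unfolding EE_prob by simp
  also have "\<dots> \<le> EE PP (\<lambda>f. \<Sum>v\<in>V. (of_bool (Ev2 v f) + (\<Sum>w\<in>V - {v}. of_bool (Ev1 v w f))))" by (rule EE_mono[OF finite_set_PP]) (rule b)
  also have "\<dots> = (\<Sum>v\<in>V. (EE PP (\<lambda>f. of_bool (Ev2 v f)) + (\<Sum>w\<in>V - {v}. EE PP (\<lambda>f. of_bool (Ev1 v w f)))))"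
    unfolding EE_sum[OF finite_set_PP] EE_add[OF finite_set_PP] ..
  also have "\<dots> \<le> (\<Sum>v\<in>V. (2 * nn (-5) + (\<Sum>w\<in>V - {v}. 2 * nn (-5))))"
    by (intro sum_mono add_mono Ev1_prob Ev2_prob) auto
  also have "\<dots> = (\<Sum>v\<in>V. N * (2 * nn (-5)))"
  proof (rule sum.cong[OF refl])
    fix v assume "v \<in> V"
    then have "(\<Sum>w\<in>V - {v}. 2 * nn (-5)) = (N - 1) * (2 * nn (-5))" by (simp only: sum_constant card_row N_def)
    then show "2 * nn (-5) + (\<Sum>w\<in>V - {v}. 2 * nn (-5)) = N * (2 * nn (-5))" by (simp only: left_diff_distrib)
  qed
  also have "\<dots> = N * (N * (2 * nn (-5)))" by (simp add: N_def)
  also have "\<dots> \<le> (3 * nn 1) * ((3 * nn 1) * (2 * nn (-5)))" using N_bounds by (intro mult_mono) auto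
  also have "\<dots> = 18 * (nn 1 * (nn 1 * nn (-5)))" by simp
  also have "\<dots> \<le> nn (-2)" unfolding nn_mult by (rule nn_absorb) auto
  finally show ?thesis .
qed

text \<open>In both \<open>D2 f v\<close> and \<open>S2 f\<close> the colors are exchanged for the
  predictions \<open>Yt\<close>, at the cost of the few vertices counted by \<open>QQ\<close>. The
  predictions ignore the edges at v, so v sees the fraction p of their sum up to n^(6/10). What
  remains is at least n^(993/1000) against errors of order n^(985/1000).\<close>

lemma unanimous_after_step_3:
  assumes z: "z = 1 \<or> z = -1" and S: "z * S2 f \<ge> nn (994/1000)" and Z: "ZZ f < nn (51/100)" and Q: "QQ f < nn (985/1000)"
    and B: "\<not> Bad f" and v: "v \<in> V"
  shows "Y3 f v = z"
proof -
  have K: "KN v f \<le> nn (51/100)" using KN_ZZ[OF v, of f] Z by linarith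
  have d: "\<bar>Y2 f w - Yt v f w\<bar> \<le> 2 * of_bool (\<bar>D1 f w\<bar> \<le> tau)" if w: "w \<in> V - {v}" for w
  proof (cases "\<bar>D1 f w\<bar> \<le> tau")
    case True
    have "\<bar>Y2 f w - Yt v f w\<bar> \<le> 2" using Y2_pm(1)[of f w] Yt_pm(1)[of v f w] by linarith
    then show ?thesis using True by simp
  next
    case False
    have "\<not> Ev1 v w f" using B v w unfolding Bad_def by blast
    then have "\<bar>cs v f w (row v f)\<bar> \<le> tau / 8" using K unfolding Ev1_def by linarith
    then have "Y2 f w = Yt v f w" using Y2_eq_Yt[OF v _ _ _ tau4, of w f] w False by auto
    then show ?thesis by simp
  qed
  have Q': "(\<Sum>w\<in>V - {v}. 2 * of_bool (\<bar>D1 f w\<bar> \<le> tau)) \<le> 2 * QQ f"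
    unfolding QQ_def sum_distrib_left by (rule sum_mono2) (use finV in auto)
  let ?A = "\<Sum>w\<in>V - {v}. of_bool (f {v,w}) * Yt v f w" and ?B = "\<Sum>w\<in>V - {v}. Yt v f w"
  have 1: "\<bar>D2 f v - ?A\<bar> \<le> 2 * QQ f"
  proof -
    have "D2 f v - ?A = (\<Sum>w\<in>V - {v}. of_bool (f {v,w}) * (Y2 f w - Yt v f w))" unfolding D2_def by (simp only: sum_subtractf right_diff_distrib)
    then have "\<bar>D2 f v - ?A\<bar> \<le> (\<Sum>w\<in>V - {v}. 2 * of_bool (\<bar>D1 f w\<bar> \<le> tau))"
    proof (simp only:, intro order_trans[OF sum_abs] sum_mono)
      fix w assume w: "w \<in> V - {v}"
      have "\<bar>of_bool (f {v,w}) * (Y2 f w - Yt v f w)\<bar> \<le> 1 * \<bar>Y2 f w - Yt v f w\<bar>" unfolding abs_mult by (intro mult_right_mono) auto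
      then have "\<bar>of_bool (f {v,w}) * (Y2 f w - Yt v f w)\<bar> \<le> \<bar>Y2 f w - Yt v f w\<bar>" unfolding mult_1_left .
      then show "\<bar>of_bool (f {v,w}) * (Y2 f w - Yt v f w)\<bar> \<le> 2 * of_bool (\<bar>D1 f w\<bar> \<le> tau)" by (rule order_trans[OF _ d[OF w]])
    qed
    then show ?thesis using Q' by linarith
  qed
  have 2: "\<bar>S2 f - ?B\<bar> \<le> 2 * QQ f + 1"
  proof -
    have "S2 f - ?B = Y2 f v + (\<Sum>w\<in>V - {v}. (Y2 f w - Yt v f w))" unfolding S2_def sum_subtractf by (simp add: sum.remove[OF finV v])
    moreover have "\<bar>\<Sum>w\<in>V - {v}. (Y2 f w - Yt v f w)\<bar> \<le> 2 * QQ f"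
      by (rule order_trans[OF sum_abs order_trans[OF sum_mono[OF d] Q']])
    ultimately show ?thesis using Y2_pm(1)[of f v] by linarith
  qed
  have 3: "\<bar>?A - p * ?B\<bar> < nn (6/10)"
  proof -
    have "csum (Yt v f) (V - {v}) (row v f) = ?A - p * ?B"
      unfolding csum_def row_def sum_distrib_left sum_subtractf[symmetric] by (rule sum.cong) (auto simp: algebra_simps)
    then show ?thesis using B v unfolding Bad_def Ev2_def by force
  qed
  have zz: "\<bar>z * a\<bar> = \<bar>a\<bar>" for a using z by auto
  have p2: "p * (z * ?B) \<ge> p * (z * S2 f) - (2 * QQ f + 1)"
  proof -
    have "\<bar>z * (S2 f - ?B)\<bar> \<le> 2 * QQ f + 1" unfolding zz by (rule 2)
    then have "\<bar>p * (z * (S2 f - ?B))\<bar> \<le> 1 * (2 * QQ f + 1)" unfolding abs_mult[of p] using p by (intro mult_mono) auto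
    then show ?thesis by (simp add: right_diff_distrib abs_le_iff)
  qed
  have a1: "\<bar>z * (D2 f v - ?A)\<bar> \<le> 2 * QQ f" unfolding zz by (rule 1)
  have a3: "\<bar>z * (?A - p * ?B)\<bar> < nn (6/10)" unfolding zz by (rule 3)
  have big: "p * (z * S2 f) \<ge> nn (993/1000)"
  proof -
    have "nn (-1/1000) * nn (994/1000) \<le> p * (z * S2 f)" using p_lower(1) S p by (intro mult_mono) auto
    then show ?thesis by (simp add: nn_mult)
  qed
  have n1: "10 * nn (985/1000) \<le> nn (993/1000)" by (rule nn_absorb) auto
  have n2: "nn (6/10) \<le> nn (985/1000)" "1 \<le> nn (985/1000)" using nn_mono[of "6/10" "985/1000"] nn_mono[of 0 "985/1000"] nn_1(2) by auto
  have e: "z * (D2 f v - ?A) = z * D2 f v - z * ?A" "z * (?A - p * ?B) = z * ?A - p * (z * ?B)" by (simp_all add: algebra_simps)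
  have "z * D2 f v \<ge> 1" using a1 a3 p2 big n1 n2 Q unfolding e abs_le_iff abs_less_iff by linarith
  then show ?thesis using z Y2_pm(2)[of f v] unfolding Y3_def sg_def by auto
qed

text \<open>The threshold lies a factor of about n^(-2/1000) below the standard deviation: rarely
  missed, yet large enough for the surplus n^(994/1000) at time 2, which must exceed n^(990/1000)
  from \<open>U_sum_tail\<close> and the errors n^(985/1000) from \<open>QQ\<close>.\<close>

lemma S1_anticoncentration: "measure_pmf.prob PP {f. \<bar>S1 f\<bar> < nn (498/1000)} \<le> nn (-1/1000)"
proof -
  let ?s = "nn (498/1000)"
  have "measure_pmf.prob PP {f. \<bar>S1 f\<bar> < ?s} \<le> EE PP (\<lambda>f. of_bool (S1 f \<le> ?s) - of_bool (S1 f \<le> - ?s))"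
    unfolding EE_prob
  proof (rule EE_mono[OF finite_set_PP])
    fix f
    have "- ?s \<le> ?s" by simp
    then consider "S1 f \<le> - ?s" "S1 f \<le> ?s" | "\<not> S1 f \<le> - ?s" by linarith
    then show "of_bool (f \<in> {f. \<bar>S1 f\<bar> < ?s}) \<le> of_bool (S1 f \<le> ?s) - (of_bool (S1 f \<le> - ?s) :: real)"
      by cases (auto simp: abs_less_iff)
  qed
  also have "\<dots> = measure_pmf.prob PP {f. S1 f \<le> ?s} - measure_pmf.prob PP {f. S1 f \<le> - ?s}"
    unfolding EE_diff[OF finite_set_PP] EE_prob by simp
  also have "\<dots> \<le> (Phi ((?s - mu) / sig) - Phi ((- ?s - mu) / sig)) + 14 * nn (-1/400)"
    using clt_S1[of ?s] clt_S1[of "- ?s"] by linarith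
  also have "Phi ((?s - mu) / sig) - Phi ((- ?s - mu) / sig) \<le> 2 * ?s * (1 / sig)"
  proof -
    have "(?s - mu) / sig - (- ?s - mu) / sig = 2 * ?s * (1 / sig)" by (simp add: diff_divide_distrib[symmetric])
    moreover have "0 \<le> 2 * ?s * (1 / sig)" using sig_bounds(2) by simp
    ultimately show ?thesis using Phi_lipschitz[of "(?s - mu) / sig" "(- ?s - mu) / sig"] by simp
  qed
  also have "2 * ?s * (1 / sig) \<le> 2 * ?s * nn (-1/2)" using sig_bounds(4) by (intro mult_left_mono) auto
  also have "2 * ?s * nn (-1/2) = 2 * nn (498/1000 + -1/2)" unfolding nn_mult[symmetric] by simp
  also have "2 * nn (498/1000 + -1/2) \<le> 2 * nn (-2/1000)" by (intro mult_left_mono nn_mono) auto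
  finally have "measure_pmf.prob PP {f. \<bar>S1 f\<bar> < ?s} \<le> 2 * nn (-2/1000) + 14 * nn (-1/400)" by simp
  also have "\<dots> \<le> 16 * nn (-2/1000)" using nn_mono[of "-1/400" "-2/1000"] by simp
  also have "\<dots> \<le> nn (-1/1000)" by (rule nn_absorb) auto
  finally show ?thesis .
qed

definition Good where "Good f \<longleftrightarrow> (S1 f > 0 \<and> (\<forall>v\<in>V. Y3 f v = 1)) \<or> (S1 f < 0 \<and> (\<forall>v\<in>V. Y3 f v = -1))"

lemma not_Good_tail: "measure_pmf.prob PP {f. \<not> Good f} \<le> 5 * nn (-1/1000)"
proof -
  let ?A = "{f. \<bar>S1 f\<bar> < nn (498/1000)}" and ?B = "{f. nn (990/1000) \<le> \<bar>\<Sum>w\<in>V. U f w\<bar>}"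
    and ?C = "{f. nn (51/100) \<le> ZZ f}" and ?D = "{f. nn (985/1000) \<le> QQ f}" and ?E = "{f. Bad f}"
  have sub: "{f. \<not> Good f} \<subseteq> ?A \<union> (?B \<union> (?C \<union> (?D \<union> ?E)))"
  proof (rule subsetI, rule ccontr)
    fix f assume ng: "f \<in> {f. \<not> Good f}" and "f \<notin> ?A \<union> (?B \<union> (?C \<union> (?D \<union> ?E)))"
    then have a: "\<not> \<bar>S1 f\<bar> < nn (498/1000)" "\<bar>\<Sum>w\<in>V. U f w\<bar> < nn (990/1000)" "ZZ f < nn (51/100)" "QQ f < nn (985/1000)" "\<not> Bad f" by auto
    define z where "z = sg (S1 f)"
    have z: "z = 1 \<or> z = -1" by (auto simp: z_def sg_def)
    have zS: "z * S1 f = \<bar>S1 f\<bar>" by (auto simp: z_def sg_def)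
    have "z * S2 f \<ge> nn (994/1000)" by (rule S2_lower[OF z _ a(2)]) (use zS a(1) in linarith)
    then have w: "Y3 f v = z" if "v \<in> V" for v by (rule unanimous_after_step_3[OF z _ a(3-5) that])
    have "0 < \<bar>S1 f\<bar>" using a(1) nn_pos[of "498/1000"] by linarith
    then have "Good f" unfolding Good_def using w by (auto simp: z_def sg_def split: if_splits)
    then show False using ng by simp
  qed
  have "measure_pmf.prob PP {f. \<not> Good f} \<le> measure_pmf.prob PP (?A \<union> (?B \<union> (?C \<union> (?D \<union> ?E))))"
    by (rule measure_pmf.finite_measure_mono[OF sub]) simp
  also have "\<dots> \<le> measure_pmf.prob PP ?A + (measure_pmf.prob PP ?B + (measure_pmf.prob PP ?C + (measure_pmf.prob PP ?D + measure_pmf.prob PP ?E)))"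
    by (intro order_trans[OF measure_Un_le] add_left_mono) auto
  also have "\<dots> \<le> nn (-1/1000) + (nn (-3/1000) + (nn (-8/1000) + (nn (-13/1000) + nn (-2))))"
    by (intro add_mono S1_anticoncentration U_sum_tail ZZ_tail QQ_tail Bad_tail)
  also have "\<dots> \<le> 5 * nn (-1/1000)"
    using nn_mono[of "-3/1000" "-1/1000"] nn_mono[of "-8/1000" "-1/1000"] nn_mono[of "-13/1000" "-1/1000"] nn_mono[of "-2" "-1/1000"] by simp
  finally show ?thesis .
qed

end

section \<open>Conclusion\<close>

context majority begin

section \<open>From sign vectors to the set-valued dynamics\<close>

definition Eset :: "('a set \<Rightarrow> bool) \<Rightarrow> 'a set set" where "Eset f = {e \<in> all_edges V. f e}"

text \<open>The difference of the neighbor counts is an integer, so doubling it and adding the own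
  color decides by majority and resolves a tie in favor of staying.\<close>

lemma majority_step_sign:
  fixes y :: "'a \<Rightarrow> real" and f :: "'a set \<Rightarrow> bool"
  assumes y: "\<And>v. v \<in> V \<Longrightarrow> y v = 1 \<or> y v = -1"
  defines "y' \<equiv> \<lambda>v. sg (2 * (\<Sum>u\<in>V - {v}. of_bool (f {v,u}) * y u) + y v)"
  shows "majority_step (Eset f) ({v\<in>V. y v = -1}, {v\<in>V. y v = 1}) = ({v\<in>V. y' v = -1}, {v\<in>V. y' v = 1})"
proof -
  let ?E = "Eset f" and ?B = "{v\<in>V. y v = -1}" and ?R = "{v\<in>V. y v = 1}"
  let ?r = "\<lambda>v. card (neighbors ?E v \<inter> ?R)" and ?b = "\<lambda>v. card (neighbors ?E v \<inter> ?B)"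
  have diff: "(\<Sum>u\<in>V - {v}. of_bool (f {v,u}) * y u) = real (?r v) - real (?b v)" if v: "v \<in> V" for v
  proof -
    have nR: "neighbors ?E v \<inter> ?R = {u\<in>V - {v}. f {v,u} \<and> y u = 1}"
      unfolding neighbors_def Eset_def using edge_iff[OF v] by (auto simp: all_edges_def)
    have nB: "neighbors ?E v \<inter> ?B = {u\<in>V - {v}. f {v,u} \<and> y u = -1}"
      unfolding neighbors_def Eset_def using edge_iff[OF v] by (auto simp: all_edges_def)
    have "(\<Sum>u\<in>V - {v}. of_bool (f {v,u}) * y u) = (\<Sum>u\<in>V - {v}. of_bool (f {v,u} \<and> y u = 1) - of_bool (f {v,u} \<and> y u = -1))"
      by (rule sum.cong) (use y in force)+
    also have "\<dots> = (\<Sum>u\<in>V - {v}. of_bool (f {v,u} \<and> y u = 1)) - (\<Sum>u\<in>V - {v}. of_bool (f {v,u} \<and> y u = -1))"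
      by (rule sum_subtractf)
    also have "(\<Sum>u\<in>V - {v}. of_bool (f {v,u} \<and> y u = 1)) = real (card {u\<in>V - {v}. f {v,u} \<and> y u = 1})"
      using finV by (simp add: sum_of_bool_eq Int_def)
    also have "(\<Sum>u\<in>V - {v}. of_bool (f {v,u} \<and> y u = -1)) = real (card {u\<in>V - {v}. f {v,u} \<and> y u = -1})"
      using finV by (simp add: sum_of_bool_eq Int_def)
    finally show ?thesis unfolding nR nB .
  qed
  have red: "y' v = 1 \<longleftrightarrow> (if y v = 1 then \<not> ?r v < ?b v else ?b v < ?r v)" if v: "v \<in> V" for v
    unfolding y'_def diff[OF v] using y[OF v] by (auto simp: sg_def)
  have blue: "y' v = -1 \<longleftrightarrow> y' v \<noteq> 1" for v by (auto simp: y'_def sg_def)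
  show ?thesis unfolding majority_step_def moves_def prod.case
  proof (intro arg_cong2[where f=Pair] set_eqI)
    fix v
    show "(v \<in> {v \<in> ?B. \<not> ?b v < ?r v} \<union> {v \<in> ?R. ?r v < ?b v}) = (v \<in> {v\<in>V. y' v = -1})"
      using red[of v] y[of v] unfolding blue by (cases "v \<in> V") auto
    show "(v \<in> {v \<in> ?R. \<not> ?r v < ?b v} \<union> {v \<in> ?B. ?b v < ?r v}) = (v \<in> {v\<in>V. y' v = 1})"
      using red[of v] y[of v] by (cases "v \<in> V") auto
  qed
qed

lemma initial_state: "(B0, R0) = ({v\<in>V. real_of_int (x v) = -1}, {v\<in>V. real_of_int (x v) = 1})"
  using V disj by (auto simp: x_def)

lemma Y_step: "Y f v = sg (2 * (\<Sum>u\<in>V - {v}. of_bool (f {v,u}) * real_of_int (x u)) + real_of_int (x v))"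
proof -
  have "real_of_int (DX {} f v) = (\<Sum>u\<in>V - {v}. of_bool (f {v,u}) * real_of_int (x u))"
    unfolding DX_def of_int_sum by (rule sum.cong) auto
  then show ?thesis unfolding Y_def by simp
qed

lemma state_after_1: "(majority_step (Eset f) ^^ 1) (B0, R0) = ({v\<in>V. Y f v = -1}, {v\<in>V. Y f v = 1})"
proof -
  have "majority_step (Eset f) (B0, R0) = ({v\<in>V. Y f v = -1}, {v\<in>V. Y f v = 1})"
    unfolding initial_state Y_step by (rule majority_step_sign) (use x_cases in force)
  then show ?thesis by simp
qed

lemma state_after_3: "(majority_step (Eset f) ^^ 3) (B0, R0) = ({v\<in>V. Y3 f v = -1}, {v\<in>V. Y3 f v = 1})"
proof -
  have 2: "majority_step (Eset f) ({v\<in>V. Y f v = -1}, {v\<in>V. Y f v = 1}) = ({v\<in>V. Y2 f v = -1}, {v\<in>V. Y2 f v = 1})"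
    unfolding Y2_def D1_def by (rule majority_step_sign) (use Y_pm(2) in blast)
  have 3: "majority_step (Eset f) ({v\<in>V. Y2 f v = -1}, {v\<in>V. Y2 f v = 1}) = ({v\<in>V. Y3 f v = -1}, {v\<in>V. Y3 f v = 1})"
    unfolding Y3_def D2_def by (rule majority_step_sign) (use Y2_pm(2) in blast)
  have "(majority_step (Eset f) ^^ 3) (B0, R0) = majority_step (Eset f) (majority_step (Eset f) ((majority_step (Eset f) ^^ 1) (B0, R0)))"
    by (simp add: numeral_3_eq_3)
  then show ?thesis unfolding state_after_1 2 3 .
qed

lemma S1_card: "S1 f = real (card {v\<in>V. Y f v = 1}) - real (card {v\<in>V. Y f v = -1})"
proof -
  have "S1 f = (\<Sum>v\<in>V. of_bool (Y f v = 1) - of_bool (Y f v = -1))"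
    unfolding S1_def by (rule sum.cong) (use Y_pm(2) in force)+
  also have "\<dots> = (\<Sum>v\<in>V. of_bool (Y f v = 1)) - (\<Sum>v\<in>V. of_bool (Y f v = -1))" by (rule sum_subtractf)
  finally show ?thesis using finV by (simp add: sum_of_bool_eq Int_def)
qed

lemma all_iff_card: "card {v\<in>V. P v} = card V \<longleftrightarrow> (\<forall>v\<in>V. P v)"
proof
  assume "card {v\<in>V. P v} = card V"
  then have "{v\<in>V. P v} = V" using finV by (intro card_subset_eq) auto
  then show "\<forall>v\<in>V. P v" by blast
next
  assume "\<forall>v\<in>V. P v"
  then have "{v\<in>V. P v} = V" by blast
  then show "card {v\<in>V. P v} = card V" by simp
qed

lemma erdos_renyi_prob: "measure_pmf.prob (erdos_renyi V p) {E. Q E} = measure_pmf.prob PP {f. Q (Eset f)}"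
proof -
  have "erdos_renyi V p = map_pmf Eset PP" unfolding erdos_renyi_def PP_def bern_def Eset_def ..
  then show ?thesis by (simp add: measure_map_pmf vimage_def)
qed

end

context regime begin

lemma V_ne: "V \<noteq> {}" using N_bounds(2) by (auto simp: N_def)

lemma Good_event:
  "((card (red (Eset f) B0 R0 1) > card (blue (Eset f) B0 R0 1) \<and> red_wins_by (Eset f) B0 R0 3) \<or>
    (card (blue (Eset f) B0 R0 1) > card (red (Eset f) B0 R0 1) \<and> blue_wins_by (Eset f) B0 R0 3)) \<longleftrightarrow> Good f"
proof -
  have BR: "B0 \<union> R0 = V" using V by auto
  have r: "red_wins_by (Eset f) B0 R0 3 \<longleftrightarrow> (\<forall>v\<in>V. Y3 f v = 1)"
    unfolding red_wins_by_def red_def state_after_3 BR by auto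
  have b: "blue_wins_by (Eset f) B0 R0 3 \<longleftrightarrow> (\<forall>v\<in>V. Y3 f v = -1)"
    unfolding blue_wins_by_def blue_def state_after_3 BR by auto
  have 1: "card (red (Eset f) B0 R0 1) > card (blue (Eset f) B0 R0 1) \<longleftrightarrow> S1 f > 0"
    "card (blue (Eset f) B0 R0 1) > card (red (Eset f) B0 R0 1) \<longleftrightarrow> S1 f < 0"
    unfolding red_def blue_def state_after_1 S1_card by auto
  show ?thesis unfolding Good_def r b 1 ..
qed

lemma red3_event: "card (red (Eset f) B0 R0 3) = 2 * n + \<Delta> \<longleftrightarrow> (\<forall>v\<in>V. Y3 f v = 1)"
  unfolding red_def state_after_3 snd_conv cV[symmetric] by (rule all_iff_card)

lemma prob_first:
  "measure_pmf.prob (erdos_renyi V p)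
       {E. (card (red E B0 R0 1) > card (blue E B0 R0 1) \<and> red_wins_by E B0 R0 3) \<or>
           (card (blue E B0 R0 1) > card (red E B0 R0 1) \<and> blue_wins_by E B0 R0 3)} \<ge> 1 - 5 * nn (-1/1000)"
proof -
  have "measure_pmf.prob PP {f. \<not> Good f} = 1 - measure_pmf.prob PP {f. Good f}"
    using measure_pmf.prob_compl[of "{f. Good f}" PP] by (simp add: Collect_neg_eq Compl_eq_Diff_UNIV)
  then show ?thesis unfolding erdos_renyi_prob Good_event using not_Good_tail by linarith
qed

section \<open>The mean of the surplus and the argument of Phi\<close>

definition tt :: real where "tt = p * real \<Delta> * sqrt 2 / sqrt (pi * p * (1 - p))"

text \<open>Summing \<open>mv_approx\<close> over V, the initial colors contribute only (1 - 2 p) *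
  \<open>\<Delta>\<close> and the common drift 2 p * \<open>\<Delta>\<close> remains N
  times.\<close>

lemma mu_approx: "\<bar>mu - 2 * p * real \<Delta> * N * P0\<bar> \<le> nn (41/100)"
proof -
  let ?c = "\<lambda>v. P0 * (x v + 2 * p * (real \<Delta> - x v))"
  have "\<bar>mu - (\<Sum>v\<in>V. ?c v)\<bar> \<le> (\<Sum>v\<in>V. nn (-3/5))"
    unfolding mu_def sum_subtractf[symmetric] by (rule order_trans[OF sum_abs sum_mono]) (rule mv_approx)
  also have "\<dots> = N * nn (-3/5)" by (simp add: N_def)
  also have "\<dots> \<le> (3 * nn 1) * nn (-3/5)" using N_bounds by (intro mult_right_mono) auto
  also have "\<dots> = 3 * nn (1 + -3/5)" unfolding nn_mult[symmetric] by simp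
  finally have 1: "\<bar>mu - (\<Sum>v\<in>V. ?c v)\<bar> \<le> 3 * nn (2/5)" by simp
  have "(\<Sum>v\<in>V. ?c v) = P0 * ((1 - 2 * p) * (\<Sum>v\<in>V. real_of_int (x v)) + 2 * p * real \<Delta> * N)"
  proof -
    have "(\<Sum>v\<in>V. ?c v) = (\<Sum>v\<in>V. P0 * ((1 - 2 * p) * real_of_int (x v)) + P0 * (2 * p * real \<Delta>))"
      by (rule sum.cong) (auto simp: algebra_simps)
    also have "\<dots> = P0 * ((1 - 2 * p) * (\<Sum>v\<in>V. real_of_int (x v))) + N * (P0 * (2 * p * real \<Delta>))"
      unfolding sum.distrib sum_distrib_left by (simp add: N_def)
    finally show ?thesis by (simp add: algebra_simps)
  qed
  then have 2: "(\<Sum>v\<in>V. ?c v) - 2 * p * real \<Delta> * N * P0 = P0 * ((1 - 2 * p) * real \<Delta>)" unfolding sum_x by (simp add: algebra_simps)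
  have "\<bar>P0 * ((1 - 2 * p) * real \<Delta>)\<bar> \<le> nn (-499/1000) * (1 * nn (1/1000))"
    unfolding abs_mult using P0_bounds \<Delta>b p by (intro mult_mono) (auto simp: abs_le_iff)
  also have "\<dots> = nn (-499/1000 + 1/1000)" unfolding nn_mult[symmetric] by simp
  also have "\<dots> \<le> nn (2/5)" by (rule nn_mono) simp
  finally have "\<bar>mu - 2 * p * real \<Delta> * N * P0\<bar> \<le> 4 * nn (2/5)" using 1 2 by linarith
  also have "\<dots> \<le> nn (41/100)" by (rule nn_absorb) auto
  finally show ?thesis .
qed

text \<open>In 2 * sig * \<open>P0\<close> the quotient sqrt (N / m3) tends to sqrt 2, which is the
  factor in the theorem; the 4 under the root of \<open>P0\<close> cancels the 2.\<close>

lemma mu_tt: "\<bar>mu / sig - tt\<bar> \<le> nn (-1/20)"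
proof -
  have a: "\<bar>mu / sig - 2 * p * real \<Delta> * sig * P0\<bar> \<le> nn (-9/100)"
  proof -
    have "2 * p * real \<Delta> * N * P0 / sig = 2 * p * real \<Delta> * sig * P0" unfolding sig_bounds(3)[symmetric] using sig_bounds(2) by simp
    then have "\<bar>mu / sig - 2 * p * real \<Delta> * sig * P0\<bar> = \<bar>mu - 2 * p * real \<Delta> * N * P0\<bar> * (1 / sig)"
      using sig_bounds(2) by (metis abs_divide abs_of_pos diff_divide_distrib mult.right_neutral times_divide_eq_right)
    also have "\<dots> \<le> nn (41/100) * nn (-1/2)" using mu_approx sig_bounds by (intro mult_mono) auto
    also have "\<dots> = nn (-9/100)" by (simp add: nn_mult)
    finally show ?thesis .
  qed
  define D where "D = sqrt (pi * (p * q))"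
  have Dpos: "0 < D" using p q by (simp add: D_def)
  have b: "2 * sig * P0 = sqrt (N / m3) / D"
  proof -
    have "sqrt (4 * pi * (m3 * (p * q))) = sqrt (4 * (m3 * (pi * (p * q))))" by (simp add: mult_ac)
    also have "\<dots> = 2 * (sqrt m3 * D)" unfolding D_def real_sqrt_mult by simp
    finally have "P0 = 1 / (2 * (sqrt m3 * D))" unfolding P0_def by simp
    then show ?thesis unfolding sig_def real_sqrt_divide by simp
  qed
  have c: "tt = p * real \<Delta> * (sqrt 2 / D)" unfolding tt_def D_def q_def by (simp add: mult.assoc)
  have eq: "2 * p * real \<Delta> * sig * P0 - tt = (p * real \<Delta>) * ((sqrt (N / m3) - sqrt 2) / D)"
  proof -
    have "2 * p * real \<Delta> * sig * P0 = p * real \<Delta> * (2 * sig * P0)" by simp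
    then show ?thesis unfolding b c by (simp add: right_diff_distrib diff_divide_distrib)
  qed
  have e1: "\<bar>sqrt (N / m3) - sqrt 2\<bar> \<le> nn (-99/100)"
  proof -
    have Nm: "N = 2 * m3 + (real \<Delta> + 6)" using n_ge_10 unfolding N_def cV m3_def by simp
    then have q2: "N / m3 = 2 + (real \<Delta> + 6) / m3" using m3(3) by (simp add: add_divide_distrib)
    have d0: "0 \<le> (real \<Delta> + 6) / m3" using m3(3) by simp
    have "sqrt (N / m3) \<le> sqrt 2 + (real \<Delta> + 6) / m3"
    proof (rule real_le_lsqrt)
      show "0 \<le> sqrt 2 + (real \<Delta> + 6) / m3" using d0 by simp
      have "2 + (real \<Delta> + 6) / m3 \<le> 2 + 2 * sqrt 2 * ((real \<Delta> + 6) / m3) + ((real \<Delta> + 6) / m3)\<^sup>2"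
      proof -
        have "1 * ((real \<Delta> + 6) / m3) \<le> 2 * sqrt 2 * ((real \<Delta> + 6) / m3)" 
        proof (rule mult_right_mono[OF _ d0])
          have "1 \<le> sqrt 2" by simp
          then show "1 \<le> 2 * sqrt 2" by linarith
        qed
        then show ?thesis using zero_le_power2[of "(real \<Delta> + 6) / m3"] by linarith
      qed
      then show "N / m3 \<le> (sqrt 2 + (real \<Delta> + 6) / m3)\<^sup>2" unfolding q2 power2_sum by simp
    qed
    moreover have "sqrt 2 \<le> sqrt (N / m3)" unfolding q2 using d0 by simp
    ultimately have "\<bar>sqrt (N / m3) - sqrt 2\<bar> \<le> (real \<Delta> + 6) / m3" by linarith
    also have "\<dots> \<le> (2 * nn (1/1000)) / ((1/2) * nn 1)"
    proof (rule frac_le)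
      show "real \<Delta> + 6 \<le> 2 * nn (1/1000)" using \<Delta>b nb by linarith
    qed (use m3 in auto)
    also have "\<dots> = 4 * (nn (1/1000) / nn 1)" by simp
    also have "\<dots> \<le> nn (-99/100)" unfolding nn_divide by (rule nn_absorb) auto
    finally show ?thesis .
  qed
  have e2: "1 / D \<le> nn (1/100)"
  proof -
    have "nn (-1/1000) \<le> 1 * (p * q)" using pqb by simp
    also have "\<dots> \<le> pi * (p * q)" using pq pi_gt3 by (intro mult_right_mono) auto
    finally have "sqrt (nn (-1/1000)) \<le> D" unfolding D_def by (rule real_sqrt_le_mono)
    then have "nn (-1/2000) \<le> D" unfolding nn_sqrt by simp
    then have "1 / D \<le> 1 / nn (-1/2000)" using Dpos by (intro divide_left_mono) auto
    also have "\<dots> = nn (1/2000)" using nn_divide[of 0 "-1/2000"] nn_1(2) by simp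
    also have "\<dots> \<le> nn (1/100)" by (rule nn_mono) simp
    finally show ?thesis .
  qed
  have "\<bar>2 * p * real \<Delta> * sig * P0 - tt\<bar> = (p * real \<Delta>) * (\<bar>sqrt (N / m3) - sqrt 2\<bar> * (1 / D))"
    unfolding eq abs_mult abs_divide using p Dpos by simp
  also have "\<dots> \<le> (1 * nn (1/1000)) * (nn (-99/100) * nn (1/100))"
    using p \<Delta>b e1 e2 Dpos by (intro mult_mono) auto
  also have "\<dots> = nn (1/1000 + (-99/100 + 1/100))" unfolding nn_mult[symmetric] by simp
  also have "\<dots> \<le> nn (-9/100)" by (rule nn_mono) simp
  finally have "\<bar>mu / sig - tt\<bar> \<le> 2 * nn (-9/100)" using a by linarith
  also have "\<dots> \<le> nn (-1/20)" by (rule nn_absorb) auto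
  finally show ?thesis .
qed

text \<open>On \<open>Good\<close>, red is unanimous exactly if \<open>S1\<close> is positive, and
  the central limit theorem gives that probability. The constant is 5 + 7 + 1: failure of
  \<open>Good\<close>, normal approximation, and \<open>tt\<close> in place of mu/sig.\<close>

lemma prob_second:
  "\<bar>measure_pmf.prob (erdos_renyi V p) {E. card (red E B0 R0 3) = 2 * n + \<Delta>} - Phi tt\<bar> \<le> 13 * nn (-1/1000)"
proof -
  let ?A = "{f. \<forall>v\<in>V. Y3 f v = 1}" and ?B = "{f. S1 f > 0}"
  have "\<bar>measure_pmf.prob PP ?A - measure_pmf.prob PP ?B\<bar> \<le> measure_pmf.prob PP {f. \<not> Good f}"
  proof -
    have "f \<in> ?A \<longleftrightarrow> f \<in> ?B" if "Good f" for f
    proof -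
      \<comment> \<open>A vertex is needed: on an empty set both colors would count as
        unanimous.\<close>
      obtain v where "v \<in> V" using V_ne by blast
      then show ?thesis using that unfolding Good_def by force
    qed
    then have "\<bar>of_bool (f \<in> ?A) - of_bool (f \<in> ?B)\<bar> \<le> (of_bool (f \<in> {f. \<not> Good f}) :: real)" for f
      by (cases "Good f") auto
    then show ?thesis unfolding EE_prob EE_diff[OF finite_set_PP, symmetric] by (intro EE_abs_le[OF finite_set_PP])
  qed
  then have 1: "\<bar>measure_pmf.prob PP ?A - measure_pmf.prob PP ?B\<bar> \<le> 5 * nn (-1/1000)" using not_Good_tail by linarith
  have B: "measure_pmf.prob PP ?B = 1 - measure_pmf.prob PP {f. S1 f \<le> 0}"
    using measure_pmf.prob_compl[of "{f. S1 f \<le> 0}" PP] by (simp add: Compl_eq_Diff_UNIV[symmetric] Collect_neg_eq[symmetric] not_le)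
  have "Phi ((0 - mu) / sig) = 1 - Phi (mu / sig)" using Phi_minus[of "mu / sig"] by simp
  then have 2: "\<bar>measure_pmf.prob PP ?B - Phi (mu / sig)\<bar> \<le> 7 * nn (-1/400)" using clt_S1[of 0] unfolding B by linarith
  have 3: "\<bar>Phi (mu / sig) - Phi tt\<bar> \<le> nn (-1/20)" using Phi_lipschitz[of "mu / sig" tt] mu_tt by linarith
  have "\<bar>measure_pmf.prob PP ?A - Phi tt\<bar> \<le> 13 * nn (-1/1000)"
    using 1 2 3 nn_mono[of "-1/400" "-1/1000"] nn_mono[of "-1/20" "-1/1000"] by linarith
  then show ?thesis unfolding erdos_renyi_prob red3_event .
qed

end

text \<open>The factor 2 in the last inequality pays for p (1 - p) being only at least half of the
  smaller of p and 1 - p.\<close>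

lemma eventually_regime:
  "\<exists>n0::nat. \<forall>n\<ge>n0. n \<ge> 10 \<and> 1000000 \<le> real n powr (1/1000) \<and> exp (- (real n powr (1/1000))) \<le> real n powr (-5)
     \<and> ln (real n) powr (1/4) \<le> real n powr (1/1000) \<and> 2 * real n powr (-1/1000) \<le> ln (real n) powr (-1/16)"
proof -
  have "eventually (\<lambda>n::nat. n \<ge> 10) sequentially" by (rule eventually_ge_at_top)
  moreover have "eventually (\<lambda>n::nat. 1000000 \<le> real n powr (1/1000)) sequentially" by real_asymp
  moreover have "eventually (\<lambda>n::nat. exp (- (real n powr (1/1000))) \<le> real n powr (-5)) sequentially" by real_asymp
  moreover have "eventually (\<lambda>n::nat. ln (real n) powr (1/4) \<le> real n powr (1/1000)) sequentially" by real_asymp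
  moreover have "eventually (\<lambda>n::nat. 2 * real n powr (-1/1000) \<le> ln (real n) powr (-1/16)) sequentially" by real_asymp
  ultimately have "eventually (\<lambda>n::nat. n \<ge> 10 \<and> 1000000 \<le> real n powr (1/1000) \<and> exp (- (real n powr (1/1000))) \<le> real n powr (-5)
     \<and> ln (real n) powr (1/4) \<le> real n powr (1/1000) \<and> 2 * real n powr (-1/1000) \<le> ln (real n) powr (-1/16)) sequentially"
    by eventually_elim blast
  then show ?thesis unfolding eventually_sequentially .
qed

theorem theorem1p3:
  "\<exists>c>0. \<exists>C>0. \<forall>(n::nat) (\<Delta>::nat) (p::real) (V::nat set) (R0::nat set) (B0::nat set).
     n \<ge> 1 \<longrightarrow>
     real \<Delta> \<le> ln (real n) powr (1/4) \<longrightarrow>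
     ln (real n) powr (-1/16) \<le> p \<longrightarrow>
     p \<le> 1 - ln (real n) powr (-1/16) \<longrightarrow>
     finite V \<longrightarrow> card V = 2 * n + \<Delta> \<longrightarrow>
     V = R0 \<union> B0 \<longrightarrow> R0 \<inter> B0 = {} \<longrightarrow>
     card R0 = n + \<Delta> \<longrightarrow> card B0 = n \<longrightarrow>
     measure_pmf.prob (erdos_renyi V p)
       {E. (card (red E B0 R0 1) > card (blue E B0 R0 1) \<and> red_wins_by E B0 R0 3) \<or>
           (card (blue E B0 R0 1) > card (red E B0 R0 1) \<and> blue_wins_by E B0 R0 3)}
       \<ge> 1 - C * real n powr (-c) \<and>
     \<bar>measure_pmf.prob (erdos_renyi V p) {E. card (red E B0 R0 3) = 2 * n + \<Delta>}
       - cdf std_normal_distribution (p * real \<Delta> * sqrt 2 / sqrt (pi * p * (1 - p)))\<bar>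
       \<le> C * real n powr (-c)"
proof -
  obtain n0 :: nat where n0: "\<And>n. n \<ge> n0 \<Longrightarrow> n \<ge> 10 \<and> 1000000 \<le> real n powr (1/1000) \<and> exp (- (real n powr (1/1000))) \<le> real n powr (-5)
     \<and> ln (real n) powr (1/4) \<le> real n powr (1/1000) \<and> 2 * real n powr (-1/1000) \<le> ln (real n) powr (-1/16)"
    using eventually_regime by blast
  \<comment> \<open>The second summand makes C * n^(-c) at least 1 for 1 <= n < n0, where both
    claims are then trivial; 13 is the constant of \<open>prob_second\<close>.\<close>
  define C where "C = 13 + real n0 powr (1/1000)"
  have C: "C > 0" "C \<ge> 13" by (simp_all add: C_def add_pos_nonneg)
  show ?thesis
  proof (rule exI[of _ "1/1000::real"], rule conjI[OF _ exI[of _ C]], simp, rule conjI[OF C(1)], intro allI impI)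
    fix n \<Delta> :: nat and p :: real and V R0 B0 :: "nat set"
    assume n1: "n \<ge> 1" and D: "real \<Delta> \<le> ln (real n) powr (1/4)" and p1: "ln (real n) powr (-1/16) \<le> p"
      and p2: "p \<le> 1 - ln (real n) powr (-1/16)" and V: "finite V" "card V = 2 * n + \<Delta>" "V = R0 \<union> B0" "R0 \<inter> B0 = {}"
      "card R0 = n + \<Delta>" "card B0 = n"
    let ?P1 = "measure_pmf.prob (erdos_renyi V p)
       {E. (card (red E B0 R0 1) > card (blue E B0 R0 1) \<and> red_wins_by E B0 R0 3) \<or>
           (card (blue E B0 R0 1) > card (red E B0 R0 1) \<and> blue_wins_by E B0 R0 3)}"
    let ?P2 = "measure_pmf.prob (erdos_renyi V p) {E. card (red E B0 R0 3) = 2 * n + \<Delta>}"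
    let ?F = "cdf std_normal_distribution (p * real \<Delta> * sqrt 2 / sqrt (pi * p * (1 - p)))"
    show "?P1 \<ge> 1 - C * real n powr (-(1/1000)) \<and> \<bar>?P2 - ?F\<bar> \<le> C * real n powr (-(1/1000))"
    proof (cases "n \<ge> n0")
      case True
      note r = n0[OF True]
      define a where "a = ln (real n) powr (-1/16)"
      have a: "2 * real n powr (-1/1000) \<le> a" using r by (simp add: a_def)
      have npos: "0 < real n powr (-1/1000)" using n1 by simp
      have a0: "0 < a" using a npos by linarith
      have pa: "a \<le> p" "p \<le> 1 - a" using p1 p2 by (simp_all add: a_def)
      have pp: "0 < p" "p < 1" using pa a0 by linarith+
      have pq: "real n powr (-1/1000) \<le> p * (1 - p)"
      proof (cases "p \<le> 1/2")
        case True
        have "a * (1/2) \<le> p * (1 - p)" using pa pp a0 True by (intro mult_mono) auto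
        then show ?thesis using a by linarith
      next
        case False
        have "(1/2) * a \<le> p * (1 - p)" using pa pp a0 False by (intro mult_mono) auto
        then show ?thesis using a by linarith
      qed
      interpret bern: bernoulli p by unfold_locales (rule pp)+
      interpret regime p V R0 B0 n \<Delta> "\<lambda>a. real n powr a"
        by unfold_locales (use V r D pq in \<open>auto simp: bern.q_def\<close>)
      have "5 * real n powr (-1/1000) \<le> C * real n powr (-1/1000)" "13 * real n powr (-1/1000) \<le> C * real n powr (-1/1000)"
        using C(2) npos by (intro mult_right_mono; linarith)+
      then show ?thesis using prob_first prob_second unfolding tt_def by simp
    next
      case False
      have "1 = real n powr (1/1000) * real n powr (-(1/1000))" using n1 by (simp add: powr_minus)
      also have "\<dots> \<le> C * real n powr (-(1/1000))"
      proof (rule mult_right_mono)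
        have "real n powr (1/1000) \<le> real n0 powr (1/1000)" using False by (intro powr_mono2) auto
        then show "real n powr (1/1000) \<le> C" by (simp add: C_def)
      qed simp
      finally have 1: "1 \<le> C * real n powr (-(1/1000))" .
      have "0 \<le> ?P1" "0 \<le> ?P2" "?P2 \<le> 1" by simp_all
      moreover have "0 \<le> ?F" "?F \<le> 1" by (rule Phi_range)+
      ultimately show ?thesis using 1 by linarith
    qed
  qed
qed

end
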